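(* Let $\beta,\gamma\in(0,1)$ and $\rho>0$. There exist constants $a_1,a_2,c_1,c_2,c_3>0$, depending only on $\beta,\gamma,\rho$, such that the following holds. Let $\delta\in(0,1)$, $\varepsilon\in(0,1)$, $\alpha\in(0,1)$ with $\alpha<a_1$, $\nu=a_2\varepsilon$, $K=\lceil c_2/(\delta^2\alpha^3)\rceil$, $L=\lceil 2eK\rceil$, and $n\geq c_1/(\delta^5\alpha^9)$. Let $A$ be a deterministic $n\times n$ real matrix with $\|A\|=1$, let $V$ be an $n$-dimensional pattern matrix with parameters $\alpha,\beta,\gamma,\rho$, let $R_1,R_2$ be from the $n$-dimensional oblivious perturbation model with pattern matrix $V$ and parameters $\rho,K,L$, and let $M=A+\varepsilon(R_1+R_2)$. Then $$\mathbb{P}\Big(\inf_{v\in\mathrm{Incomp}(\alpha,\nu)}\|Mv\|_2\geq c_3\,\varepsilon^3\delta^2\alpha^3 n^{-1}\Big)\geq 1-\delta/2.$$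
   Context: $\|\cdot\|$ is the spectral norm, $[n]=\{1,\dots,n\}$, $S^{n-1}$ the unit sphere. Pattern matrix: for $\alpha,\beta,\gamma\in(0,1)$, $\rho>0$, an $n\times n$ matrix $V$ with entries in $\{-1,1\}$ with (i) $\|V\|\leq\rho\sqrt n$ and (ii) for every $\eta\in\{-1,1\}^n$ and every $x\in S^{n-1}$ with at most $\alpha n$ nonzero coordinates, $|\{j:|e_j^\top V\mathrm{diag}(\eta)x|\geq\beta\}|\geq\gamma n$ and $|\{j:|e_j^\top V^\top\mathrm{diag}(\eta)x|\geq\beta\}|\geq\gamma n$. Oblivious perturbation model (mutually independent random objects): $\eta_{k,i}$ ($k=1,2$, $i\in[n]$) i.i.d. Rademacher, $D_k=\mathrm{diag}(\eta_{k,1},\dots,\eta_{k,n})$, $R_1=(\rho\sqrt n)^{-1}D_1VD_2$; $J_1,\dots,J_n$ independent uniformly random $K$-subsets of $[n]$; $\bar h_{j,i}=\mathbf 1[j\in J_i]$; $H$ is $\bar H$ with each row having more than $L$ nonzeros replaced by zero; $X_{l,i}$ ($l\in[K],i\in[n]$) i.i.d. Rademacher; with $J_i=\{j(i,1)<\dots<j(i,K)\}$, $\bar R_2$ has entry $X_{l,i}/L$ at $(j(i,l),i)$ and $0$ elsewhere; $R_2=H\odot\bar R_2$ (entrywise product). $\mathrm{Comp}(\alpha,\nu)$ is the set of $x\in S^{n-1}$ within Euclidean distance $\nu$ of some $v\in S^{n-1}$ with at most $\alpha n$ nonzero coordinates, and $\mathrm{Incomp}(\alpha,\nu)=S^{n-1}\setminus\mathrm{Comp}(\alpha,\nu)$.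 *)

theory Defs
  imports
    "HOL-Probability.Probability"
    "Jordan_Normal_Form.Matrix"
begin

unbundle no vec_syntax

text \<open>
  The dimension is quantified inside the main statement, so vectors and matrices are those of
  \<^theory>\<open>Jordan_Normal_Form.Matrix\<close>, with index set \<open>{..<n}\<close> for \<open>[n]\<close>.
\<close>

definition l2_norm :: "real Matrix.vec \<Rightarrow> real" where
  "l2_norm x = sqrt (x \<bullet> x)"

definition unit_sphere :: "nat \<Rightarrow> real Matrix.vec set" where
  "unit_sphere n = {x \<in> carrier_vec n. l2_norm x = 1}"

definition spectral_norm :: "real Matrix.mat \<Rightarrow> real" where
  "spectral_norm A = (SUP x \<in> unit_sphere (dim_col A). l2_norm (A *\<^sub>v x))"

definition num_nonzero :: "real Matrix.vec \<Rightarrow> nat" where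
  "num_nonzero x = card {i. i < dim_vec x \<and> x $ i \<noteq> 0}"

definition Comp :: "nat \<Rightarrow> real \<Rightarrow> real \<Rightarrow> real Matrix.vec set" where
  "Comp n \<alpha> \<nu> = {x \<in> unit_sphere n.
     \<exists>v \<in> unit_sphere n. real (num_nonzero v) \<le> \<alpha> * real n \<and> l2_norm (x - v) \<le> \<nu>}"

definition Incomp :: "nat \<Rightarrow> real \<Rightarrow> real \<Rightarrow> real Matrix.vec set" where
  "Incomp n \<alpha> \<nu> = unit_sphere n - Comp n \<alpha> \<nu>"

definition pattern_matrix ::
  "nat \<Rightarrow> real \<Rightarrow> real \<Rightarrow> real \<Rightarrow> real \<Rightarrow> real Matrix.mat \<Rightarrow> bool" where
  "pattern_matrix n \<alpha> \<beta> \<gamma> \<rho> V \<longleftrightarrow>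
     V \<in> carrier_mat n n \<and>
     (\<forall>i<n. \<forall>j<n. V $$ (i, j) \<in> {-1, 1}) \<and>
     spectral_norm V \<le> \<rho> * sqrt (real n) \<and>
     (\<forall>\<eta> \<in> {..<n} \<rightarrow> {-1, 1}. \<forall>x \<in> unit_sphere n. real (num_nonzero x) \<le> \<alpha> * real n \<longrightarrow>
        real (card {j. j < n \<and> \<bar>(V * mat_diag n \<eta> *\<^sub>v x) $ j\<bar> \<ge> \<beta>}) \<ge> \<gamma> * real n \<and>
        real (card {j. j < n \<and> \<bar>(transpose_mat V * mat_diag n \<eta> *\<^sub>v x) $ j\<bar> \<ge> \<beta>}) \<ge> \<gamma> * real n)"

definition rademacher :: "real pmf" where
  "rademacher = pmf_of_set {-1, 1}"

text \<open>
  Joint law of the random inputs \<open>(\<eta>, J, X)\<close> of the oblivious perturbation model; mutual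
  independence is expressed by products of probability mass functions. All the random objects
  are functions of these inputs. The law is meaningful only for \<open>K \<le> n\<close>, since otherwise there
  are no \<open>K\<close>-subsets of \<open>{..<n}\<close>.
\<close>

type_synonym perturbation_input =
  "(nat \<times> nat \<Rightarrow> real) \<times> (nat \<Rightarrow> nat set) \<times> (nat \<times> nat \<Rightarrow> real)"

definition perturbation_law :: "nat \<Rightarrow> nat \<Rightarrow> perturbation_input pmf" where
  "perturbation_law n K =
     pair_pmf (Pi_pmf ({1, 2} \<times> {..<n}) 0 (\<lambda>_. rademacher))
       (pair_pmf (Pi_pmf {..<n} {} (\<lambda>_. pmf_of_set {S. S \<subseteq> {..<n} \<and> card S = K}))
         (Pi_pmf ({..<K} \<times> {..<n}) 0 (\<lambda>_. rademacher)))"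

definition R1 :: "nat \<Rightarrow> real \<Rightarrow> real Matrix.mat \<Rightarrow> perturbation_input \<Rightarrow> real Matrix.mat" where
  "R1 n \<rho> V = (\<lambda>(\<eta>, J, X).
     (1 / (\<rho> * sqrt (real n))) \<cdot>\<^sub>m
       (mat_diag n (\<lambda>i. \<eta> (1, i)) * V * mat_diag n (\<lambda>i. \<eta> (2, i))))"

definition H_bar :: "nat \<Rightarrow> (nat \<Rightarrow> nat set) \<Rightarrow> real Matrix.mat" where
  "H_bar n J = Matrix.mat n n (\<lambda>(j, i). if j \<in> J i then 1 else 0)"

definition H_trunc :: "nat \<Rightarrow> nat \<Rightarrow> (nat \<Rightarrow> nat set) \<Rightarrow> real Matrix.mat" where
  "H_trunc n L J = Matrix.mat n n (\<lambda>(j, i).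
     if num_nonzero (row (H_bar n J) j) > L then 0 else H_bar n J $$ (j, i))"

text \<open>
  \<open>sorted_list_of_set (J i) ! l\<close> is the \<open>l\<close>-th smallest element of \<open>J i\<close>, counting from \<open>0\<close>.
  At most one summand is nonzero when \<open>J i\<close> has \<open>K\<close> elements.
\<close>

definition R2_bar ::
  "nat \<Rightarrow> nat \<Rightarrow> nat \<Rightarrow> (nat \<Rightarrow> nat set) \<Rightarrow> (nat \<times> nat \<Rightarrow> real) \<Rightarrow> real Matrix.mat" where
  "R2_bar n K L J X = Matrix.mat n n (\<lambda>(j, i).
     \<Sum>l<K. if j = sorted_list_of_set (J i) ! l then X (l, i) / real L else 0)"

definition hadamard_prod :: "real Matrix.mat \<Rightarrow> real Matrix.mat \<Rightarrow> real Matrix.mat" where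
  "hadamard_prod A B = Matrix.mat (dim_row A) (dim_col A) (\<lambda>(j, i). A $$ (j, i) * B $$ (j, i))"

definition R2 :: "nat \<Rightarrow> nat \<Rightarrow> nat \<Rightarrow> perturbation_input \<Rightarrow> real Matrix.mat" where
  "R2 n K L = (\<lambda>(\<eta>, J, X). hadamard_prod (H_trunc n L J) (R2_bar n K L J X))"

end

theory Submission
  imports Defs
begin

text \<open>
  Let \<open>u\<^sub>i\<close> be a unit vector orthogonal to all columns of \<open>M\<close> but the \<open>i\<close>-th. Then
  \<open>\<parallel>M v\<parallel> \<ge> \<bar>v\<^sub>i\<bar> \<bar>\<langle>M\<^sub>i, u\<^sub>i\<rangle>\<bar>\<close>, and an incompressible \<open>v\<close> has more than \<open>\<alpha> n\<close> coordinates of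
  order \<open>\<epsilon> / \<surd>n\<close>. So if \<open>\<parallel>M v\<parallel>\<close> is small, then more than \<open>\<alpha> n\<close> of the \<open>\<langle>M\<^sub>i, u\<^sub>i\<rangle>\<close> are small, and
  by Markov's inequality it suffices to bound the probability of this for a single \<open>i\<close> by a small
  multiple of \<open>\<delta> \<alpha>\<close>. If \<open>u\<^sub>i\<close> has order \<open>\<alpha> n\<close> large coordinates in rows that survive the truncation,
  then order \<open>\<alpha> K\<close> of them lie in \<open>J\<^sub>i\<close> by Chebyshev's inequality, and the Littlewood--Offord
  inequality for the signs \<open>X\<close> gives a bound of order \<open>1 / \<surd>(\<alpha> K)\<close>. Few rows are truncated because
  \<open>L \<ge> 2 e K\<close>.

  It remains to see that \<open>u\<^sub>i\<close> is incompressible, that is, that \<open>M\<^sup>T u\<close> has many coordinates of order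
  \<open>\<epsilon> / \<surd>n\<close> for all sparse \<open>u\<close> simultaneously. For a fixed \<open>u\<close> this holds because the \<open>i\<close>-th coordinate
  cancels for at most one value of the sign \<open>\<eta>\<^sub>2\<^sub>,\<^sub>i\<close>. A net over \<open>u\<close> would cost a power of
  \<open>1 / \<epsilon>\<close>; instead, the cancelling signs depend only on the signs of affine functionals of \<open>u\<close>, whose
  number of patterns is bounded by the Sauer--Shelah lemma independently of \<open>\<epsilon>\<close>.
\<close>

subsection \<open>Littlewood--Offord anticoncentration\<close>

text \<open>Fubini. The premise is asked only on the support of \<open>p\<close>, so that facts that
  hold almost surely, such as the sizes of the sets \<open>J i\<close>, are available after
  conditioning.\<close>

lemma prob_pair_pmf_le_fst:
  assumes "\<And>x. x \<in> set_pmf p \<Longrightarrow> measure_pmf.prob q {y. (x, y) \<in> E} \<le> c" and "0 \<le> c"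
  shows "measure_pmf.prob (pair_pmf p q) E \<le> c"
proof -
  have "emeasure (pair_pmf p q) E = (\<integral>\<^sup>+x. emeasure q {y. (x, y) \<in> E} \<partial>p)"
  proof -
    have "emeasure (pair_pmf p q) E = (\<integral>\<^sup>+z. indicator E z \<partial>pair_pmf p q)" by simp
    also have "\<dots> = (\<integral>\<^sup>+x. \<integral>\<^sup>+y. indicator E (x, y) \<partial>q \<partial>p)"
      by (rule nn_integral_pair_pmf')
    also have "\<dots> = (\<integral>\<^sup>+x. \<integral>\<^sup>+y. indicator {y. (x, y) \<in> E} y \<partial>q \<partial>p)"
      by (intro nn_integral_cong) (auto simp: indicator_def)
    finally show ?thesis by simp
  qed
  also have "\<dots> \<le> (\<integral>\<^sup>+x. ennreal c \<partial>p)"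
    using assms
    by (intro nn_integral_mono_AE)
      (auto simp: AE_measure_pmf_iff measure_pmf.emeasure_eq_measure intro!: ennreal_leI)
  finally have "ennreal (measure_pmf.prob (pair_pmf p q) E) \<le> ennreal c"
    by (simp add: measure_pmf.emeasure_eq_measure)
  then show ?thesis using assms(2) by (simp add: ennreal_le_iff)
qed

lemma prob_pair_pmf_le_snd:
  assumes "\<And>y. y \<in> set_pmf q \<Longrightarrow> measure_pmf.prob p {x. (x, y) \<in> E} \<le> c" and "0 \<le> c"
  shows "measure_pmf.prob (pair_pmf p q) E \<le> c"
  unfolding pair_commute_pmf[of p q] measure_map_pmf
  by (rule prob_pair_pmf_le_fst) (use assms in \<open>auto simp: vimage_def\<close>)

text \<open>Reveals the coordinates in \<open>A\<close> and leaves those in \<open>B\<close> random.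
  Later \<open>B\<close> carries the signs of one column of \<open>X\<close>, or the signs
  \<open>\<eta> (2, i)\<close>.\<close>

lemma prob_Pi_pmf_split_le:
  assumes "finite A" "finite B" "A \<inter> B = {}"
    and "\<And>f. f \<in> set_pmf (Pi_pmf A d p) \<Longrightarrow>
      measure_pmf.prob (Pi_pmf B d p) {g. (\<lambda>x. if x \<in> A then f x else g x) \<in> E} \<le> c"
    and "0 \<le> c"
  shows "measure_pmf.prob (Pi_pmf (A \<union> B) d p) E \<le> c"
  unfolding Pi_pmf_union[OF assms(1-3)] measure_map_pmf
  by (rule prob_pair_pmf_le_fst) (use assms in \<open>auto simp: vimage_def\<close>)

text \<open>Redraws one coordinate with all others frozen; this serves to redraw \<open>J i\<close>
  alone.\<close>

lemma prob_Pi_pmf_coordinate_le: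
  assumes "finite A" "i \<in> A"
    and "\<And>f. f \<in> set_pmf (Pi_pmf (A - {i}) d p) \<Longrightarrow>
      measure_pmf.prob (p i) {y. f(i := y) \<in> E} \<le> c"
    and "0 \<le> c"
  shows "measure_pmf.prob (Pi_pmf A d p) E \<le> c"
proof -
  have A: "A = insert i (A - {i})" using assms(2) by auto
  have ins: "Pi_pmf (insert i (A - {i})) d p
      = map_pmf (\<lambda>(y, f). f(i := y)) (pair_pmf (p i) (Pi_pmf (A - {i}) d p))"
    by (rule Pi_pmf_insert) (use assms in auto)
  have "measure_pmf.prob (Pi_pmf (insert i (A - {i})) d p) E \<le> c"
    unfolding ins measure_map_pmf
    by (rule prob_pair_pmf_le_snd) (use assms in \<open>auto simp: vimage_def\<close>)
  then show ?thesis by (simp only: A[symmetric])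
qed

lemma prob_markov_finite:
  assumes fin: "finite (set_pmf p)" and "0 < c"
    and f: "\<And>x. x \<in> set_pmf p \<Longrightarrow> 0 \<le> (f x :: real)"
    and E: "\<And>x. x \<in> set_pmf p \<Longrightarrow> x \<in> E \<Longrightarrow> c \<le> f x"
  shows "measure_pmf.prob p E \<le> measure_pmf.expectation p f / c"
proof -
  have "measure_pmf.prob p E = measure_pmf.expectation p (indicator E)" by simp
  also have "\<dots> \<le> measure_pmf.expectation p (\<lambda>x. f x / c)"
  proof (rule integral_mono_AE)
    show "AE x in p. indicator E x \<le> f x / c"
      using f E \<open>0 < c\<close> by (auto simp: AE_measure_pmf_iff indicator_def field_simps)
  qed (auto intro: integrable_measure_pmf_finite fin)
  finally show ?thesis by simp
qed

lemma set_pmf_rademacher [simp]: "set_pmf rademacher = {-1, 1}"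
  by (simp add: rademacher_def)

lemma prob_Pi_pmf_rademacher_insert:
  assumes "finite A" "x \<notin> A"
  shows "measure_pmf.prob (Pi_pmf (insert x A) d (\<lambda>_. rademacher)) E =
    (measure_pmf.prob (Pi_pmf A d (\<lambda>_. rademacher)) {f. f(x := 1) \<in> E} +
     measure_pmf.prob (Pi_pmf A d (\<lambda>_. rademacher)) {f. f(x := -1) \<in> E}) / 2"
proof -
  let ?P = "Pi_pmf A d (\<lambda>_. rademacher)"
  let ?b = "bind_pmf (pmf_of_set {-1, 1 :: real}) (\<lambda>y. map_pmf (\<lambda>f. f(x := y)) ?P)"
  have eq: "Pi_pmf (insert x A) d (\<lambda>_. rademacher) = ?b"
    unfolding Pi_pmf_insert'[OF assms] map_pmf_def rademacher_def by simp
  have fin: "finite (set_pmf (map_pmf (\<lambda>f. f(x := y)) ?P))" for y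
    using assms(1) by (simp add: set_Pi_pmf finite_PiE_dflt)
  have "measure_pmf.prob ?b E = measure_pmf.expectation ?b (indicat_real E)"
    by simp
  also have "\<dots> = (\<Sum>y\<in>{-1, 1 :: real}.
          measure_pmf.expectation (map_pmf (\<lambda>f. f(x := y)) ?P) (indicat_real E) /\<^sub>R
            real (card {-1, 1 :: real}))"
    by (rule pmf_expectation_bind_pmf_of_set) (simp_all only: fin, simp_all)
  also have "\<dots> = (\<Sum>y\<in>{-1, 1 :: real}. measure_pmf.prob ?P {f. f(x := y) \<in> E} / 2)"
    by (simp add: vimage_def)
  finally show ?thesis unfolding eq by simp
qed

text \<open>The window of \<open>k\<close> middle binomial probabilities. It is the probability that a simple random
  walk started at \<open>k\<close> stays positive for \<open>m\<close> steps, and satisfies that walk's recursion.\<close>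

definition binom_prob :: "nat \<Rightarrow> int \<Rightarrow> real" where
  "binom_prob m j = (if j < 0 then 0 else real (m choose nat j) / 2 ^ m)"

definition mid_window :: "nat \<Rightarrow> nat \<Rightarrow> int set" where
  "mid_window m k = {j. int m - int k < 2 * j \<and> 2 * j \<le> int m + int k}"

definition mid_binom :: "nat \<Rightarrow> nat \<Rightarrow> real" where
  "mid_binom m k = (\<Sum>j\<in>mid_window m k. binom_prob m j)"

lemma binom_prob_Suc: "binom_prob (Suc m) j = (binom_prob m j + binom_prob m (j - 1)) / 2"
proof -
  consider "j < 0" | "j = 0" | i where "j = int (Suc i)"
    by (metis int_cases nat.exhaust negative_zless_0 of_nat_0)
  then show ?thesis
  proof cases
    case 3
    then have "nat j = Suc i" "nat (j - 1) = i" "\<not> j < 0" "\<not> j - 1 < 0" by auto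
    then show ?thesis by (simp add: binom_prob_def field_simps)
  qed (auto simp: binom_prob_def)
qed

lemma finite_mid_window [simp]: "finite (mid_window m k)"
  by (rule finite_subset[of _ "{- int m - int k .. int m + int k}"]) (auto simp: mid_window_def)

lemma mid_binom_0 [simp]: "mid_binom m 0 = 0"
proof -
  have "mid_window m 0 = {}" by (auto simp: mid_window_def)
  then show ?thesis by (simp add: mid_binom_def)
qed

lemma mid_binom_0_left: "1 \<le> mid_binom 0 (Suc k)"
proof -
  have "0 \<in> mid_window 0 (Suc k)" by (auto simp: mid_window_def)
  then have "binom_prob 0 0 \<le> mid_binom 0 (Suc k)"
    unfolding mid_binom_def by (intro member_le_sum) (auto simp: binom_prob_def)
  then show ?thesis by (simp add: binom_prob_def)
qed

lemma mid_binom_Suc: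
  "mid_binom (Suc m) (Suc k) = (mid_binom m (Suc (Suc k)) + mid_binom m k) / 2"
proof -
  define S where "S = mid_window (Suc m) (Suc k)"
  define T where "T = (\<lambda>j. j - 1) ` S"
  have T: "T = {j. j + 1 \<in> S}" by (force simp: T_def)
  have fin: "finite S" "finite T" by (simp_all add: S_def T_def)
  \<comment> \<open>\<open>T\<close> is \<open>S\<close> shifted down by one. The two cover the
    wider window for \<open>m\<close> and overlap in the narrower one, so the sums from Pascal's
    rule recombine by inclusion and exclusion.\<close>
  have un: "S \<union> T = mid_window m (Suc (Suc k))" "S \<inter> T = mid_window m k"
    unfolding T S_def mid_window_def by auto
  have "mid_binom (Suc m) (Suc k) = (\<Sum>j\<in>S. (binom_prob m j + binom_prob m (j - 1)) / 2)"
    unfolding mid_binom_def S_def by (simp add: binom_prob_Suc)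
  also have "\<dots> = ((\<Sum>j\<in>S. binom_prob m j) + (\<Sum>j\<in>T. binom_prob m j)) / 2"
    unfolding T_def by (subst sum.reindex) (auto simp: inj_on_def sum.distrib sum_divide_distrib[symmetric])
  also have "(\<Sum>j\<in>S. binom_prob m j) + (\<Sum>j\<in>T. binom_prob m j)
      = mid_binom m (Suc (Suc k)) + mid_binom m k"
    unfolding mid_binom_def using sum.union_inter[OF fin, of "binom_prob m"] un by simp
  finally show ?thesis .
qed

text \<open>The ratio of consecutive terms is (2n+1)/(2n+2), and the bound passes to n+1 because
  sqrt((2n+1)(2n+3)) is at most 2n+2.\<close>

lemma central_binomial_le: "real ((2 * n) choose n) / 4 ^ n \<le> 1 / sqrt (2 * real n + 1)"
proof (induction n)
  case (Suc n)
  have "Suc n * ((2 * Suc n) choose Suc n) = (2 * Suc n) * ((2 * n + 1) choose n)"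
    using Suc_times_binomial[of n "2 * n + 1"] by simp
  moreover have "Suc n * ((2 * n + 1) choose Suc n) = (2 * n + 1) * ((2 * n) choose n)"
    using Suc_times_binomial[of n "2 * n"] by simp
  moreover have "(2 * n + 1) choose n = (2 * n + 1) choose Suc n"
    using binomial_symmetric[of n "2 * n + 1"] by simp
  ultimately have "Suc n * (Suc n * ((2 * Suc n) choose Suc n))
      = Suc n * (2 * ((2 * n + 1) * ((2 * n) choose n)))"
    by (metis mult.assoc mult.commute)
  then have "Suc n * ((2 * Suc n) choose Suc n) = 2 * ((2 * n + 1) * ((2 * n) choose n))"
    by (simp only: mult_cancel1) simp
  then have "real (Suc n) * real ((2 * Suc n) choose Suc n)
      = 2 * ((2 * real n + 1) * real ((2 * n) choose n))"
    by (metis (mono_tags, opaque_lifting) of_nat_1 of_nat_add of_nat_mult of_nat_numeral)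
  moreover have "x / (4 * q) = (2 * m + 1) / (2 * m + 2) * (y / q)"
    if "(m + 1) * x = 2 * ((2 * m + 1) * y)" "0 < q" "0 \<le> m" for x y q m :: real
  proof -
    have "x = 2 * ((2 * m + 1) * y) / (m + 1)" using that by (simp add: field_simps)
    also have "\<dots> / (4 * q) = (2 * m + 1) / (2 * m + 2) * (y / q)"
      using that by (simp add: divide_simps)
    finally show ?thesis .
  qed
  ultimately have "real ((2 * Suc n) choose Suc n) / 4 ^ Suc n
      = (2 * real n + 1) / (2 * real n + 2) * (real ((2 * n) choose n) / 4 ^ n)"
    by (simp only: power_Suc of_nat_Suc) (simp add: add.commute)
  also have "\<dots> \<le> (2 * real n + 1) / (2 * real n + 2) * (1 / sqrt (2 * real n + 1))"
    by (rule mult_left_mono[OF Suc.IH]) simp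
  also have "\<dots> = sqrt (2 * real n + 1) / (2 * real n + 2)"
    by (simp add: real_div_sqrt field_simps)
  also have "\<dots> \<le> 1 / sqrt (2 * real (Suc n) + 1)"
  proof -
    have "sqrt (2 * real n + 1) * sqrt (2 * real n + 3) \<le> 2 * real n + 2"
      unfolding real_sqrt_mult[symmetric]
      by (rule real_le_lsqrt) (auto simp: power2_eq_square algebra_simps)
    then show ?thesis by (simp add: field_simps)
  qed
  finally show ?case .
qed simp

text \<open>A window of width one holds a single middle probability. For odd \<open>m\<close> it
  equals the central one for \<open>m\<close> + 1, because the central coefficient is twice its
  neighbour in the row above.\<close>

lemma mid_binom_1_le: "mid_binom m 1 \<le> 1 / sqrt (real m + 1)"
proof (cases "even m")
  case True
  then obtain h where m: "m = 2 * h" by auto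
  have "mid_window m 1 = {int h}" by (auto simp: mid_window_def m)
  then have "mid_binom m 1 = real ((2 * h) choose h) / 4 ^ h"
    by (simp add: mid_binom_def binom_prob_def m power_mult)
  then show ?thesis using central_binomial_le[of h] by (simp add: m)
next
  case False
  then obtain h where m: "m = 2 * h + 1" by (auto elim: oddE)
  have "mid_window m 1 = {int (Suc h)}" by (auto simp: mid_window_def m)
  moreover have "(2 * Suc h) choose Suc h = 2 * ((2 * h + 1) choose Suc h)"
    using binomial_symmetric[of h "2 * h + 1"] by simp
  ultimately have "mid_binom m 1 = real ((2 * Suc h) choose Suc h) / 4 ^ Suc h"
    by (simp add: mid_binom_def binom_prob_def m power_mult nat_add_distrib power2_eq_square[symmetric] power_mult_distrib[symmetric] add_divide_distrib)
  also have "\<dots> \<le> 1 / sqrt (2 * real (Suc h) + 1)" by (rule central_binomial_le)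
  also have "\<dots> \<le> 1 / sqrt (real m + 1)"
    by (intro divide_left_mono) (auto simp: m)
  finally show ?thesis .
qed

text \<open>Kleitman's argument: the windows for the two values of a large summand are shifted by at least
  their width, so the last of the upper windows may be traded to the lower ones.\<close>

lemma littlewood_offord_windows:
  fixes a :: "'a \<Rightarrow> real" and t :: "nat \<Rightarrow> real"
  assumes "finite A" "0 < r" and "\<And>s. Suc s < k \<Longrightarrow> t s + 2 * r \<le> t (Suc s)"
  shows "measure_pmf.prob (Pi_pmf A 0 (\<lambda>_. rademacher))
      {X. \<exists>s<k. t s \<le> (\<Sum>l\<in>A. a l * X l) \<and> (\<Sum>l\<in>A. a l * X l) < t s + 2 * r}
    \<le> mid_binom (card {l \<in> A. r \<le> \<bar>a l\<bar>}) k"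
  using assms(1,3)
proof (induction A arbitrary: k t rule: finite_induct)
  case empty
  show ?case
  proof (cases k)
    case (Suc k')
    show ?thesis unfolding Suc using mid_binom_0_left[of k']
      by (simp del: pmf_Pi_empty)
  qed simp
next
  case (insert x A)
  let ?P = "Pi_pmf A 0 (\<lambda>_. rademacher)"
  define F where "F k t = {X. \<exists>s<k. t s \<le> (\<Sum>l\<in>A. a l * X l) \<and> (\<Sum>l\<in>A. a l * X l) < t s + 2 * r}"
    for k :: nat and t :: "nat \<Rightarrow> real"
  define m where "m = card {l \<in> A. r \<le> \<bar>a l\<bar>}"
  have IH: "measure_pmf.prob ?P (F k t) \<le> mid_binom m k"
    if "\<And>s. Suc s < k \<Longrightarrow> t s + 2 * r \<le> t (Suc s)" for k t
    unfolding F_def m_def by (rule insert.IH) (rule that)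
  have sum_upd: "(\<Sum>l\<in>A. a l * (X(x := y)) l) = (\<Sum>l\<in>A. a l * X l)" for X :: "'a \<Rightarrow> real" and y
    using insert.hyps by (intro sum.cong) auto
  \<comment> \<open>Fixing the new sign moves every window down or up by \<open>b\<close>; the sign
    of \<open>a x\<close> only decides which value does which.\<close>
  define b where "b = \<bar>a x\<bar>"
  let ?lo = "\<lambda>s. t s - b" and ?hi = "\<lambda>s. t s + b"
  have eq: "measure_pmf.prob (Pi_pmf (insert x A) 0 (\<lambda>_. rademacher))
      {X. \<exists>s<k. t s \<le> (\<Sum>l\<in>insert x A. a l * X l) \<and> (\<Sum>l\<in>insert x A. a l * X l) < t s + 2 * r}
    = (measure_pmf.prob ?P (F k ?lo) + measure_pmf.prob ?P (F k ?hi)) / 2"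
  proof (cases "0 \<le> a x")
    case True
    then show ?thesis
      unfolding prob_Pi_pmf_rademacher_insert[OF insert.hyps] F_def b_def
      by (simp add: insert.hyps sum_upd algebra_simps del: fun_upd_apply) (simp add: algebra_simps)
  next
    case False
    then show ?thesis
      unfolding prob_Pi_pmf_rademacher_insert[OF insert.hyps] F_def b_def
      by (simp add: insert.hyps sum_upd algebra_simps del: fun_upd_apply) (simp add: algebra_simps)
  qed
  have gaps: "\<And>s. Suc s < k \<Longrightarrow> t s + 2 * r \<le> t (Suc s)" by (rule insert.prems)
  show ?case
  proof (cases "r \<le> \<bar>a x\<bar>")
    case False
    then have "{l \<in> insert x A. r \<le> \<bar>a l\<bar>} = {l \<in> A. r \<le> \<bar>a l\<bar>}" by auto
    moreover have "measure_pmf.prob ?P (F k ?lo) \<le> mid_binom m k"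
      "measure_pmf.prob ?P (F k ?hi) \<le> mid_binom m k"
      by (rule IH, use gaps in force)+
    ultimately show ?thesis unfolding eq by (simp add: m_def)
  next
    case True
    then have "{l \<in> insert x A. r \<le> \<bar>a l\<bar>} = insert x {l \<in> A. r \<le> \<bar>a l\<bar>}" by auto
    then have card: "card {l \<in> insert x A. r \<le> \<bar>a l\<bar>} = Suc m"
      using insert.hyps by (simp add: m_def)
    show ?thesis
    proof (cases k)
      case 0
      then show ?thesis by simp
    next
      case (Suc k')
      \<comment> \<open>After the trade there are k+1 lower windows, whose last gap is
        \<open>2 * b\<close>, at least \<open>2 * r\<close>, and k-1 upper windows with their old
        gaps. The induction hypothesis applies to both families, and \<open>mid_binom_Suc\<close>
        averages the two bounds.\<close>
      let ?lo' = "\<lambda>s. if s \<le> k' then t s - b else t k' + b"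
      have lo: "measure_pmf.prob ?P (F (Suc k) ?lo') \<le> mid_binom m (Suc k)"
      proof (rule IH)
        fix s assume s: "Suc s < Suc k"
        show "?lo' s + 2 * r \<le> ?lo' (Suc s)"
        proof (cases "s = k'")
          case True
          then show ?thesis using \<open>r \<le> \<bar>a x\<bar>\<close> by (simp add: b_def)
        next
          case False
          then show ?thesis using gaps[of s] s Suc by simp
        qed
      qed
      have hi: "measure_pmf.prob ?P (F k' ?hi) \<le> mid_binom m k'"
        by (rule IH) (use gaps Suc in force)
      define N where "N = {X. t k' + b \<le> (\<Sum>l\<in>A. a l * X l) \<and> (\<Sum>l\<in>A. a l * X l) < t k' + b + 2 * r}"
      \<comment> \<open>The traded window starts at \<open>t k' + b\<close>, where all lower windows
        have already ended. Its probability therefore adds exactly to theirs.\<close>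
      have disj: "F k ?lo \<inter> N = {}"
      proof -
        have mono: "t s \<le> t k'" if "s \<le> k'" for s
          using that
        proof (induction rule: inc_induct)
          case (step i)
          then show ?case using gaps[of i] Suc \<open>0 < r\<close> by simp
        qed simp
        have "False" if "X \<in> F k ?lo" "X \<in> N" for X
        proof -
          from that obtain s where s: "s < k" "(\<Sum>l\<in>A. a l * X l) < t s - b + 2 * r"
            and "t k' + b \<le> (\<Sum>l\<in>A. a l * X l)"
            by (auto simp: F_def N_def)
          moreover have "t s \<le> t k'" using mono s Suc by simp
          ultimately show False using True by (simp add: b_def)
        qed
        then show ?thesis by blast
      qed
      define Q where "Q y X \<longleftrightarrow> y \<le> (\<Sum>l\<in>A. a l * X l) \<and> (\<Sum>l\<in>A. a l * X l) < y + 2 * r" for y X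
      have FQ: "F k t = {X. \<exists>s<k. Q (t s) X}" for k t by (simp add: F_def Q_def)
      have NQ: "N = {X. Q (t k' + b) X}" by (simp add: N_def Q_def)
      have lo_eq: "?lo' s = ?lo s" if "s < k" for s using that Suc by simp
      have "(\<exists>s<Suc k. Q (?lo' s) X) \<longleftrightarrow> (\<exists>s<k. Q (?lo s) X) \<or> Q (t k' + b) X" for X
        unfolding Ex_less_Suc using lo_eq Suc by (metis not_less_eq_eq order.refl)
      then have "F (Suc k) ?lo' = F k ?lo \<union> N"
        unfolding FQ NQ by blast
      then have "measure_pmf.prob ?P (F (Suc k) ?lo')
          = measure_pmf.prob ?P (F k ?lo) + measure_pmf.prob ?P N"
        using disj by (simp add: measure_pmf.finite_measure_Union)
      moreover have "F k ?hi = F k' ?hi \<union> N"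
        unfolding FQ NQ Suc Ex_less_Suc by blast
      then have "measure_pmf.prob ?P (F k ?hi)
          \<le> measure_pmf.prob ?P (F k' ?hi) + measure_pmf.prob ?P N"
        by (simp add: measure_Un_le)
      ultimately have "measure_pmf.prob ?P (F k ?lo) + measure_pmf.prob ?P (F k ?hi)
          \<le> mid_binom m (Suc k) + mid_binom m k'"
        using lo hi by linarith
      then show ?thesis unfolding eq card using Suc by (simp add: mid_binom_Suc)
    qed
  qed
qed

text \<open>The case of a single window: the half-open interval of length \<open>2 * r\<close>
  starting at \<open>- b - r\<close> contains the event.\<close>

lemma littlewood_offord:
  fixes a :: "'a \<Rightarrow> real"
  assumes "finite A" "0 < r"
  shows "measure_pmf.prob (Pi_pmf A 0 (\<lambda>_. rademacher)) {X. \<bar>b + (\<Sum>l\<in>A. a l * X l)\<bar> < r}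
    \<le> 1 / sqrt (real (card {l \<in> A. r \<le> \<bar>a l\<bar>}) + 1)"
proof -
  let ?P = "Pi_pmf A 0 (\<lambda>_. rademacher)"
  have "measure_pmf.prob ?P {X. \<bar>b + (\<Sum>l\<in>A. a l * X l)\<bar> < r}
    \<le> measure_pmf.prob ?P {X. \<exists>s<(1::nat). - b - r \<le> (\<Sum>l\<in>A. a l * X l) \<and> (\<Sum>l\<in>A. a l * X l) < - b - r + 2 * r}"
    by (rule measure_pmf.finite_measure_mono) auto
  also have "\<dots> \<le> mid_binom (card {l \<in> A. r \<le> \<bar>a l\<bar>}) 1"
    using littlewood_offord_windows[OF assms, of "1::nat" "\<lambda>_::nat. - b - r" a] by simp
  also have "\<dots> \<le> 1 / sqrt (real (card {l \<in> A. r \<le> \<bar>a l\<bar>}) + 1)"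
    by (rule mid_binom_1_le)
  finally show ?thesis .
qed

subsection \<open>Uniformly random subsets\<close>

definition card_subsets :: "nat \<Rightarrow> nat \<Rightarrow> nat set set" where
  "card_subsets n K = {S. S \<subseteq> {..<n} \<and> card S = K}"

lemma finite_card_subsets [simp]: "finite (card_subsets n K)"
  by (simp add: card_subsets_def)

lemma card_card_subsets: "card (card_subsets n K) = n choose K"
  using n_subsets[of "{..<n}" K] by (simp add: card_subsets_def)

lemma card_subsets_nonempty:
  assumes "K \<le> n"
  shows "card_subsets n K \<noteq> {}"
proof -
  have "{..<K} \<in> card_subsets n K" using assms by (auto simp: card_subsets_def)
  then show ?thesis by blast
qed

lemma card_card_subsets_containing:
  assumes "B \<subseteq> {..<n}" "card B \<le> K"
  shows "card {S \<in> card_subsets n K. B \<subseteq> S} = (n - card B) choose (K - card B)"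
proof -
  have finB: "finite B" using assms(1) finite_subset by blast
  have "bij_betw (\<lambda>S. S - B) {S \<in> card_subsets n K. B \<subseteq> S}
      {T. T \<subseteq> {..<n} - B \<and> card T = K - card B}"
  proof (rule bij_betw_byWitness[where f' = "\<lambda>T. T \<union> B"])
    show "(\<lambda>S. S - B) ` {S \<in> card_subsets n K. B \<subseteq> S}
        \<subseteq> {T. T \<subseteq> {..<n} - B \<and> card T = K - card B}"
      using finB by (auto simp: card_subsets_def card_Diff_subset)
    have "card (T \<union> B) = K" if "T \<subseteq> {..<n} - B" "card T = K - card B" for T
    proof -
      have "finite T" using that(1) finite_subset by blast
      then have "card (T \<union> B) = card T + card B"
        using that finB by (intro card_Un_disjoint) auto
      then show ?thesis using that assms by simp
    qed
    then show "(\<lambda>T. T \<union> B) ` {T. T \<subseteq> {..<n} - B \<and> card T = K - card B}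
        \<subseteq> {S \<in> card_subsets n K. B \<subseteq> S}"
      using assms(1) by (auto simp: card_subsets_def)
  qed auto
  then have "card {S \<in> card_subsets n K. B \<subseteq> S}
      = card {T. T \<subseteq> {..<n} - B \<and> card T = K - card B}"
    by (rule bij_betw_same_card)
  also have "\<dots> = (n - card B) choose (K - card B)"
    using n_subsets[of "{..<n} - B" "K - card B"] assms(1) finB by (simp add: card_Diff_subset)
  finally show ?thesis .
qed

lemma card_subsets_containing_1:
  assumes "j < n" "1 \<le> K"
  shows "real (card {S \<in> card_subsets n K. j \<in> S}) = real K / real n * real (n choose K)"
proof -
  have "card {S \<in> card_subsets n K. j \<in> S} = (n - 1) choose (K - 1)"
    using card_card_subsets_containing[of "{j}" n K] assms by simp
  moreover have "K * (n choose K) = n * ((n - 1) choose (K - 1))"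
    using times_binomial_minus1_eq[of K n] assms by simp
  then have "real K * real (n choose K) = real n * real ((n - 1) choose (K - 1))"
    by (metis of_nat_mult)
  ultimately show ?thesis using assms by (simp add: field_simps)
qed

text \<open>Two memberships are not positively correlated, since (K-1)/(n-1) is at most K/n. This is
  the second-moment input for Chebyshev's inequality.\<close>

lemma card_subsets_containing_2:
  assumes "j < n" "j' < n" "j \<noteq> j'" "1 \<le> K" "K \<le> n"
  shows "real (card {S \<in> card_subsets n K. j \<in> S \<and> j' \<in> S})
    \<le> (real K / real n)\<^sup>2 * real (n choose K)"
\<comment> \<open>For \<open>K\<close> = 1 the truncated difference \<open>K - 2\<close> would
  wrongly count one set, so this case is settled separately.\<close>
proof (cases "K = 1")
  case True
  have "{S \<in> card_subsets n K. j \<in> S \<and> j' \<in> S} = {}"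
    using True assms(3) by (auto simp: card_subsets_def card_1_singleton_iff)
  then show ?thesis by (simp only: card.empty of_nat_0) simp
next
  case False
  then have K: "2 \<le> K" using assms by simp
  have "card {S \<in> card_subsets n K. j \<in> S \<and> j' \<in> S} = (n - 2) choose (K - 2)"
    using card_card_subsets_containing[of "{j, j'}" n K] assms K by (simp add: numeral_2_eq_2)
  moreover have "(K - 1) * ((n - 1) choose (K - 1)) = (n - 1) * ((n - 2) choose (K - 2))"
    using times_binomial_minus1_eq[of "K - 1" "n - 1"] K by (simp add: numeral_2_eq_2)
  then have "real (K - 1) * real ((n - 1) choose (K - 1)) = real (n - 1) * real ((n - 2) choose (K - 2))"
    by (metis of_nat_mult)
  moreover have "K * (n choose K) = n * ((n - 1) choose (K - 1))"
    using times_binomial_minus1_eq[of K n] assms by simp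
  then have "real K * real (n choose K) = real n * real ((n - 1) choose (K - 1))"
    by (metis of_nat_mult)
  moreover have n: "0 < real (n - 1)" "0 < real n" using K assms by auto
  ultimately have eq: "real (card {S \<in> card_subsets n K. j \<in> S \<and> j' \<in> S})
      = real (K - 1) / real (n - 1) * (real K / real n * real (n choose K))"
    by (simp add: field_simps)
  have "real (K - 1) / real (n - 1) \<le> real K / real n"
    using n K assms by (simp add: field_simps of_nat_diff)
  then have "real (K - 1) / real (n - 1) * (real K / real n * real (n choose K))
      \<le> real K / real n * (real K / real n * real (n choose K))"
    by (rule mult_right_mono) simp
  then show ?thesis unfolding eq by (simp add: power2_eq_square mult.assoc)
qed

text \<open>Chebyshev's inequality. In the second moment the off-diagonal pairs contribute at most
  the squared mean and the diagonal adds \<mu>, so the variance is at most \<mu>, while the event is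
  a deviation by \<mu>/2.\<close>

lemma prob_hypergeometric_lower:
  fixes T :: "nat set" and n K :: nat
  defines "\<mu> \<equiv> real K * real (card T) / real n"
  assumes "1 \<le> K" "K \<le> n" "T \<subseteq> {..<n}" "0 < card T"
  shows "measure_pmf.prob (pmf_of_set (card_subsets n K)) {S. real (card (S \<inter> T)) < \<mu> / 2} \<le> 4 / \<mu>"
proof -
  define C where "C = real (n choose K)"
  define N where "N S = real (card (S \<inter> T))" for S
  define p where "p = real K / real n"
  let ?\<S> = "card_subsets n K"
  have finT: "finite T" using assms finite_subset by blast
  have n: "0 < n" using assms by simp
  have \<mu>: "0 < \<mu>" using assms by (simp add: \<mu>_def)
  have \<mu>': "\<mu> = p * real (card T)" by (simp add: \<mu>_def p_def)
  have C: "0 < C" using assms by (simp add: C_def)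
  have N: "N S = (\<Sum>j\<in>T. of_bool (j \<in> S))" for S
    using finT by (simp add: N_def Int_commute)
  have "(\<Sum>S\<in>?\<S>. N S) = (\<Sum>j\<in>T. \<Sum>S\<in>?\<S>. of_bool (j \<in> S))"
    unfolding N by (rule sum.swap)
  also have "\<dots> = (\<Sum>j\<in>T. p * C)"
  proof (rule sum.cong[OF refl])
    fix j assume "j \<in> T"
    then have "j < n" using assms by auto
    then show "(\<Sum>S\<in>?\<S>. of_bool (j \<in> S)) = p * C"
      using card_subsets_containing_1[of j n K] assms
      by (simp add: C_def p_def Int_def)
  qed
  finally have sum1: "(\<Sum>S\<in>?\<S>. N S) = \<mu> * C" by (simp add: \<mu>' algebra_simps)
  have "(\<Sum>S\<in>?\<S>. (N S)\<^sup>2) = (\<Sum>S\<in>?\<S>. \<Sum>j\<in>T. \<Sum>j'\<in>T. of_bool (j \<in> S \<and> j' \<in> S))"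
    unfolding N power2_eq_square sum_product by (simp add: of_bool_conj)
  also have "\<dots> = (\<Sum>j\<in>T. \<Sum>S\<in>?\<S>. \<Sum>j'\<in>T. of_bool (j \<in> S \<and> j' \<in> S))"
    by (rule sum.swap)
  also have "\<dots> = (\<Sum>j\<in>T. \<Sum>j'\<in>T. \<Sum>S\<in>?\<S>. of_bool (j \<in> S \<and> j' \<in> S))"
    by (intro sum.cong refl sum.swap)
  also have "\<dots> \<le> (\<Sum>j\<in>T. \<Sum>j'\<in>T. p\<^sup>2 * C + (if j' = j then p * C else 0))"
  proof (intro sum_mono)
    fix j j' assume "j \<in> T" "j' \<in> T"
    then have j: "j < n" "j' < n" using assms by auto
    show "(\<Sum>S\<in>?\<S>. of_bool (j \<in> S \<and> j' \<in> S)) \<le> p\<^sup>2 * C + (if j' = j then p * C else 0)"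
    proof (cases "j' = j")
      case True
      then show ?thesis
        using card_subsets_containing_1[of j n K] assms j C
        by (simp add: C_def p_def Int_def)
    next
      case False
      then show ?thesis
        using card_subsets_containing_2[of j n j' K] assms j
        by (simp add: C_def p_def Int_def)
    qed
  qed
  also have "\<dots> = (\<Sum>j\<in>T. real (card T) * (p\<^sup>2 * C) + p * C)"
    using finT by (intro sum.cong refl) (simp add: sum.distrib)
  also have "\<dots> = \<mu>\<^sup>2 * C + \<mu> * C"
    by (simp add: \<mu>' algebra_simps power2_eq_square)
  finally have sum2: "(\<Sum>S\<in>?\<S>. (N S)\<^sup>2) \<le> \<mu>\<^sup>2 * C + \<mu> * C" .
  have "(\<Sum>S\<in>?\<S>. (N S - \<mu>)\<^sup>2) = (\<Sum>S\<in>?\<S>. (N S)\<^sup>2) - 2 * \<mu> * (\<Sum>S\<in>?\<S>. N S) + \<mu>\<^sup>2 * C"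
    by (simp add: power2_diff sum.distrib sum_subtractf sum_distrib_left C_def card_card_subsets
        mult.assoc mult.commute mult.left_commute)
  also have "\<dots> \<le> \<mu> * C" using sum2 by (simp add: sum1 power2_eq_square algebra_simps)
  finally have var: "(\<Sum>S\<in>?\<S>. (N S - \<mu>)\<^sup>2) \<le> \<mu> * C" .
  have "measure_pmf.prob (pmf_of_set ?\<S>) {S. N S < \<mu> / 2}
      \<le> measure_pmf.expectation (pmf_of_set ?\<S>) (\<lambda>S. (N S - \<mu>)\<^sup>2) / (\<mu> / 2)\<^sup>2"
  proof (rule prob_markov_finite)
    show "finite (set_pmf (pmf_of_set ?\<S>))"
      using card_subsets_nonempty[OF \<open>K \<le> n\<close>] by simp
    show "0 < (\<mu> / 2)\<^sup>2" using \<mu> by simp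
    fix S assume "S \<in> {S. N S < \<mu> / 2}"
    then have "\<mu> / 2 \<le> \<mu> - N S" by simp
    then have "(\<mu> / 2)\<^sup>2 \<le> (\<mu> - N S)\<^sup>2" using \<mu> by (intro power_mono) auto
    then show "(\<mu> / 2)\<^sup>2 \<le> (N S - \<mu>)\<^sup>2" by (simp add: power2_commute)
  qed simp
  also have "measure_pmf.expectation (pmf_of_set ?\<S>) (\<lambda>S. (N S - \<mu>)\<^sup>2)
      = (\<Sum>S\<in>?\<S>. (N S - \<mu>)\<^sup>2) / C"
    using card_subsets_nonempty[OF \<open>K \<le> n\<close>]
    by (simp add: integral_pmf_of_set C_def card_card_subsets)
  also have "\<dots> \<le> \<mu>" using var C by (simp add: field_simps)
  finally have "measure_pmf.prob (pmf_of_set ?\<S>) {S. N S < \<mu> / 2} \<le> \<mu> / (\<mu> / 2)\<^sup>2"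
    using \<mu> by (simp add: divide_right_mono)
  also have "\<mu> / (\<mu> / 2)\<^sup>2 = 4 / \<mu>" using \<mu> by (simp add: power2_eq_square field_simps)
  finally show ?thesis by (simp add: N_def)
qed

section \<open>Row counts of independent random subsets\<close>

text \<open>This is the number of nonzeros of row \<open>j\<close> of \<open>H_bar n J\<close>, so a
  row is truncated exactly when \<open>L < row_count n J j\<close>.\<close>

definition row_count :: "nat \<Rightarrow> (nat \<Rightarrow> nat set) \<Rightarrow> nat \<Rightarrow> nat" where
  "row_count n J j = card {i. i < n \<and> j \<in> J i}"

definition subsets_law :: "nat \<Rightarrow> nat \<Rightarrow> (nat \<Rightarrow> nat set) pmf" where
  "subsets_law n K = Pi_pmf {..<n} {} (\<lambda>_. pmf_of_set (card_subsets n K))"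

lemma set_subsets_law:
  assumes "K \<le> n" "J \<in> set_pmf (subsets_law n K)" "i < n"
  shows "J i \<subseteq> {..<n}" "card (J i) = K"
  using assms card_subsets_nonempty[OF assms(1)]
  by (auto simp: subsets_law_def set_Pi_pmf PiE_dflt_def card_subsets_def)

lemma finite_set_subsets_law:
  assumes "K \<le> n"
  shows "finite (set_pmf (subsets_law n K))"
  using card_subsets_nonempty[OF assms]
  by (auto simp: subsets_law_def set_Pi_pmf intro!: finite_PiE_dflt)

text \<open>By independence of the sets the expectation is (1 + 3K/n)^n. The base 4 leaves a factor
  2 to the power of the count after division by 2^L on heavy rows, while exp(3K) remains far below
  2^L.\<close>

lemma expectation_power_row_count:
  assumes "1 \<le> K" "K \<le> n" "j < n"
  shows "measure_pmf.expectation (subsets_law n K) (\<lambda>J. 4 ^ row_count n J j :: real) \<le> exp (3 * real K)"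
proof -
  have ne: "card_subsets n K \<noteq> {}" by (rule card_subsets_nonempty[OF assms(2)])
  have "(4::real) ^ row_count n J j = (\<Prod>i<n. if j \<in> J i then 4 else 1)" for J
  proof -
    have "{i. i < n \<and> j \<in> J i} = {i \<in> {..<n}. j \<in> J i}" by auto
    then show ?thesis by (simp add: row_count_def prod.If_cases Int_def)
  qed
  then have "measure_pmf.expectation (subsets_law n K) (\<lambda>J. 4 ^ row_count n J j :: real)
      = measure_pmf.expectation (subsets_law n K) (\<lambda>J. \<Prod>i<n. if j \<in> J i then 4 else 1)"
    by simp
  also have "\<dots> = (\<Prod>i<n. measure_pmf.expectation (pmf_of_set (card_subsets n K))
      (\<lambda>S. if j \<in> S then 4 else 1))"
    unfolding subsets_law_def
    by (rule expectation_prod_Pi_pmf) (use ne in \<open>simp_all add: integrable_measure_pmf_finite\<close>)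
  also have "measure_pmf.expectation (pmf_of_set (card_subsets n K)) (\<lambda>S. if j \<in> S then 4 else 1)
      = 1 + 3 * (real K / real n)"
  proof -
    have "(\<Sum>S\<in>card_subsets n K. if j \<in> S then 4 else 1)
        = (\<Sum>S\<in>card_subsets n K. 1 + 3 * of_bool (j \<in> S) :: real)"
      by (intro sum.cong) auto
    also have "\<dots> = real (n choose K) + 3 * real (card {S \<in> card_subsets n K. j \<in> S})"
      by (simp add: sum.distrib sum_distrib_left[symmetric] card_card_subsets Int_def)
    also have "\<dots> = (1 + 3 * (real K / real n)) * real (n choose K)"
      using card_subsets_containing_1[of j n K] assms by (simp add: algebra_simps)
    finally show ?thesis
      using ne assms by (simp add: integral_pmf_of_set card_card_subsets)
  qed
  also have "(\<Prod>i<n. 1 + 3 * (real K / real n)) \<le> (\<Prod>i<n. exp (3 * (real K / real n)))"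
    by (intro prod_mono) (auto simp: exp_ge_add_one_self)
  also have "\<dots> = exp (3 * real K)"
    using assms by (simp add: exp_of_nat_mult[symmetric])
  finally show ?thesis .
qed

subsection \<open>Sign patterns of affine functionals\<close>

text \<open>Gaussian elimination with more unknowns than equations. It yields both the linear
  relation behind the count of sign patterns and the normal vectors.\<close>

lemma ex_nontrivial_solution:
  fixes a :: "'e \<Rightarrow> 'b \<Rightarrow> real"
  assumes "finite E" "finite B" "card E < card B"
  shows "\<exists>x. (\<exists>b\<in>B. x b \<noteq> 0) \<and> (\<forall>e\<in>E. (\<Sum>b\<in>B. a e b * x b) = 0)"
  using assms
proof (induction E arbitrary: a B rule: finite_induct)
  case empty
  then have "B \<noteq> {}" by auto
  then show ?case by (intro exI[of _ "\<lambda>_. 1"]) auto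
next
  case (insert e E)
  show ?case
  proof (cases "\<forall>b\<in>B. a e b = 0")
    case True
    have "card E < card B" using insert by simp
    then obtain x where "\<exists>b\<in>B. x b \<noteq> 0" "\<forall>e\<in>E. (\<Sum>b\<in>B. a e b * x b) = 0"
      using insert.IH[OF insert.prems(1), of a] by blast
    then show ?thesis using True by (intro exI[of _ x]) auto
  next
    case False
    then obtain c where c: "c \<in> B" "a e c \<noteq> 0" by auto
    \<comment> \<open>The equation \<open>e\<close> is solved for the unknown \<open>c\<close> and
      substituted into the others.\<close>
    define a' where "a' e' b = a e' b - a e' c * a e b / a e c" for e' b
    have "card E < card (B - {c})" using insert c by simp
    then obtain x where x: "\<exists>b\<in>B - {c}. x b \<noteq> 0" "\<forall>e'\<in>E. (\<Sum>b\<in>B - {c}. a' e' b * x b) = 0"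
      using insert.IH[of "B - {c}" a'] insert.prems by auto
    define s where "s = (\<Sum>b\<in>B - {c}. a e b * x b)"
    define y where "y = x(c := - s / a e c)"
    have sum_y: "(\<Sum>b\<in>B. a e' b * y b) = (\<Sum>b\<in>B - {c}. a e' b * x b) - a e' c * s / a e c" for e'
    proof -
      have "(\<Sum>b\<in>B. a e' b * y b) = a e' c * y c + (\<Sum>b\<in>B - {c}. a e' b * y b)"
        using c insert.prems by (simp add: sum.remove)
      also have "(\<Sum>b\<in>B - {c}. a e' b * y b) = (\<Sum>b\<in>B - {c}. a e' b * x b)"
        by (intro sum.cong) (auto simp: y_def)
      finally show ?thesis by (simp add: y_def)
    qed
    have "(\<Sum>b\<in>B. a e b * y b) = 0" using c by (simp add: sum_y s_def)
    moreover have "(\<Sum>b\<in>B. a e' b * y b) = 0" if "e' \<in> E" for e'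
    proof -
      have "(\<Sum>b\<in>B - {c}. a' e' b * x b) = (\<Sum>b\<in>B - {c}. a e' b * x b) - a e' c * s / a e c"
        unfolding a'_def s_def
        by (simp add: left_diff_distrib sum_subtractf sum_distrib_left sum_divide_distrib mult.assoc)
      then show ?thesis using x that by (simp add: sum_y)
    qed
    moreover have "\<exists>b\<in>B. y b \<noteq> 0" using x(1) by (auto simp: y_def)
    ultimately show ?thesis by (intro exI[of _ y]) auto
  qed
qed

section \<open>Shattered sets and the number of sign patterns\<close>

definition shatters :: "'a set set \<Rightarrow> 'a set \<Rightarrow> bool" where
  "shatters \<F> B \<longleftrightarrow> (\<forall>C\<subseteq>B. \<exists>Z\<in>\<F>. Z \<inter> B = C)"

text \<open>Split the family at \<open>x\<close> into the traces \<open>F0\<close> and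
  \<open>F1\<close>. Their sizes add up to those of their union and intersection. Sets shattered by
  the union are shattered by the family, and sets shattered by the intersection stay shattered after
  adding \<open>x\<close>; the two kinds differ in whether they contain \<open>x\<close>.\<close>

lemma pajor:
  assumes "finite I" "\<F> \<subseteq> Pow I"
  shows "card \<F> \<le> card {B. B \<subseteq> I \<and> shatters \<F> B}"
  using assms
proof (induction I arbitrary: \<F> rule: finite_induct)
  case empty
  then consider "\<F> = {}" | "\<F> = {{}}" by auto
  then show ?case
  proof cases
    case 2
    then have "{B. B \<subseteq> {} \<and> shatters \<F> B} = {{}}" by (auto simp: shatters_def)
    then show ?thesis using 2 by simp
  qed simp
next
  case (insert x I)
  define F0 where "F0 = {Z \<in> \<F>. x \<notin> Z}"
  define F1 where "F1 = {Z. x \<notin> Z \<and> insert x Z \<in> \<F>}"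
  have sub: "F0 \<subseteq> Pow I" "F1 \<subseteq> Pow I" using insert by (auto simp: F0_def F1_def)
  have fin: "finite F0" "finite F1" using sub insert by (auto intro: finite_subset)
  have "\<F> = F0 \<union> insert x ` F1"
  proof (intro equalityI subsetI)
    fix Z assume "Z \<in> \<F>"
    moreover have "Z = insert x (Z - {x})" if "x \<in> Z" using that by auto
    ultimately show "Z \<in> F0 \<union> insert x ` F1"
      by (cases "x \<in> Z") (auto simp: F0_def F1_def insert_absorb intro!: image_eqI[of _ _ "Z - {x}"])
  qed (auto simp: F0_def F1_def)
  moreover have "F0 \<inter> insert x ` F1 = {}" by (auto simp: F0_def)
  moreover have "inj_on (insert x) F1" by (auto simp: inj_on_def F1_def)
  ultimately have "card \<F> = card F0 + card F1"
    using fin by (simp add: card_Un_disjoint card_image)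
  also have "\<dots> = card (F0 \<union> F1) + card (F0 \<inter> F1)" using fin by (rule card_Un_Int)
  also have "\<dots> \<le> card {B. B \<subseteq> I \<and> shatters (F0 \<union> F1) B} + card {B. B \<subseteq> I \<and> shatters (F0 \<inter> F1) B}"
    by (intro add_mono insert.IH) (use sub in auto)
  also have "\<dots> = card ({B. B \<subseteq> I \<and> shatters (F0 \<union> F1) B} \<union>
      insert x ` {B. B \<subseteq> I \<and> shatters (F0 \<inter> F1) B})"
  proof -
    have "inj_on (insert x) {B. B \<subseteq> I \<and> shatters (F0 \<inter> F1) B}"
      using insert.hyps by (auto simp: inj_on_def)
    moreover have "{B. B \<subseteq> I \<and> shatters (F0 \<union> F1) B} \<inter>
        insert x ` {B. B \<subseteq> I \<and> shatters (F0 \<inter> F1) B} = {}"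
      using insert.hyps by auto
    ultimately show ?thesis
      using insert.hyps by (simp add: card_Un_disjoint card_image)
  qed
  also have "\<dots> \<le> card {B. B \<subseteq> insert x I \<and> shatters \<F> B}"
  proof (rule card_mono)
    show "finite {B. B \<subseteq> insert x I \<and> shatters \<F> B}" using insert.hyps by simp
    have "shatters \<F> B" if B: "B \<subseteq> I" "shatters (F0 \<union> F1) B" for B
      unfolding shatters_def
    proof (intro allI impI)
      fix C assume "C \<subseteq> B"
      then obtain Z where Z: "Z \<in> F0 \<union> F1" "Z \<inter> B = C" using B unfolding shatters_def by metis
      have "x \<notin> B" using B insert.hyps by auto
      then have "insert x Z \<inter> B = C" using Z by auto
      then show "\<exists>Z\<in>\<F>. Z \<inter> B = C" using Z by (auto simp: F0_def F1_def)
    qed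
    moreover have "shatters \<F> (insert x B)" if B: "B \<subseteq> I" "shatters (F0 \<inter> F1) B" for B
      unfolding shatters_def
    proof (intro allI impI)
      fix C assume C: "C \<subseteq> insert x B"
      then have "C - {x} \<subseteq> B" by auto
      then obtain Z where Z: "Z \<in> F0 \<inter> F1" "Z \<inter> B = C - {x}"
        using B unfolding shatters_def by metis
      have "x \<notin> B" using B insert.hyps by auto
      show "\<exists>Z\<in>\<F>. Z \<inter> insert x B = C"
      proof (cases "x \<in> C")
        case True
        then show ?thesis using Z by (intro bexI[of _ "insert x Z"]) (auto simp: F1_def)
      next
        case False
        then show ?thesis using Z by (intro bexI[of _ Z]) (auto simp: F0_def)
      qed
    qed
    ultimately show "{B. B \<subseteq> I \<and> shatters (F0 \<union> F1) B} \<union>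
        insert x ` {B. B \<subseteq> I \<and> shatters (F0 \<inter> F1) B} \<subseteq> {B. B \<subseteq> insert x I \<and> shatters \<F> B}"
      by auto
  qed
  finally show ?case .
qed

lemma sum_Pow_power_card:
  fixes x :: real
  assumes "finite I"
  shows "(\<Sum>B\<in>Pow I. x ^ card B) = (1 + x) ^ card I"
  using assms
proof (induction I rule: finite_induct)
  case (insert i I)
  have "(\<Sum>B\<in>insert i ` Pow I. x ^ card B) = (\<Sum>B\<in>Pow I. x ^ card (insert i B))"
    using insert.hyps by (subst sum.reindex) (auto simp: inj_on_def)
  also have "\<dots> = (\<Sum>B\<in>Pow I. x * x ^ card B)"
    using insert.hyps by (intro sum.cong refl) (subst card_insert_disjoint, auto intro: finite_subset)
  also have "\<dots> = x * (1 + x) ^ card I" using insert.IH by (simp add: sum_distrib_left[symmetric])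
  finally have "(\<Sum>B\<in>insert i ` Pow I. x ^ card B) = x * (1 + x) ^ card I" .
  moreover have "(\<Sum>B\<in>Pow (insert i I). x ^ card B)
      = (\<Sum>B\<in>Pow I. x ^ card B) + (\<Sum>B\<in>insert i ` Pow I. x ^ card B)"
    unfolding Pow_insert using insert.hyps by (intro sum.union_disjoint) auto
  ultimately show ?case using insert by (simp add: algebra_simps)
qed simp

text \<open>Each set of at most \<open>m\<close> elements has weight \<open>x ^ card B\<close> at
  least \<open>x ^ m\<close>, and all weights together sum to a binomial power.\<close>

lemma card_small_subsets:
  fixes x :: real
  assumes "finite I" "0 < x" "x \<le> 1"
  shows "real (card {B. B \<subseteq> I \<and> card B \<le> m}) \<le> (1 + x) ^ card I / x ^ m"
proof -
  have "real (card {B. B \<subseteq> I \<and> card B \<le> m}) * x ^ m = (\<Sum>B | B \<subseteq> I \<and> card B \<le> m. x ^ m)"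
    by simp
  also have "\<dots> \<le> (\<Sum>B | B \<subseteq> I \<and> card B \<le> m. x ^ card B)"
    using assms by (intro sum_mono power_decreasing) auto
  also have "\<dots> \<le> (\<Sum>B\<in>Pow I. x ^ card B)"
    using assms by (intro sum_mono2) auto
  finally show ?thesis using assms by (simp add: sum_Pow_power_card field_simps)
qed

text \<open>More than \<open>card D\<close> functionals satisfy a nontrivial linear relation
  \<open>z\<close>. If they were shattered, some \<open>u\<close> would make each functional
  nonnegative exactly where \<open>z\<close> is, so the relation evaluated at \<open>u\<close> would
  be positive instead of zero. Hence shattered sets are small, and Pajor's lemma bounds the number
  of patterns.\<close>

lemma card_sign_patterns:
  fixes l :: "'b \<Rightarrow> 'd \<Rightarrow> real" and x :: real
  assumes "finite I" "finite D" "0 < x" "x \<le> 1"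
  shows "real (card ((\<lambda>u. {b \<in> I. 0 \<le> (\<Sum>d\<in>D. l b d * u d)}) ` U)) \<le> (1 + x) ^ card I / x ^ card D"
proof -
  define Z where "Z u = {b \<in> I. 0 \<le> (\<Sum>d\<in>D. l b d * u d)}" for u
  have small: "card B \<le> card D" if B: "B \<subseteq> I" "shatters (Z ` U) B" for B
  proof (rule ccontr)
    assume "\<not> card B \<le> card D"
    moreover have "finite B" using B assms finite_subset by blast
    ultimately obtain y where y: "\<exists>b\<in>B. y b \<noteq> 0" "\<forall>d\<in>D. (\<Sum>b\<in>B. l b d * y b) = 0"
      using ex_nontrivial_solution[of D B "\<lambda>d b. l b d"] assms by auto
    \<comment> \<open>The relation is negated if necessary: strict positivity comes from a negative
      coefficient, because there the functional is itself negative.\<close>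
    obtain z where z: "\<exists>b\<in>B. z b < 0" "\<forall>d\<in>D. (\<Sum>b\<in>B. l b d * z b) = 0"
    proof (cases "\<exists>b\<in>B. y b < 0")
      case True
      then show ?thesis using that y by blast
    next
      case False
      then have "\<exists>b\<in>B. - y b < 0" using y by force
      moreover have "\<forall>d\<in>D. (\<Sum>b\<in>B. l b d * - y b) = 0" using y by (simp add: sum_negf)
      ultimately show ?thesis using that[of "\<lambda>b. - y b"] by blast
    qed
    have "{b \<in> B. 0 \<le> z b} \<subseteq> B" by blast
    then obtain u where u: "Z u \<inter> B = {b \<in> B. 0 \<le> z b}"
      using B(2) unfolding shatters_def by blast
    have "0 < (\<Sum>b\<in>B. z b * (\<Sum>d\<in>D. l b d * u d))"
    proof -
      have sgn: "(0 \<le> (\<Sum>d\<in>D. l b d * u d)) \<longleftrightarrow> 0 \<le> z b" if "b \<in> B" for b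
        using that u B(1) by (auto simp: Z_def)
      obtain b0 where b0: "b0 \<in> B" "z b0 < 0" using z by blast
      show ?thesis
      proof (rule sum_pos2[OF \<open>finite B\<close> b0(1)])
        show "0 < z b0 * (\<Sum>d\<in>D. l b0 d * u d)"
          using sgn[OF b0(1)] b0 by (intro mult_neg_neg) auto
        show "0 \<le> z b * (\<Sum>d\<in>D. l b d * u d)" if "b \<in> B" for b
          using sgn[OF that] by (cases "0 \<le> z b") (auto intro: mult_nonpos_nonpos)
      qed
    qed
    also have "(\<Sum>b\<in>B. z b * (\<Sum>d\<in>D. l b d * u d)) = (\<Sum>b\<in>B. \<Sum>d\<in>D. u d * (l b d * z b))"
      by (simp add: sum_distrib_left mult_ac)
    also have "\<dots> = (\<Sum>d\<in>D. \<Sum>b\<in>B. u d * (l b d * z b))" by (rule sum.swap)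
    also have "\<dots> = (\<Sum>d\<in>D. u d * (\<Sum>b\<in>B. l b d * z b))" by (simp add: sum_distrib_left)
    also have "\<dots> = 0" using z by simp
    finally show False by simp
  qed
  have "card (Z ` U) \<le> card {B. B \<subseteq> I \<and> shatters (Z ` U) B}"
    using assms by (intro pajor) (auto simp: Z_def)
  also have "\<dots> \<le> card {B. B \<subseteq> I \<and> card B \<le> card D}"
    using small assms by (intro card_mono) auto
  finally have "real (card (Z ` U)) \<le> real (card {B. B \<subseteq> I \<and> card B \<le> card D})" by simp
  also have "\<dots> \<le> (1 + x) ^ card I / x ^ card D"
    using assms by (intro card_small_subsets)
  finally show ?thesis by (simp add: Z_def)
qed

section \<open>Cancelling signs, uniformly over sparse vectors\<close>

text \<open>Exponential Markov inequality with weight 1/16 per agreement, so each coordinate of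
  \<open>P\<close> contributes the mean (1 + 1/16)/2 = 17/32. For negative \<open>s\<close> the
  bound exceeds one.\<close>

lemma prob_few_agreements:
  fixes \<sigma> :: "'i \<Rightarrow> real" and s :: real
  assumes "finite I" "P \<subseteq> I" "s \<le> real (card P)" "\<And>i. \<sigma> i \<in> {-1, 1}"
  shows "measure_pmf.prob (Pi_pmf I 0 (\<lambda>_. rademacher))
      {\<eta>. real (card {i \<in> P. \<eta> i = \<sigma> i}) < s / 8} \<le> exp (- s / 5)"
proof -
  define h where "h i y = (if i \<in> P \<and> y = \<sigma> i then 1 / 16 else 1 :: real)" for i y
  define c where "c = exp (- (s / 8) * ln 16)"
  have finP: "finite P" using assms finite_subset by blast
  have h: "(\<Prod>i\<in>I. h i (\<eta> i)) = exp (- real (card {i \<in> P. \<eta> i = \<sigma> i}) * ln 16)" for \<eta>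
  proof -
    have "(\<Prod>i\<in>I. h i (\<eta> i)) = (1 / 16) ^ card (I \<inter> {i. i \<in> P \<and> \<eta> i = \<sigma> i})"
      unfolding h_def using assms by (simp add: prod.If_cases)
    also have "I \<inter> {i. i \<in> P \<and> \<eta> i = \<sigma> i} = {i \<in> P. \<eta> i = \<sigma> i}" using assms by auto
    also have "(1 / 16 :: real) = exp (- ln 16)" by (simp add: exp_minus)
    finally show ?thesis by (simp add: exp_of_nat_mult[symmetric])
  qed
  have Eh: "measure_pmf.expectation rademacher (h i) = (if i \<in> P then 17 / 32 else 1)" for i
    using assms(4)[of i] unfolding rademacher_def
    by (subst integral_pmf_of_set) (auto simp: h_def)
  have "measure_pmf.prob (Pi_pmf I 0 (\<lambda>_. rademacher))
      {\<eta>. real (card {i \<in> P. \<eta> i = \<sigma> i}) < s / 8}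
      \<le> measure_pmf.expectation (Pi_pmf I 0 (\<lambda>_. rademacher)) (\<lambda>\<eta>. \<Prod>i\<in>I. h i (\<eta> i)) / c"
  proof (rule prob_markov_finite)
    show "finite (set_pmf (Pi_pmf I 0 (\<lambda>_. rademacher)))"
      using assms(1) by (simp add: set_Pi_pmf finite_PiE_dflt)
    show "0 < c" by (simp add: c_def)
  qed (auto simp: h c_def)
  also have "measure_pmf.expectation (Pi_pmf I 0 (\<lambda>_. rademacher)) (\<lambda>\<eta>. \<Prod>i\<in>I. h i (\<eta> i))
      = (\<Prod>i\<in>I. measure_pmf.expectation rademacher (h i))"
    by (rule expectation_prod_Pi_pmf) (use assms in \<open>auto simp: h_def intro!: integrable_measure_pmf_finite\<close>)
  also have "\<dots> = (17 / 32) ^ card P"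
    unfolding Eh using assms by (simp add: prod.If_cases Int_absorb1)
  also have "\<dots> = exp (real (card P) * ln (17 / 32))"
    by (simp add: exp_of_nat_mult)
  also have "\<dots> \<le> exp (s * ln (17 / 32))"
    using assms(3) by (simp add: mult_right_mono_neg)
  also have "exp (s * ln (17 / 32)) / c = exp (s * (ln (17 / 32) + ln 16 / 8))"
    by (simp add: c_def exp_diff[symmetric] algebra_simps)
  finally have "measure_pmf.prob (Pi_pmf I 0 (\<lambda>_. rademacher))
      {\<eta>. real (card {i \<in> P. \<eta> i = \<sigma> i}) < s / 8} \<le> exp (s * (ln (17 / 32) + ln 16 / 8))"
    by (simp add: divide_right_mono c_def)
  moreover have "exp (s * (ln (17 / 32) + ln 16 / 8)) \<le> exp (- s / 5)" if "0 \<le> s"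
  proof -
    have "ln (16 :: real) = 4 * ln 2"
      using ln_realpow[of 2 4] by simp
    \<comment> \<open>The exponent is half of ln(289/512), and ln t <= t - 1 puts it below
      -1/5.\<close>
    moreover have "2 * ln (17 / 32 :: real) + ln 2 = ln (289 / 512)"
    proof -
      have "2 * ln (17 / 32 :: real) = ln ((17 / 32) ^ 2)" by (subst ln_realpow) auto
      also have "\<dots> + ln 2 = ln ((17 / 32) ^ 2 * 2)" by (subst ln_mult) auto
      finally show ?thesis by (simp add: power2_eq_square)
    qed
    moreover have "ln (289 / 512 :: real) \<le> 289 / 512 - 1" by (rule ln_le_minus_one) simp
    ultimately have "ln (17 / 32) + ln 16 / 8 \<le> (- 1 / 5 :: real)" by simp
    then have "s * (ln (17 / 32) + ln 16 / 8) \<le> s * (- 1 / 5)" using that by (rule mult_left_mono)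
    then show ?thesis by simp
  qed
  moreover have "measure_pmf.prob (Pi_pmf I 0 (\<lambda>_. rademacher))
      {\<eta>. real (card {i \<in> P. \<eta> i = \<sigma> i}) < s / 8} \<le> exp (- s / 5)" if "s < 0"
    by (rule order_trans[OF measure_pmf.prob_le_1]) (use that in simp)
  ultimately show ?thesis by (meson not_le order_trans)
qed

text \<open>The sign \<open>\<sigma>\<close> for which \<open>f\<close> and \<open>\<sigma> g\<close> do not cancel takes few values over all
  \<open>u\<close>, independently of the size of \<open>c\<close>: it is read off the signs of affine functions of \<open>u\<close>.\<close>

lemma prob_sign_cancellation:
  fixes f g :: "'i \<Rightarrow> 'd \<Rightarrow> real" and \<beta> c s x :: real
  assumes fin: "finite I" "finite D" and x: "0 < x" "x \<le> 1" and "0 < \<beta>" "0 < c"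
    and U: "\<And>u. u \<in> U \<Longrightarrow> s \<le> real (card {i \<in> I. \<beta> \<le> \<bar>\<Sum>d\<in>D. g i d * u d\<bar>})"
  shows "measure_pmf.prob (Pi_pmf I 0 (\<lambda>_. rademacher))
      {\<eta>. \<exists>u\<in>U. real (card {i \<in> I. c * \<beta> \<le> \<bar>(\<Sum>d\<in>D. f i d * u d) + c * \<eta> i * (\<Sum>d\<in>D. g i d * u d)\<bar>}) < s / 8}
    \<le> (1 + x) ^ (3 * card I) / x ^ (card D + 1) * exp (- s / 5)"
proof -
  \<comment> \<open>Three tests per index: tag 0 records whether f is nonnegative, tag 3 whether g
    is at least \<beta>, tag 2 whether -g is. The extra coordinate \<open>None\<close> of
    \<open>D1\<close> carries the constant 1 and makes the affine tests linear.\<close>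
  define I3 where "I3 = {0, 2, 3 :: nat} \<times> I"
  define D1 where "D1 = insert None (Some ` D)"
  define l where "l b d = (case b of (k, i) \<Rightarrow> case d of
      None \<Rightarrow> (if k = (0 :: nat) then 0 else - \<beta>)
    | Some d \<Rightarrow> (if k = 0 then f i d else if k = 3 then g i d else - g i d))" for b d
  define ext where "ext u d = (case d of None \<Rightarrow> 1 | Some d \<Rightarrow> u d)" for u :: "'d \<Rightarrow> real" and d
  define Z where "Z u = {b \<in> I3. 0 \<le> (\<Sum>d\<in>D1. l b d * u d)}" for u
  define F where "F = Z ` ext ` U"
  define P where "P Z = {i \<in> I. (3, i) \<in> Z \<or> (2, i) \<in> Z}" for Z :: "(nat \<times> 'i) set"
  \<comment> \<open>On \<open>P Z\<close> the tag 3 gives the sign of g, so this is the value of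
    \<open>\<eta> i\<close> for which both summands have the same sign.\<close>
  define \<sigma> where "\<sigma> Z i = (if (0, i) \<in> Z \<longleftrightarrow> (3, i) \<in> Z then 1 else - 1 :: real)"
    for Z :: "(nat \<times> 'i) set" and i
  let ?Pr = "Pi_pmf I 0 (\<lambda>_. rademacher)"
  define fu where "fu u i = (\<Sum>d\<in>D. f i d * u d)" for u i
  define gu where "gu u i = (\<Sum>d\<in>D. g i d * u d)" for u i
  have fin': "finite I3" "finite D1" using fin by (auto simp: I3_def D1_def)
  have sumD1: "(\<Sum>d\<in>D1. l b d * ext u d) = l b None + (\<Sum>d\<in>D. l b (Some d) * u d)" for b u
    unfolding D1_def using fin by (simp add: sum.reindex ext_def)
  have mem: "(0, i) \<in> Z (ext u) \<longleftrightarrow> 0 \<le> fu u i" "(3, i) \<in> Z (ext u) \<longleftrightarrow> \<beta> \<le> gu u i"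
    "(2, i) \<in> Z (ext u) \<longleftrightarrow> \<beta> \<le> - gu u i" if "i \<in> I" for u i
    using that unfolding Z_def mem_Collect_eq sumD1
    by (auto simp: I3_def l_def fu_def gu_def sum_negf)
  have PZ: "P (Z (ext u)) = {i \<in> I. \<beta> \<le> \<bar>gu u i\<bar>}" for u
    using \<open>0 < \<beta>\<close> by (auto simp: P_def mem)
  have finF: "finite F"
    by (rule finite_subset[of _ "Pow I3"]) (auto simp: F_def Z_def fin')
  have sub: "{\<eta>. \<exists>u\<in>U. real (card {i \<in> I. c * \<beta> \<le> \<bar>fu u i + c * \<eta> i * gu u i\<bar>}) < s / 8}
      \<subseteq> (\<Union>Z\<in>F. {\<eta>. real (card {i \<in> P Z. \<eta> i = \<sigma> Z i}) < s / 8})"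
  proof
    fix \<eta> assume "\<eta> \<in> {\<eta>. \<exists>u\<in>U. real (card {i \<in> I. c * \<beta> \<le> \<bar>fu u i + c * \<eta> i * gu u i\<bar>}) < s / 8}"
    then obtain u where u: "u \<in> U"
      "real (card {i \<in> I. c * \<beta> \<le> \<bar>fu u i + c * \<eta> i * gu u i\<bar>}) < s / 8" by auto
    have "{i \<in> P (Z (ext u)). \<eta> i = \<sigma> (Z (ext u)) i}
        \<subseteq> {i \<in> I. c * \<beta> \<le> \<bar>fu u i + c * \<eta> i * gu u i\<bar>}"
    proof
      fix i assume "i \<in> {i \<in> P (Z (ext u)). \<eta> i = \<sigma> (Z (ext u)) i}"
      then have i: "i \<in> I" "\<beta> \<le> \<bar>gu u i\<bar>" "\<eta> i = \<sigma> (Z (ext u)) i" by (auto simp: PZ)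
      have cg: "c * \<beta> \<le> c * \<bar>gu u i\<bar>" using i \<open>0 < c\<close> by simp
      have cc: "c * \<bar>gu u i\<bar> = \<bar>c * gu u i\<bar>" using \<open>0 < c\<close> by (simp add: abs_mult)
      have "\<bar>c * gu u i\<bar> \<le> \<bar>fu u i + c * \<eta> i * gu u i\<bar>"
      proof (cases "0 \<le> gu u i")
        case True
        then have "\<beta> \<le> gu u i" "0 \<le> c * gu u i" using i \<open>0 < c\<close> by auto
        then show ?thesis using i by (auto simp: \<sigma>_def mem)
      next
        case False
        then have "\<not> \<beta> \<le> gu u i" "c * gu u i < 0"
          using \<open>0 < \<beta>\<close> \<open>0 < c\<close> by (auto simp: mult_pos_neg)
        then show ?thesis using i by (auto simp: \<sigma>_def mem)
      qed
      then show "i \<in> {i \<in> I. c * \<beta> \<le> \<bar>fu u i + c * \<eta> i * gu u i\<bar>}"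
        using i cg cc by simp
    qed
    then have "card {i \<in> P (Z (ext u)). \<eta> i = \<sigma> (Z (ext u)) i}
        \<le> card {i \<in> I. c * \<beta> \<le> \<bar>fu u i + c * \<eta> i * gu u i\<bar>}"
      using fin by (intro card_mono) auto
    then show "\<eta> \<in> (\<Union>Z\<in>F. {\<eta>. real (card {i \<in> P Z. \<eta> i = \<sigma> Z i}) < s / 8})"
      using u by (auto simp: F_def intro!: bexI[of _ u])
  qed
  have "measure_pmf.prob ?Pr {\<eta>. \<exists>u\<in>U. real (card {i \<in> I. c * \<beta> \<le> \<bar>fu u i + c * \<eta> i * gu u i\<bar>}) < s / 8}
      \<le> measure_pmf.prob ?Pr (\<Union>Z\<in>F. {\<eta>. real (card {i \<in> P Z. \<eta> i = \<sigma> Z i}) < s / 8})"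
    using sub by (intro measure_pmf.finite_measure_mono) auto
  \<comment> \<open>The patterns in \<open>F\<close> do not depend on \<open>\<eta>\<close>, so a
    union bound over them replaces the uncountable union over \<open>u\<close>.\<close>
  also have "\<dots> \<le> (\<Sum>Z\<in>F. measure_pmf.prob ?Pr {\<eta>. real (card {i \<in> P Z. \<eta> i = \<sigma> Z i}) < s / 8})"
    using finF by (intro measure_UNION_le) auto
  also have "\<dots> \<le> (\<Sum>Z\<in>F. exp (- s / 5))"
  proof (rule sum_mono)
    fix Z' assume "Z' \<in> F"
    then obtain u where u: "u \<in> U" "Z' = Z (ext u)" by (auto simp: F_def)
    show "measure_pmf.prob ?Pr {\<eta>. real (card {i \<in> P Z'. \<eta> i = \<sigma> Z' i}) < s / 8} \<le> exp (- s / 5)"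
    proof (rule prob_few_agreements[OF fin(1)])
      show "s \<le> real (card (P Z'))" using U[OF u(1)] by (simp add: u PZ gu_def)
    qed (auto simp: P_def \<sigma>_def)
  qed
  also have "\<dots> = real (card F) * exp (- s / 5)" by simp
  also have "\<dots> \<le> (1 + x) ^ card I3 / x ^ card D1 * exp (- s / 5)"
    unfolding F_def Z_def by (intro mult_right_mono card_sign_patterns fin' x) simp
  also have "card I3 = 3 * card I" by (simp add: I3_def card_cartesian_product)
  also have "card D1 = card D + 1"
    using fin by (simp add: D1_def card_image)
  finally show ?thesis by (simp add: fu_def gu_def)
qed

text \<open>Union bound over the supports. On a fixed support the functionals live in dimension at
  most \<open>m\<close>, which is the exponent of 1/x in the pattern count.\<close>

lemma prob_sign_cancellation_sparse:
  fixes f g :: "'i \<Rightarrow> nat \<Rightarrow> real" and \<beta> c s x :: real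
  assumes "finite I" and x: "0 < x" "x \<le> 1" and "0 < \<beta>" "0 < c"
    and U: "\<And>u. u \<in> U \<Longrightarrow> card {j. j < n \<and> u j \<noteq> 0} \<le> m"
    and "\<And>u. u \<in> U \<Longrightarrow> s \<le> real (card {i \<in> I. \<beta> \<le> \<bar>\<Sum>j<n. g i j * u j\<bar>})"
  shows "measure_pmf.prob (Pi_pmf I 0 (\<lambda>_. rademacher))
      {\<eta>. \<exists>u\<in>U. real (card {i \<in> I. c * \<beta> \<le> \<bar>(\<Sum>j<n. f i j * u j) + c * \<eta> i * (\<Sum>j<n. g i j * u j)\<bar>}) < s / 8}
    \<le> (1 + x) ^ n / x ^ m * ((1 + x) ^ (3 * card I) / x ^ (m + 1) * exp (- s / 5))"
proof -
  let ?Pr = "Pi_pmf I 0 (\<lambda>_. rademacher)"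
  define \<S> where "\<S> = {S. S \<subseteq> {..<n} \<and> card S \<le> m}"
  define US where "US S = {u \<in> U. {j. j < n \<and> u j \<noteq> 0} = S}" for S
  define B where "B S = {\<eta>. \<exists>u\<in>US S. real (card {i \<in> I. c * \<beta> \<le>
      \<bar>(\<Sum>j\<in>S. f i j * u j) + c * \<eta> i * (\<Sum>j\<in>S. g i j * u j)\<bar>}) < s / 8}" for S
  have sums: "(\<Sum>j<n. h j * u j) = (\<Sum>j\<in>S. h j * u j)" if "u \<in> US S" for h u S
    using that by (intro sum.mono_neutral_right) (auto simp: US_def)
  have fin: "finite \<S>" by (rule finite_subset[of _ "Pow {..<n}"]) (auto simp: \<S>_def)
  have "{\<eta>. \<exists>u\<in>U. real (card {i \<in> I. c * \<beta> \<le> \<bar>(\<Sum>j<n. f i j * u j) + c * \<eta> i * (\<Sum>j<n. g i j * u j)\<bar>}) < s / 8}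
      \<subseteq> (\<Union>S\<in>\<S>. B S)"
  proof safe
    fix \<eta> u assume u: "u \<in> U" "real (card {i \<in> I. c * \<beta> \<le>
      \<bar>(\<Sum>j<n. f i j * u j) + c * \<eta> i * (\<Sum>j<n. g i j * u j)\<bar>}) < s / 8"
    define S where "S = {j. j < n \<and> u j \<noteq> 0}"
    have "u \<in> US S" using u by (simp add: US_def S_def)
    moreover have "S \<in> \<S>" using U[OF u(1)] by (auto simp: S_def \<S>_def)
    ultimately show "\<eta> \<in> (\<Union>S\<in>\<S>. B S)"
      using u(2) unfolding sums[OF \<open>u \<in> US S\<close>] B_def by blast
  qed
  then have "measure_pmf.prob ?Pr {\<eta>. \<exists>u\<in>U. real (card {i \<in> I. c * \<beta> \<le>
      \<bar>(\<Sum>j<n. f i j * u j) + c * \<eta> i * (\<Sum>j<n. g i j * u j)\<bar>}) < s / 8}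
      \<le> measure_pmf.prob ?Pr (\<Union>S\<in>\<S>. B S)"
    by (intro measure_pmf.finite_measure_mono) auto
  also have "\<dots> \<le> (\<Sum>S\<in>\<S>. measure_pmf.prob ?Pr (B S))"
    using fin by (intro measure_UNION_le) auto
  also have "\<dots> \<le> (\<Sum>S\<in>\<S>. (1 + x) ^ (3 * card I) / x ^ (m + 1) * exp (- s / 5))"
  proof (rule sum_mono)
    fix S assume S: "S \<in> \<S>"
    then have "finite S" using finite_subset[of S "{..<n}"] by (auto simp: \<S>_def)
    then have "measure_pmf.prob ?Pr (B S) \<le> (1 + x) ^ (3 * card I) / x ^ (card S + 1) * exp (- s / 5)"
      unfolding B_def
    proof (intro prob_sign_cancellation assms(1) x \<open>0 < \<beta>\<close> \<open>0 < c\<close>)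
      fix u assume u: "u \<in> US S"
      then have "u \<in> U" by (simp add: US_def)
      from assms(7)[OF this] show "s \<le> real (card {i \<in> I. \<beta> \<le> \<bar>\<Sum>j\<in>S. g i j * u j\<bar>})"
        unfolding sums[OF u] .
    qed
    also have "\<dots> \<le> (1 + x) ^ (3 * card I) / x ^ (m + 1) * exp (- s / 5)"
      using S x by (intro mult_right_mono divide_left_mono power_decreasing) (auto simp: \<S>_def)
    finally show "measure_pmf.prob ?Pr (B S) \<le> (1 + x) ^ (3 * card I) / x ^ (m + 1) * exp (- s / 5)" .
  qed
  also have "\<dots> = real (card \<S>) * ((1 + x) ^ (3 * card I) / x ^ (m + 1) * exp (- s / 5))" by simp
  also have "\<dots> \<le> (1 + x) ^ n / x ^ m * ((1 + x) ^ (3 * card I) / x ^ (m + 1) * exp (- s / 5))"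
    using card_small_subsets[of "{..<n}" x m] x
    by (intro mult_right_mono) (auto simp: \<S>_def)
  finally show ?thesis .
qed

subsection \<open>The perturbed matrix\<close>

text \<open>Entries are indexed by row \<open>j\<close> and column \<open>i\<close>. The bounds are
  stated for the transposes because the argument pairs vectors \<open>u\<close> with the columns of
  M.\<close>

locale perturbation_model =
  fixes n K L :: nat and A V :: "nat \<Rightarrow> nat \<Rightarrow> real" and \<rho> \<epsilon> \<alpha> \<beta> \<gamma> :: real
  assumes n_pos: "0 < n" and K_pos: "1 \<le> K" and K_le: "K \<le> n" and K_le_L: "K \<le> L"
    and \<rho>_pos: "0 < \<rho>" and \<epsilon>_pos: "0 < \<epsilon>" and \<epsilon>_less: "\<epsilon> < 1"
    and \<alpha>_pos: "0 < \<alpha>" and \<beta>_pos: "0 < \<beta>" and \<gamma>_pos: "0 < \<gamma>"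
    and A_norm: "\<And>y. L2_set (\<lambda>i. \<Sum>j<n. A j i * y j) {..<n} \<le> L2_set y {..<n}"
    and V_norm: "\<And>y. L2_set (\<lambda>i. \<Sum>j<n. V j i * y j) {..<n} \<le> \<rho> * sqrt (real n) * L2_set y {..<n}"
    and V_pattern: "\<And>\<eta> u. (\<And>j. j < n \<Longrightarrow> \<eta> j \<in> {-1, 1}) \<Longrightarrow> L2_set u {..<n} = 1 \<Longrightarrow>
      real (card {j. j < n \<and> u j \<noteq> 0}) \<le> \<alpha> * real n \<Longrightarrow>
      \<gamma> * real n \<le> real (card {i. i < n \<and> \<beta> \<le> \<bar>\<Sum>j<n. V j i * (\<eta> j * u j)\<bar>})"
begin

definition r2 :: "(nat \<Rightarrow> nat set) \<Rightarrow> (nat \<times> nat \<Rightarrow> real) \<Rightarrow> nat \<Rightarrow> nat \<Rightarrow> real" where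
  "r2 J X j i = (if L < row_count n J j \<or> j \<notin> J i then 0
    else \<Sum>l<K. if j = sorted_list_of_set (J i) ! l then X (l, i) / real L else 0)"

definition M :: "(nat \<times> nat \<Rightarrow> real) \<Rightarrow> (nat \<Rightarrow> nat set) \<Rightarrow> (nat \<times> nat \<Rightarrow> real) \<Rightarrow> nat \<Rightarrow> nat \<Rightarrow> real" where
  "M \<eta> J X j i = A j i + \<epsilon> * (\<eta> (1, j) * V j i * \<eta> (2, i) / (\<rho> * sqrt (real n)) + r2 J X j i)"

definition Mt :: "(nat \<times> nat \<Rightarrow> real) \<Rightarrow> (nat \<Rightarrow> nat set) \<Rightarrow> (nat \<times> nat \<Rightarrow> real) \<Rightarrow>
    (nat \<Rightarrow> real) \<Rightarrow> nat \<Rightarrow> real" where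
  "Mt \<eta> J X y i = (\<Sum>j<n. M \<eta> J X j i * y j)"

definition admissible :: "perturbation_input \<Rightarrow> bool" where
  "admissible = (\<lambda>(\<eta>, J, X). (\<forall>k\<in>{1, 2}. \<forall>i<n. \<eta> (k, i) \<in> {-1, 1}) \<and>
    (\<forall>i<n. J i \<subseteq> {..<n} \<and> card (J i) = K) \<and> (\<forall>l<K. \<forall>i<n. X (l, i) \<in> {-1, 1}))"

lemma L_pos: "0 < L"
  using K_pos K_le_L by simp

lemma Mt_add: "Mt \<eta> J X (\<lambda>j. y j + z j) i = Mt \<eta> J X y i + Mt \<eta> J X z i"
  by (simp add: Mt_def distrib_left sum.distrib)

lemma Mt_scale: "Mt \<eta> J X (\<lambda>j. c * y j) i = c * Mt \<eta> J X y i"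
  by (simp add: Mt_def sum_distrib_left mult_ac)

lemma r2_nth:
  assumes "finite (J i)" "card (J i) = K" "l < K"
  shows "r2 J X (sorted_list_of_set (J i) ! l) i
    = (if L < row_count n J (sorted_list_of_set (J i) ! l) then 0 else X (l, i) / real L)"
proof -
  let ?s = "sorted_list_of_set (J i)"
  have len: "length ?s = K" using assms by simp
  have mem: "?s ! l \<in> J i" using nth_mem[of l ?s] len assms by simp
  have "(\<Sum>l'<K. if ?s ! l = ?s ! l' then X (l', i) / real L else 0)
      = (\<Sum>l'<K. if l = l' then X (l', i) / real L else 0)"
    using assms len by (intro sum.cong refl) (simp add: nth_eq_iff_index_eq)
  also have "\<dots> = X (l, i) / real L" using assms by simp
  finally show ?thesis using mem by (simp add: r2_def)
qed

lemma bij_betw_nth_sorted: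
  assumes "finite (S :: nat set)"
  shows "bij_betw ((!) (sorted_list_of_set S)) {..<card S} S"
  using assms by (intro bij_betw_nth) auto

lemma sum_r2:
  assumes "J i \<subseteq> {..<n}" "card (J i) = K"
  shows "(\<Sum>j<n. r2 J X j i * u j) = (\<Sum>l<K.
    (if L < row_count n J (sorted_list_of_set (J i) ! l) then 0
     else u (sorted_list_of_set (J i) ! l) / real L) * X (l, i))"
proof -
  have fin: "finite (J i)" using assms finite_subset by blast
  have "(\<Sum>j<n. r2 J X j i * u j) = (\<Sum>j\<in>J i. r2 J X j i * u j)"
    using assms by (intro sum.mono_neutral_right) (auto simp: r2_def)
  also have "\<dots> = (\<Sum>l<K. r2 J X (sorted_list_of_set (J i) ! l) i * u (sorted_list_of_set (J i) ! l))"
    using sum.reindex_bij_betw[OF bij_betw_nth_sorted[OF fin], of "\<lambda>j. r2 J X j i * u j"] assms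
    by simp
  also have "\<dots> = (\<Sum>l<K. (if L < row_count n J (sorted_list_of_set (J i) ! l) then 0
     else u (sorted_list_of_set (J i) ! l) / real L) * X (l, i))"
    using assms fin by (intro sum.cong refl) (simp add: r2_nth)
  finally show ?thesis .
qed

text \<open>Cauchy's inequality in each column costs K/L^2 times the surviving squares. Truncation
  leaves at most \<open>L\<close> entries in each row, so summing over the columns gives K/L, at
  most one.\<close>

lemma r2_norm:
  assumes J: "\<And>i. i < n \<Longrightarrow> J i \<subseteq> {..<n} \<and> card (J i) = K"
    and X: "\<And>l i. l < K \<Longrightarrow> i < n \<Longrightarrow> X (l, i) \<in> {-1, 1}"
  shows "L2_set (\<lambda>i. \<Sum>j<n. r2 J X j i * y j) {..<n} \<le> L2_set y {..<n}"
proof -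
  define R where "R j i \<longleftrightarrow> row_count n J j \<le> L \<and> j \<in> J i" for j i
  have col: "(\<Sum>j<n. r2 J X j i * y j)\<^sup>2 \<le> (\<Sum>j<n. if R j i then real K / (real L)\<^sup>2 * (y j)\<^sup>2 else 0)"
    if i: "i < n" for i
  proof -
    have fin: "finite (J i)" using J[OF i] finite_subset by blast
    let ?s = "\<lambda>l. sorted_list_of_set (J i) ! l"
    define c where "c l = (if L < row_count n J (?s l) then 0 else y (?s l) / real L)" for l
    have "(\<Sum>j<n. r2 J X j i * y j)\<^sup>2 = (\<Sum>l<K. c l * X (l, i))\<^sup>2"
      using sum_r2[of J i X y] J[OF i] by (simp add: c_def)
    also have "\<dots> \<le> (\<Sum>l<K. (c l)\<^sup>2) * (\<Sum>l<K. (X (l, i))\<^sup>2)"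
      by (rule Cauchy_Schwarz_ineq_sum)
    also have "(\<Sum>l<K. (X (l, i))\<^sup>2) = (\<Sum>l<K. 1)"
      using X[OF _ i] by (intro sum.cong refl) (auto simp: power2_eq_1_iff)
    also have "(\<Sum>l<K. (c l)\<^sup>2) = (\<Sum>j\<in>J i. if R j i then (y j / real L)\<^sup>2 else 0)"
    proof -
      have "(c l)\<^sup>2 = (if R (?s l) i then (y (?s l) / real L)\<^sup>2 else 0)" if "l < K" for l
        using that nth_mem[of l "sorted_list_of_set (J i)"] J[OF i] fin
        by (auto simp: c_def R_def)
      then have "(\<Sum>l<K. (c l)\<^sup>2) = (\<Sum>l<K. if R (?s l) i then (y (?s l) / real L)\<^sup>2 else 0)"
        by simp
      then show ?thesis
        using sum.reindex_bij_betw[OF bij_betw_nth_sorted[OF fin],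
            of "\<lambda>j. if R j i then (y j / real L)\<^sup>2 else 0"] J[OF i] by simp
    qed
    also have "\<dots> = (\<Sum>j<n. if R j i then (y j / real L)\<^sup>2 else 0)"
      using J[OF i] by (intro sum.mono_neutral_left) (auto simp: R_def)
    also have "(\<Sum>j<n. if R j i then (y j / real L)\<^sup>2 else 0) * (\<Sum>l<K. 1)
        = (\<Sum>j<n. if R j i then real K / (real L)\<^sup>2 * (y j)\<^sup>2 else 0)"
      unfolding sum_distrib_right by (intro sum.cong) (auto simp: power_divide)
    finally show ?thesis .
  qed
  have "(\<Sum>i<n. (\<Sum>j<n. r2 J X j i * y j)\<^sup>2)
      \<le> (\<Sum>i<n. \<Sum>j<n. if R j i then real K / (real L)\<^sup>2 * (y j)\<^sup>2 else 0)"
    using col by (intro sum_mono) auto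
  also have "\<dots> = (\<Sum>j<n. \<Sum>i<n. if R j i then real K / (real L)\<^sup>2 * (y j)\<^sup>2 else 0)"
    by (rule sum.swap)
  also have "\<dots> \<le> (\<Sum>j<n. (y j)\<^sup>2)"
  proof (rule sum_mono)
    fix j assume "j \<in> {..<n}"
    have "real (card {i. i < n \<and> R j i}) \<le> real L"
    proof (cases "row_count n J j \<le> L")
      case True
      then show ?thesis by (simp add: R_def row_count_def)
    qed (simp add: R_def)
    then have "real (card {i. i < n \<and> R j i}) * (real K / (real L)\<^sup>2 * (y j)\<^sup>2)
        \<le> real L * (real K / (real L)\<^sup>2 * (y j)\<^sup>2)"
      by (rule mult_right_mono) simp
    also have "\<dots> = (real K / real L) * (y j)\<^sup>2" using L_pos by (simp add: power2_eq_square)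
    also have "\<dots> \<le> 1 * (y j)\<^sup>2"
      using K_le_L L_pos by (intro mult_right_mono) auto
    also have "real (card {i. i < n \<and> R j i}) * (real K / (real L)\<^sup>2 * (y j)\<^sup>2)
        = (\<Sum>i<n. if R j i then real K / (real L)\<^sup>2 * (y j)\<^sup>2 else 0)"
      by (simp add: sum.If_cases lessThan_def Collect_conj_eq)
    finally show "(\<Sum>i<n. if R j i then real K / (real L)\<^sup>2 * (y j)\<^sup>2 else 0) \<le> (y j)\<^sup>2" by simp
  qed
  finally show ?thesis by (simp add: L2_set_def)
qed

text \<open>The three summands of M have norms at most 1, \<epsilon> and \<epsilon>; the diagonal
  sign matrices are isometries.\<close>

lemma Mt_norm:
  assumes "admissible (\<eta>, J, X)"
  shows "L2_set (Mt \<eta> J X y) {..<n} \<le> 3 * L2_set y {..<n}"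
proof -
  define a where "a i = (\<Sum>j<n. A j i * y j)" for i
  define b where "b i = \<eta> (2, i) / (\<rho> * sqrt (real n)) * (\<Sum>j<n. V j i * (\<eta> (1, j) * y j))" for i
  define c where "c i = (\<Sum>j<n. r2 J X j i * y j)" for i
  have \<eta>: "\<bar>\<eta> (k, i)\<bar> = 1" if "k \<in> {1, 2}" "i < n" for k i
    using assms that by (auto simp: admissible_def)
  have "Mt \<eta> J X y i = a i + (\<epsilon> * b i + \<epsilon> * c i)" for i
    unfolding Mt_def M_def a_def b_def c_def
    by (simp add: sum_distrib_left sum.distrib[symmetric] distrib_left distrib_right mult_ac
        sum_divide_distrib)
  then have "L2_set (Mt \<eta> J X y) {..<n} = L2_set (\<lambda>i. a i + (\<epsilon> * b i + \<epsilon> * c i)) {..<n}" by presburger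
  also have "\<dots> \<le> L2_set a {..<n} + (L2_set (\<lambda>i. \<epsilon> * b i) {..<n} + L2_set (\<lambda>i. \<epsilon> * c i) {..<n})"
    by (rule order_trans[OF L2_set_triangle_ineq]) (intro add_left_mono L2_set_triangle_ineq)
  also have "L2_set (\<lambda>i. \<epsilon> * b i) {..<n} = \<epsilon> * L2_set b {..<n}"
    using \<epsilon>_pos by (simp add: L2_set_right_distrib)
  also have "L2_set (\<lambda>i. \<epsilon> * c i) {..<n} = \<epsilon> * L2_set c {..<n}"
    using \<epsilon>_pos by (simp add: L2_set_right_distrib)
  also have "L2_set b {..<n} = 1 / (\<rho> * sqrt (real n)) * L2_set (\<lambda>i. \<Sum>j<n. V j i * (\<eta> (1, j) * y j)) {..<n}"
  proof -
    have "L2_set b {..<n} = L2_set (\<lambda>i. 1 / (\<rho> * sqrt (real n)) * (\<Sum>j<n. V j i * (\<eta> (1, j) * y j))) {..<n}"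
      unfolding L2_set_def b_def
    proof (intro arg_cong[of _ _ sqrt] sum.cong refl)
      fix i assume "i \<in> {..<n}"
      then have "(\<eta> (2, i))\<^sup>2 = 1" using \<eta>[of 2 i] by (simp add: abs_square_eq_1)
      then show "(\<eta> (2, i) / (\<rho> * sqrt (real n)) * (\<Sum>j<n. V j i * (\<eta> (1, j) * y j)))\<^sup>2
          = (1 / (\<rho> * sqrt (real n)) * (\<Sum>j<n. V j i * (\<eta> (1, j) * y j)))\<^sup>2"
        by (simp add: power_mult_distrib power_divide)
    qed
    also have "\<dots> = 1 / (\<rho> * sqrt (real n)) * L2_set (\<lambda>i. \<Sum>j<n. V j i * (\<eta> (1, j) * y j)) {..<n}"
      by (rule L2_set_right_distrib[symmetric]) (use \<rho>_pos in simp)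
    finally show ?thesis .
  qed
  also have "\<dots> \<le> 1 / (\<rho> * sqrt (real n)) * (\<rho> * sqrt (real n) * L2_set (\<lambda>j. \<eta> (1, j) * y j) {..<n})"
    using \<rho>_pos by (intro mult_left_mono V_norm) simp
  also have "\<dots> = L2_set (\<lambda>j. \<eta> (1, j) * y j) {..<n}" using \<rho>_pos n_pos by simp
  also have "\<dots> = L2_set y {..<n}"
    unfolding L2_set_def
  proof (intro arg_cong[of _ _ sqrt] sum.cong refl)
    fix j assume "j \<in> {..<n}"
    then have "(\<eta> (1, j))\<^sup>2 = 1" using \<eta>[of 1 j] by (simp add: abs_square_eq_1)
    then show "(\<eta> (1, j) * y j)\<^sup>2 = (y j)\<^sup>2" by (simp add: power_mult_distrib)
  qed
  finally have "L2_set (Mt \<eta> J X y) {..<n}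
      \<le> L2_set a {..<n} + (\<epsilon> * L2_set y {..<n} + \<epsilon> * L2_set c {..<n})"
    using \<epsilon>_pos by simp
  also have "\<dots> \<le> L2_set y {..<n} + (1 * L2_set y {..<n} + 1 * L2_set y {..<n})"
  proof (intro add_mono mult_mono)
    show "L2_set a {..<n} \<le> L2_set y {..<n}" unfolding a_def by (rule A_norm)
    show "L2_set c {..<n} \<le> L2_set y {..<n}"
      unfolding c_def using assms by (intro r2_norm) (auto simp: admissible_def)
  qed (use \<epsilon>_less \<epsilon>_pos in auto)
  finally show ?thesis by simp
qed

section \<open>Normal vectors to all columns but one\<close>

definition is_normal :: "(nat \<times> nat \<Rightarrow> real) \<Rightarrow> (nat \<Rightarrow> nat set) \<Rightarrow> (nat \<times> nat \<Rightarrow> real) \<Rightarrow> nat \<Rightarrow>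
    (nat \<Rightarrow> real) \<Rightarrow> bool" where
  "is_normal \<eta> J X i u \<longleftrightarrow> L2_set u {..<n} = 1 \<and> (\<forall>i'<n. i' \<noteq> i \<longrightarrow> Mt \<eta> J X u i' = 0)"

text \<open>Orthogonality gives n-1 equations in n unknowns, so a solution exists whatever the rank
  of the matrix.\<close>

lemma ex_normal:
  assumes "i < n"
  shows "\<exists>u. is_normal \<eta> J X i u"
proof -
  have "card ({..<n} - {i}) < card {..<n}" using assms by simp
  then obtain x where x: "\<exists>j\<in>{..<n}. x j \<noteq> 0"
    "\<forall>i'\<in>{..<n} - {i}. (\<Sum>j<n. M \<eta> J X j i' * x j) = 0"
    using ex_nontrivial_solution[of "{..<n} - {i}" "{..<n}" "\<lambda>i' j. M \<eta> J X j i'"] by auto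
  define c where "c = L2_set x {..<n}"
  have "c \<noteq> 0" using x(1) by (auto simp: c_def L2_set_eq_0_iff)
  moreover have "0 \<le> c" by (simp add: c_def)
  ultimately have c: "0 < c" by simp
  have "L2_set (\<lambda>j. 1 / c * x j) {..<n} = 1 / c * c"
    unfolding c_def by (rule L2_set_right_distrib[symmetric]) simp
  moreover have "Mt \<eta> J X (\<lambda>j. 1 / c * x j) i' = 0" if "i' < n" "i' \<noteq> i" for i'
    unfolding Mt_scale using x(2) that by (simp add: Mt_def)
  ultimately have "is_normal \<eta> J X i (\<lambda>j. 1 / c * x j)" using c by (simp add: is_normal_def)
  then show ?thesis by blast
qed

text \<open>Emptying \<open>J i\<close> makes the normal vector independent of the \<open>i\<close>-th column, including its
  effect on the truncation of the other columns.\<close>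

definition normal :: "(nat \<times> nat \<Rightarrow> real) \<Rightarrow> (nat \<Rightarrow> nat set) \<Rightarrow> (nat \<times> nat \<Rightarrow> real) \<Rightarrow> nat \<Rightarrow>
    nat \<Rightarrow> real" where
  "normal \<eta> J X i = (SOME u. is_normal \<eta> (J(i := {})) 
      (\<lambda>p. if p \<in> {..<K} \<times> ({..<n} - {i}) then X p else 0) i u)"

lemma row_count_upd_le: "row_count n (J(i := {})) j \<le> row_count n J j"
  unfolding row_count_def by (rule card_mono) auto

lemma row_count_upd_notin:
  assumes "j \<notin> J i"
  shows "row_count n (J(i := {})) j = row_count n J j"
proof -
  have "{i'. i' < n \<and> j \<in> (J(i := {})) i'} = {i'. i' < n \<and> j \<in> J i'}" using assms by auto
  then show ?thesis by (simp add: row_count_def)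
qed

lemma row_count_upd_in:
  assumes "j \<in> J i" "i < n"
  shows "row_count n J j = Suc (row_count n (J(i := {})) j)"
proof -
  have "{i'. i' < n \<and> j \<in> J i'} = insert i {i'. i' < n \<and> j \<in> (J(i := {})) i'}" using assms by auto
  then show ?thesis by (simp add: row_count_def)
qed

text \<open>Emptying \<open>J i\<close> lowers row counts only in the rows of \<open>J i\<close>. By
  hypothesis none of these is truncated, so the truncation is unchanged and the other columns stay
  the same.\<close>

lemma is_normal_normal:
  assumes "i < n" and ok: "\<And>j. j \<in> J i \<Longrightarrow> row_count n J j \<le> L"
  shows "is_normal \<eta> J X i (normal \<eta> J X i)"
proof -
  let ?J = "J(i := {})" and ?X = "\<lambda>p. if p \<in> {..<K} \<times> ({..<n} - {i}) then X p else 0"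
  have "is_normal \<eta> ?J ?X i (normal \<eta> J X i)"
    unfolding normal_def by (rule someI_ex[OF ex_normal[OF assms(1)]])
  moreover have "Mt \<eta> ?J ?X u i' = Mt \<eta> J X u i'" if "i' < n" "i' \<noteq> i" for u i'
  proof -
    have "L < row_count n ?J j \<longleftrightarrow> L < row_count n J j" for j
    proof (cases "j \<in> J i")
      case True
      then show ?thesis using ok[OF True] row_count_upd_le[of J i j] by simp
    qed (simp add: row_count_upd_notin)
    then have "r2 ?J ?X j i' = r2 J X j i'" for j
      using that by (simp add: r2_def cong: if_cong)
    then show ?thesis by (simp add: Mt_def M_def)
  qed
  ultimately show ?thesis by (simp add: is_normal_def)
qed

text \<open>The threshold is the scale of R1 times \<beta>, and the proportion 1/8 is the share of
  favourable signs secured by \<open>prob_few_agreements\<close>.\<close>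

definition sparse_good :: "perturbation_input \<Rightarrow> bool" where
  "sparse_good = (\<lambda>(\<eta>, J, X). \<forall>u. L2_set u {..<n} = 1 \<longrightarrow>
    real (card {j. j < n \<and> u j \<noteq> 0}) \<le> \<alpha> * real n \<longrightarrow>
    \<gamma> * real n / 8 \<le> real (card {i. i < n \<and> \<epsilon> / (\<rho> * sqrt (real n)) * \<beta> \<le> \<bar>Mt \<eta> J X u i\<bar>}))"

lemma sum_sq_L2_set: "(\<Sum>j<n. (y j)\<^sup>2) = (L2_set y {..<n})\<^sup>2"
  by (simp add: L2_set_def sum_nonneg)

text \<open>Otherwise the large coordinates of \<open>u\<close> form a sparse part \<open>y\<close>,
  and the rest \<open>z\<close> has norm at most \<open>a * \<epsilon>\<close>. The transpose of M
  sends \<open>y\<close> to many coordinates of order \<epsilon>/sqrt(n). Off the coordinate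
  \<open>i\<close> these are cancelled by the image of \<open>z\<close>, whose norm is at most
  \<open>3 * a * \<epsilon>\<close>; for small \<open>a\<close> this is impossible.\<close>

lemma normal_incompressible:
  fixes a \<theta> :: real
  assumes adm: "admissible (\<eta>, J, X)" and good: "sparse_good (\<eta>, J, X)"
    and u: "is_normal \<eta> J X i u" and n16: "16 \<le> \<gamma> * real n"
    and a: "0 < a" "a \<le> 1 / 2" "576 * a\<^sup>2 * \<rho>\<^sup>2 < \<beta>\<^sup>2 * \<gamma>"
    and \<theta>: "\<theta> = a * \<epsilon> / sqrt (real n)"
  shows "\<alpha> * real n < real (card {j. j < n \<and> \<theta> \<le> \<bar>u j\<bar>})"
proof (rule ccontr)
  define T where "T = {j. j < n \<and> \<theta> \<le> \<bar>u j\<bar>}"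
  assume "\<not> \<alpha> * real n < real (card {j. j < n \<and> \<theta> \<le> \<bar>u j\<bar>})"
  then have cardT: "real (card T) \<le> \<alpha> * real n" by (simp add: T_def)
  define y where "y j = (if j \<in> T then u j else 0)" for j
  define z where "z j = (if j \<in> T then 0 else u j)" for j
  define q where "q = L2_set y {..<n}"
  define t where "t = \<epsilon> / (\<rho> * sqrt (real n)) * \<beta>"
  have t: "0 < t" using \<epsilon>_pos \<rho>_pos n_pos \<beta>_pos by (simp add: t_def)
  have "(\<Sum>j<n. (z j)\<^sup>2) \<le> (\<Sum>j<n. \<theta>\<^sup>2)"
  proof (rule sum_mono)
    fix j assume "j \<in> {..<n}"
    then have "\<bar>z j\<bar> \<le> \<theta>" using a \<epsilon>_pos by (auto simp: z_def T_def \<theta>)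
    then show "(z j)\<^sup>2 \<le> \<theta>\<^sup>2" by (rule abs_le_square_iff[THEN iffD1, OF order_trans]) simp
  qed
  also have "\<dots> = a\<^sup>2 * \<epsilon>\<^sup>2" using n_pos by (simp add: \<theta> power_divide power_mult_distrib)
  finally have z_sq: "(\<Sum>j<n. (z j)\<^sup>2) \<le> a\<^sup>2 * \<epsilon>\<^sup>2" .
  have "(\<Sum>j<n. (y j)\<^sup>2) + (\<Sum>j<n. (z j)\<^sup>2) = (\<Sum>j<n. (u j)\<^sup>2)"
    unfolding sum.distrib[symmetric] by (intro sum.cong) (auto simp: y_def z_def)
  also have "\<dots> = 1" using u by (simp add: is_normal_def sum_sq_L2_set)
  finally have "q\<^sup>2 = 1 - (\<Sum>j<n. (z j)\<^sup>2)" by (simp add: q_def sum_sq_L2_set)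
  moreover have "a\<^sup>2 * \<epsilon>\<^sup>2 \<le> (1 / 2)\<^sup>2 * 1\<^sup>2"
    using a \<epsilon>_pos \<epsilon>_less by (intro mult_mono power_mono) auto
  ultimately have q_sq: "1 / 4 \<le> q\<^sup>2" using z_sq by (simp add: power2_eq_square)
  have "0 \<le> q" by (simp add: q_def)
  moreover have "q \<noteq> 0" using q_sq by auto
  ultimately have q: "0 < q" by simp
  define v where "v j = 1 / q * y j" for j
  have "L2_set v {..<n} = 1 / q * q"
    unfolding v_def q_def by (rule L2_set_right_distrib[symmetric]) simp
  then have v1: "L2_set v {..<n} = 1" using q by simp
  have "card {j. j < n \<and> v j \<noteq> 0} \<le> card T"
    by (rule card_mono) (auto simp: v_def y_def T_def)
  then have "real (card {j. j < n \<and> v j \<noteq> 0}) \<le> \<alpha> * real n" using cardT by linarith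
  then have big: "\<gamma> * real n / 8 \<le> real (card {i. i < n \<and> t \<le> \<bar>Mt \<eta> J X v i\<bar>})"
    using good v1 by (simp add: sparse_good_def t_def)
  \<comment> \<open>The coordinate \<open>i\<close> is excluded because \<open>u\<close> need not be
    orthogonal to that column; \<open>n16\<close> absorbs the loss of one index.\<close>
  define W where "W = {i'. i' < n \<and> t \<le> \<bar>Mt \<eta> J X v i'\<bar>} - {i}"
  have "real (card {i. i < n \<and> t \<le> \<bar>Mt \<eta> J X v i\<bar>}) \<le> real (card W) + 1"
  proof -
    have "card {i. i < n \<and> t \<le> \<bar>Mt \<eta> J X v i\<bar>} \<le> card (insert i W)"
      by (rule card_mono) (auto simp: W_def)
    also have "\<dots> \<le> card W + 1"
    proof -
      have "finite W" by (simp add: W_def)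
      then show ?thesis by (simp add: card_insert_if)
    qed
    finally show ?thesis by linarith
  qed
  then have cardW: "\<gamma> * real n / 16 \<le> real (card W)" using big n16 by linarith
  have Wz: "(t / 2)\<^sup>2 \<le> (Mt \<eta> J X z i')\<^sup>2" if "i' \<in> W" for i'
  proof -
    have "Mt \<eta> J X u i' = 0" using u that by (simp add: is_normal_def W_def)
    moreover have "u = (\<lambda>j. y j + z j)" by (auto simp: y_def z_def)
    ultimately have "Mt \<eta> J X y i' + Mt \<eta> J X z i' = 0" by (metis Mt_add)
    moreover have "Mt \<eta> J X v i' = 1 / q * Mt \<eta> J X y i'" unfolding v_def by (rule Mt_scale)
    ultimately have "(Mt \<eta> J X z i')\<^sup>2 = q\<^sup>2 * (Mt \<eta> J X v i')\<^sup>2"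
      using q by (simp add: power_mult_distrib power_divide add_eq_0_iff)
    moreover have "t\<^sup>2 \<le> (Mt \<eta> J X v i')\<^sup>2"
      using that t by (simp add: W_def abs_le_square_iff[symmetric])
    then have "1 / 4 * t\<^sup>2 \<le> q\<^sup>2 * (Mt \<eta> J X v i')\<^sup>2"
      using q_sq by (intro mult_mono) auto
    ultimately show ?thesis by (simp add: power_divide)
  qed
  have "\<gamma> * real n / 16 * (t / 2)\<^sup>2 \<le> real (card W) * (t / 2)\<^sup>2"
    using cardW by (rule mult_right_mono) simp
  also have "\<dots> = (\<Sum>i'\<in>W. (t / 2)\<^sup>2)" by simp
  also have "\<dots> \<le> (\<Sum>i'\<in>W. (Mt \<eta> J X z i')\<^sup>2)" using Wz by (rule sum_mono)
  also have "\<dots> \<le> (\<Sum>i'<n. (Mt \<eta> J X z i')\<^sup>2)" by (rule sum_mono2) (auto simp: W_def)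
  also have "\<dots> = (L2_set (Mt \<eta> J X z) {..<n})\<^sup>2" by (rule sum_sq_L2_set)
  also have "\<dots> \<le> (3 * L2_set z {..<n})\<^sup>2" by (intro power_mono Mt_norm adm) simp
  also have "\<dots> = 9 * (\<Sum>j<n. (z j)\<^sup>2)" by (simp add: power_mult_distrib sum_sq_L2_set)
  also have "\<dots> \<le> 9 * (a\<^sup>2 * \<epsilon>\<^sup>2)" using z_sq by simp
  finally have "\<gamma> * real n / 16 * (t / 2)\<^sup>2 \<le> 9 * (a\<^sup>2 * \<epsilon>\<^sup>2)" .
  moreover have "t\<^sup>2 = \<epsilon>\<^sup>2 * \<beta>\<^sup>2 / (\<rho>\<^sup>2 * real n)"
    by (simp add: t_def power_mult_distrib power_divide)
  \<comment> \<open>The constant 576 is 9 * 16 * 4: the squared norm bound, the proportion 1/16 and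
    the factor 1/4 from \<open>t / 2\<close>.\<close>
  ultimately have "\<epsilon>\<^sup>2 * (\<beta>\<^sup>2 * \<gamma>) \<le> \<epsilon>\<^sup>2 * (576 * a\<^sup>2 * \<rho>\<^sup>2)"
    using n_pos \<rho>_pos by (simp add: power_divide field_simps)
  then show False using a(3) \<epsilon>_pos by simp
qed

section \<open>Bad columns and what forces them\<close>

text \<open>The count omits column \<open>i\<close>, so the set does not depend on
  \<open>J i\<close>. The strict inequality leaves room for column \<open>i\<close> itself: the row
  still survives truncation if \<open>J i\<close> hits it.\<close>

definition light_rows :: "real \<Rightarrow> (nat \<times> nat \<Rightarrow> real) \<Rightarrow> (nat \<Rightarrow> nat set) \<Rightarrow> (nat \<times> nat \<Rightarrow> real) \<Rightarrow>
    nat \<Rightarrow> nat set" where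
  "light_rows \<theta> \<eta> J X i = {j. j < n \<and> \<theta> \<le> \<bar>normal \<eta> J X i j\<bar> \<and> row_count n (J(i := {})) j < L}"

text \<open>With all other data fixed, this is an event for \<open>J i\<close> alone, while
  \<open>concentrated\<close> is one for the signs of column \<open>i\<close> alone.\<close>

definition few_hits :: "real \<Rightarrow> perturbation_input \<Rightarrow> nat \<Rightarrow> bool" where
  "few_hits \<theta> = (\<lambda>(\<eta>, J, X) i. \<alpha> * real n / 2 \<le> real (card (light_rows \<theta> \<eta> J X i)) \<and>
    real (card (J i \<inter> light_rows \<theta> \<eta> J X i)) < \<alpha> * real K / 4)"

definition concentrated :: "real \<Rightarrow> perturbation_input \<Rightarrow> nat \<Rightarrow> bool" where
  "concentrated \<theta> = (\<lambda>(\<eta>, J, X) i. \<alpha> * real K / 4 \<le> real (card (J i \<inter> light_rows \<theta> \<eta> J X i)) \<and>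
    \<bar>Mt \<eta> J X (normal \<eta> J X i) i\<bar> < \<epsilon> * \<theta> / real L)"

text \<open>One exponential weight bounds both the number of heavy rows and the number of columns
  that meet them.\<close>

definition rows_good :: "perturbation_input \<Rightarrow> bool" where
  "rows_good = (\<lambda>(\<eta>, J, X). (\<Sum>j<n. 4 ^ row_count n J j) / 2 ^ L \<le> \<alpha> * real n / 2)"

text \<open>For \<open>c\<close> at least \<open>L\<close> the right side is at least 2^c. The
  maximum lets a heavy row count both as one row and as its \<open>c\<close> incidences.\<close>

lemma heavy_row_weight:
  assumes "L \<le> c"
  shows "real (max c 1) \<le> 4 ^ c / 2 ^ L"
proof -
  have "(2::real) ^ L \<le> 2 ^ c" using assms by (intro power_increasing) auto
  then have "(2::real) ^ c * 2 ^ L \<le> 2 ^ c * 2 ^ c" by (intro mult_left_mono) auto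
  also have "\<dots> = 4 ^ c" by (simp add: power_mult_distrib[symmetric])
  finally have "(2::real) ^ c \<le> 4 ^ c / 2 ^ L" by (simp add: field_simps)
  moreover have "real c \<le> 2 ^ c" by (metis less_imp_le of_nat_less_two_power)
  moreover have "1 \<le> (2::real) ^ c" by simp
  ultimately have "real c \<le> 4 ^ c / 2 ^ L" "1 \<le> (4::real) ^ c / 2 ^ L" by linarith+
  then show ?thesis by (simp only: of_nat_max of_nat_1 max.bounded_iff)
qed

text \<open>Of the more than \<alpha>n large coordinates of \<open>v\<close>, at most \<alpha>n/2
  belong to columns in \<open>E\<close>, which meet a truncated row. Every other one gives a bad
  column: its normal vector is valid and incompressible, and testing the image of \<open>v\<close>
  against it makes \<open>Mt\<close> small at \<open>i\<close>.\<close>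

lemma many_bad_columns:
  fixes a \<theta> \<kappa> :: real
  assumes adm: "admissible (\<eta>, J, X)" and good: "sparse_good (\<eta>, J, X)" and rows: "rows_good (\<eta>, J, X)"
    and n16: "16 \<le> \<gamma> * real n"
    and a: "0 < a" "a \<le> 1 / 2" "576 * a\<^sup>2 * \<rho>\<^sup>2 < \<beta>\<^sup>2 * \<gamma>"
    and \<theta>: "\<theta> = a * \<epsilon> / sqrt (real n)"
    and v: "\<alpha> * real n < real (card {i. i < n \<and> \<kappa> \<le> \<bar>v i\<bar>})" and "0 < \<kappa>"
    and small: "L2_set (\<lambda>j. \<Sum>i<n. M \<eta> J X j i * v i) {..<n} < \<kappa> * (\<epsilon> * \<theta> / real L)"
  shows "\<alpha> * real n / 2 \<le> real (card {i. i < n \<and> (few_hits \<theta> (\<eta>, J, X) i \<or> concentrated \<theta> (\<eta>, J, X) i)})"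
proof -
  define Q where "Q = {i. i < n \<and> \<kappa> \<le> \<bar>v i\<bar>}"
  define E where "E = {i. i < n \<and> (\<exists>j\<in>J i. L < row_count n J j)}"
  define R where "R = {j. j < n \<and> L \<le> row_count n J j}"
  have w: "(\<Sum>j\<in>R. real (max (row_count n J j) 1)) \<le> \<alpha> * real n / 2"
  proof -
    have "(\<Sum>j\<in>R. real (max (row_count n J j) 1)) \<le> (\<Sum>j\<in>R. 4 ^ row_count n J j / 2 ^ L)"
      by (intro sum_mono heavy_row_weight) (simp add: R_def)
    also have "\<dots> \<le> (\<Sum>j<n. 4 ^ row_count n J j / 2 ^ L)"
      by (intro sum_mono2) (auto simp: R_def)
    also have "\<dots> = (\<Sum>j<n. 4 ^ row_count n J j) / 2 ^ L" by (simp add: sum_divide_distrib)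
    also have "\<dots> \<le> \<alpha> * real n / 2" using rows by (simp only: rows_good_def prod.case)
    finally show ?thesis .
  qed
  have finR: "finite R" by (simp add: R_def)
  have "real (card R) = (\<Sum>j\<in>R. 1)" by simp
  also have "\<dots> \<le> (\<Sum>j\<in>R. real (max (row_count n J j) 1))" by (intro sum_mono) simp
  finally have cardR: "real (card R) \<le> \<alpha> * real n / 2" using w by simp
  have "E \<subseteq> (\<Union>j\<in>R. {i. i < n \<and> j \<in> J i})"
    using adm by (fastforce simp: E_def R_def admissible_def)
  then have "card E \<le> card (\<Union>j\<in>R. {i. i < n \<and> j \<in> J i})"
    by (rule card_mono[rotated]) (use finR in auto)
  also have "\<dots> \<le> (\<Sum>j\<in>R. card {i. i < n \<and> j \<in> J i})" by (rule card_UN_le[OF finR])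
  finally have "real (card E) \<le> (\<Sum>j\<in>R. real (row_count n J j))"
    by (simp add: row_count_def flip: of_nat_sum)
  also have "\<dots> \<le> (\<Sum>j\<in>R. real (max (row_count n J j) 1))" by (intro sum_mono) simp
  finally have cardE: "real (card E) \<le> \<alpha> * real n / 2" using w by simp
  have bad: "few_hits \<theta> (\<eta>, J, X) i \<or> concentrated \<theta> (\<eta>, J, X) i" if "i \<in> Q" "i \<notin> E" for i
  proof -
    define u where "u = normal \<eta> J X i"
    have i: "i < n" "\<kappa> \<le> \<bar>v i\<bar>" using that by (auto simp: Q_def)
    have u: "is_normal \<eta> J X i u"
      unfolding u_def using that i by (intro is_normal_normal) (auto simp: E_def not_less)
    have "\<alpha> * real n < real (card {j. j < n \<and> \<theta> \<le> \<bar>u j\<bar>})"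
      by (rule normal_incompressible[OF adm good u n16 a \<theta>])
    \<comment> \<open>A large coordinate outside the light rows has count at least \<open>L\<close>
      even without column \<open>i\<close>, so its row lies in \<open>R\<close>. Removing
      \<open>R\<close> leaves at least \<alpha>n/2 light rows.\<close>
    moreover have "{j. j < n \<and> \<theta> \<le> \<bar>u j\<bar>} \<subseteq> light_rows \<theta> \<eta> J X i \<union> R"
    proof
      fix j assume "j \<in> {j. j < n \<and> \<theta> \<le> \<bar>u j\<bar>}"
      then show "j \<in> light_rows \<theta> \<eta> J X i \<union> R"
        using row_count_upd_le[of J i j]
        by (cases "row_count n (J(i := {})) j < L") (auto simp: light_rows_def R_def u_def)
    qed
    then have "card {j. j < n \<and> \<theta> \<le> \<bar>u j\<bar>} \<le> card (light_rows \<theta> \<eta> J X i \<union> R)"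
      by (rule card_mono[rotated]) (simp add: light_rows_def finR)
    then have "card {j. j < n \<and> \<theta> \<le> \<bar>u j\<bar>} \<le> card (light_rows \<theta> \<eta> J X i) + card R"
      using card_Un_le order_trans by blast
    ultimately have light: "\<alpha> * real n / 2 \<le> real (card (light_rows \<theta> \<eta> J X i))"
      using cardR by linarith
    \<comment> \<open>In the inner product of \<open>u\<close> with the image of \<open>v\<close>,
      orthogonality kills all columns but the \<open>i\<close>-th.\<close>
    have "(\<Sum>j<n. u j * (\<Sum>i'<n. M \<eta> J X j i' * v i')) = (\<Sum>j<n. \<Sum>i'<n. v i' * (M \<eta> J X j i' * u j))"
      by (simp add: sum_distrib_left mult_ac)
    also have "\<dots> = (\<Sum>i'<n. \<Sum>j<n. v i' * (M \<eta> J X j i' * u j))" by (rule sum.swap)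
    also have "\<dots> = (\<Sum>i'<n. v i' * Mt \<eta> J X u i')" by (simp add: Mt_def sum_distrib_left)
    also have "\<dots> = (\<Sum>i'<n. if i' = i then v i * Mt \<eta> J X u i else 0)"
      using u by (intro sum.cong) (auto simp: is_normal_def)
    also have "\<dots> = v i * Mt \<eta> J X u i" using i by simp
    finally have "\<bar>v i * Mt \<eta> J X u i\<bar> = \<bar>\<Sum>j<n. u j * (\<Sum>i'<n. M \<eta> J X j i' * v i')\<bar>" by simp
    also have "\<dots> \<le> (\<Sum>j<n. \<bar>u j\<bar> * \<bar>\<Sum>i'<n. M \<eta> J X j i' * v i'\<bar>)"
      by (rule order_trans[OF sum_abs]) (simp add: abs_mult)
    also have "\<dots> \<le> L2_set u {..<n} * L2_set (\<lambda>j. \<Sum>i'<n. M \<eta> J X j i' * v i') {..<n}"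
      by (rule L2_set_mult_ineq)
    also have "\<dots> < \<kappa> * (\<epsilon> * \<theta> / real L)" using u small by (simp add: is_normal_def)
    finally have "\<bar>v i\<bar> * \<bar>Mt \<eta> J X u i\<bar> < \<kappa> * (\<epsilon> * \<theta> / real L)" by (simp add: abs_mult)
    moreover have "\<kappa> * \<bar>Mt \<eta> J X u i\<bar> \<le> \<bar>v i\<bar> * \<bar>Mt \<eta> J X u i\<bar>"
      using i by (intro mult_right_mono) auto
    ultimately have "\<kappa> * \<bar>Mt \<eta> J X u i\<bar> < \<kappa> * (\<epsilon> * \<theta> / real L)" by (rule le_less_trans[rotated])
    then have "\<bar>Mt \<eta> J X u i\<bar> < \<epsilon> * \<theta> / real L"
      using \<open>0 < \<kappa>\<close> by (simp only: mult_less_cancel_left_pos)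
    then show ?thesis
      using light by (auto simp: few_hits_def concentrated_def u_def not_less)
  qed
  have "real (card Q) \<le> real (card (Q - E)) + real (card E)"
  proof -
    have "card Q \<le> card ((Q - E) \<union> E)" by (rule card_mono) (auto simp: Q_def E_def)
    then show ?thesis using card_Un_le[of "Q - E" E] by linarith
  qed
  moreover have "card (Q - E) \<le> card {i. i < n \<and> (few_hits \<theta> (\<eta>, J, X) i \<or> concentrated \<theta> (\<eta>, J, X) i)}"
    using bad by (intro card_mono) (auto simp: Q_def)
  ultimately show ?thesis using v cardE unfolding Q_def by linarith
qed

section \<open>Probabilities of the bad events\<close>

abbreviation law :: "perturbation_input pmf" where
  "law \<equiv> perturbation_law n K"

lemma law_eq: "law = pair_pmf (Pi_pmf ({1, 2} \<times> {..<n}) 0 (\<lambda>_. rademacher))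
    (pair_pmf (subsets_law n K) (Pi_pmf ({..<K} \<times> {..<n}) 0 (\<lambda>_. rademacher)))"
  by (simp add: perturbation_law_def subsets_law_def card_subsets_def)

lemma admissible_law:
  assumes "\<omega> \<in> set_pmf law"
  shows "admissible \<omega>"
proof -
  obtain \<eta> J X where \<omega>: "\<omega> = (\<eta>, J, X)" by (cases \<omega>) auto
  have "\<eta> \<in> set_pmf (Pi_pmf ({1, 2} \<times> {..<n}) 0 (\<lambda>_. rademacher))"
    "J \<in> set_pmf (subsets_law n K)" "X \<in> set_pmf (Pi_pmf ({..<K} \<times> {..<n}) 0 (\<lambda>_. rademacher))"
    using assms by (auto simp: law_eq \<omega>)
  moreover have "J i \<subseteq> {..<n} \<and> card (J i) = K" if "i < n" for i
    using set_subsets_law[OF K_le \<open>J \<in> _\<close> that] by simp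
  ultimately show ?thesis
    by (auto simp: \<omega> admissible_def set_Pi_pmf PiE_dflt_def)
qed

lemma finite_law: "finite (set_pmf law)"
  by (simp add: law_eq set_Pi_pmf finite_PiE_dflt finite_set_subsets_law[OF K_le])

lemma normal_upd: "normal \<eta> (J(i := S)) X i = normal \<eta> J X i"
  by (simp add: normal_def)

lemma light_rows_upd: "light_rows \<theta> \<eta> (J(i := S)) X i = light_rows \<theta> \<eta> J X i"
  by (simp add: light_rows_def normal_upd)

lemma light_rows_subset: "light_rows \<theta> \<eta> J X i \<subseteq> {..<n}"
  by (auto simp: light_rows_def)

text \<open>The light rows are fixed before \<open>J i\<close> is drawn. At least \<alpha>n/2 of
  them give a mean of at least \<alpha>K/2, so the event is a drop below half the mean.\<close>

lemma prob_few_hits: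
  assumes "i < n"
  shows "measure_pmf.prob law {\<omega>. few_hits \<theta> \<omega> i} \<le> 8 / (\<alpha> * real K)"
  unfolding law_eq
proof (rule prob_pair_pmf_le_fst)
  show nonneg: "0 \<le> 8 / (\<alpha> * real K)" using \<alpha>_pos by simp
  fix \<eta> :: "nat \<times> nat \<Rightarrow> real"
  show "measure_pmf.prob (pair_pmf (subsets_law n K) (Pi_pmf ({..<K} \<times> {..<n}) 0 (\<lambda>_. rademacher)))
      {y. (\<eta>, y) \<in> {\<omega>. few_hits \<theta> \<omega> i}} \<le> 8 / (\<alpha> * real K)"
  proof (rule prob_pair_pmf_le_snd[OF _ nonneg])
    fix X :: "nat \<times> nat \<Rightarrow> real"
    show "measure_pmf.prob (subsets_law n K) {J. (J, X) \<in> {y. (\<eta>, y) \<in> {\<omega>. few_hits \<theta> \<omega> i}}}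
        \<le> 8 / (\<alpha> * real K)"
      unfolding subsets_law_def
    proof (rule prob_Pi_pmf_coordinate_le[OF _ _ _ nonneg])
      show "finite {..<n}" "i \<in> {..<n}" using assms by auto
      fix J :: "nat \<Rightarrow> nat set"
      define T where "T = light_rows \<theta> \<eta> J X i"
      define \<mu> where "\<mu> = real K * real (card T) / real n"
      have eq: "{S. J(i := S) \<in> {J. (J, X) \<in> {y. (\<eta>, y) \<in> {\<omega>. few_hits \<theta> \<omega> i}}}}
          = {S. \<alpha> * real n / 2 \<le> real (card T) \<and> real (card (S \<inter> T)) < \<alpha> * real K / 4}"
        by (simp add: few_hits_def light_rows_upd T_def)
      show "measure_pmf.prob (pmf_of_set (card_subsets n K))
          {S. J(i := S) \<in> {J. (J, X) \<in> {y. (\<eta>, y) \<in> {\<omega>. few_hits \<theta> \<omega> i}}}} \<le> 8 / (\<alpha> * real K)"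
      proof (cases "\<alpha> * real n / 2 \<le> real (card T)")
        case True
        have "real K * (\<alpha> * real n / 2) \<le> real K * real (card T)"
          using True by (rule mult_left_mono) simp
        then have \<mu>: "\<alpha> * real K / 2 \<le> \<mu>"
          using n_pos by (simp add: \<mu>_def field_simps)
        have aK: "0 < \<alpha> * real K" using \<alpha>_pos K_pos by simp
        have "0 < \<alpha> * real n / 2" using \<alpha>_pos n_pos by simp
        then have "0 < card T" using True by linarith
        then have "measure_pmf.prob (pmf_of_set (card_subsets n K)) {S. real (card (S \<inter> T)) < \<mu> / 2} \<le> 4 / \<mu>"
          unfolding \<mu>_def T_def
          by (intro prob_hypergeometric_lower K_pos K_le light_rows_subset)
        moreover have "4 / \<mu> \<le> 4 / (\<alpha> * real K / 2)"
          using \<mu> aK by (intro divide_left_mono) auto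
        moreover have "measure_pmf.prob (pmf_of_set (card_subsets n K))
            {S. \<alpha> * real n / 2 \<le> real (card T) \<and> real (card (S \<inter> T)) < \<alpha> * real K / 4}
            \<le> measure_pmf.prob (pmf_of_set (card_subsets n K)) {S. real (card (S \<inter> T)) < \<mu> / 2}"
          using \<mu> by (intro measure_pmf.finite_measure_mono) auto
        ultimately show ?thesis unfolding eq by simp
      next
        case False
        then show ?thesis unfolding eq using nonneg by simp
      qed
    qed
  qed
qed

text \<open>Conditioned on all but the signs of column \<open>i\<close>, the normal vector is fixed
  and its pairing with the column is an affine form in these signs. The hits supply at least
  \<alpha>K/4 coefficients of size \<open>r\<close>, and the Littlewood-Offord bound
  applies.\<close>

lemma prob_concentrated:
  assumes i: "i < n" and "0 < \<theta>"
  shows "measure_pmf.prob law {\<omega>. concentrated \<theta> \<omega> i} \<le> 2 / sqrt (\<alpha> * real K)"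
  unfolding law_eq
proof (rule prob_pair_pmf_le_fst)
  show nonneg: "0 \<le> 2 / sqrt (\<alpha> * real K)" using \<alpha>_pos by simp
  fix \<eta> :: "nat \<times> nat \<Rightarrow> real"
  show "measure_pmf.prob (pair_pmf (subsets_law n K) (Pi_pmf ({..<K} \<times> {..<n}) 0 (\<lambda>_. rademacher)))
      {y. (\<eta>, y) \<in> {\<omega>. concentrated \<theta> \<omega> i}} \<le> 2 / sqrt (\<alpha> * real K)"
  proof (rule prob_pair_pmf_le_fst[OF _ nonneg])
    fix J assume "J \<in> set_pmf (subsets_law n K)"
    note Ji = set_subsets_law[OF K_le this i]
    have finJ: "finite (J i)" using Ji(1) finite_subset by blast
    let ?A = "{..<K} \<times> ({..<n} - {i})" and ?B = "{..<K} \<times> {i}"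
    have un: "{..<K} \<times> {..<n} = ?A \<union> ?B" using i by auto
    show "measure_pmf.prob (Pi_pmf ({..<K} \<times> {..<n}) 0 (\<lambda>_. rademacher))
        {X. (J, X) \<in> {y. (\<eta>, y) \<in> {\<omega>. concentrated \<theta> \<omega> i}}} \<le> 2 / sqrt (\<alpha> * real K)"
      unfolding un
    proof (rule prob_Pi_pmf_split_le[OF _ _ _ _ nonneg])
      fix f :: "nat \<times> nat \<Rightarrow> real"
      define Xg where "Xg g p = (if p \<in> ?A then f p else g p)" for g :: "nat \<times> nat \<Rightarrow> real" and p
      define u where "u = normal \<eta> J f i"
      define T where "T = light_rows \<theta> \<eta> J f i"
      have u: "normal \<eta> J (Xg g) i = u" for g
        unfolding u_def normal_def Xg_def by (simp cong: if_cong)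
      have T: "light_rows \<theta> \<eta> J (Xg g) i = T" for g
        unfolding T_def light_rows_def u by (simp add: u_def)
      let ?s = "\<lambda>l. sorted_list_of_set (J i) ! l"
      define b where "b = (\<Sum>j<n. (A j i + \<epsilon> * (\<eta> (1, j) * V j i * \<eta> (2, i) / (\<rho> * sqrt (real n)))) * u j)"
      define a where "a p = \<epsilon> * (if L < row_count n J (?s (fst p)) then 0 else u (?s (fst p)) / real L)"
        for p :: "nat \<times> nat"
      define r where "r = \<epsilon> * \<theta> / real L"
      have r: "0 < r" using \<epsilon>_pos assms L_pos by (simp add: r_def)
      have Mt: "Mt \<eta> J (Xg g) u i = b + (\<Sum>p\<in>?B. a p * g p)" for g
      proof -
        have "Mt \<eta> J (Xg g) u i = b + \<epsilon> * (\<Sum>j<n. r2 J (Xg g) j i * u j)"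
          unfolding Mt_def M_def b_def
          by (simp add: sum_distrib_left sum.distrib[symmetric] algebra_simps)
        also have "(\<Sum>j<n. r2 J (Xg g) j i * u j) = (\<Sum>l<K.
            (if L < row_count n J (?s l) then 0 else u (?s l) / real L) * Xg g (l, i))"
          by (rule sum_r2[of J i, OF Ji])
        also have "\<epsilon> * \<dots> = (\<Sum>l<K. a (l, i) * g (l, i))"
          unfolding sum_distrib_left by (intro sum.cong refl) (simp add: a_def Xg_def)
        also have "\<dots> = (\<Sum>p\<in>?B. a p * g p)"
        proof -
          have "?B = (\<lambda>l. (l, i)) ` {..<K}" by auto
          then show ?thesis by (simp add: sum.reindex inj_on_def)
        qed
        finally show ?thesis .
      qed
      have eq: "{g. (\<lambda>x. if x \<in> ?A then f x else g x)
          \<in> {X. (J, X) \<in> {y. (\<eta>, y) \<in> {\<omega>. concentrated \<theta> \<omega> i}}}}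
          = {g. \<alpha> * real K / 4 \<le> real (card (J i \<inter> T)) \<and> \<bar>b + (\<Sum>p\<in>?B. a p * g p)\<bar> < r}"
        unfolding Xg_def[symmetric] by (simp add: concentrated_def u T Mt r_def)
      show "measure_pmf.prob (Pi_pmf ?B 0 (\<lambda>_. rademacher)) {g. (\<lambda>x. if x \<in> ?A then f x else g x)
          \<in> {X. (J, X) \<in> {y. (\<eta>, y) \<in> {\<omega>. concentrated \<theta> \<omega> i}}}} \<le> 2 / sqrt (\<alpha> * real K)"
      proof (cases "\<alpha> * real K / 4 \<le> real (card (J i \<inter> T))")
        case True
        have aK: "0 < \<alpha> * real K" using \<alpha>_pos K_pos by simp
        \<comment> \<open>Each hit light row has full count at most \<open>L\<close>, so it is not
          truncated and contributes a coefficient of size at least \<open>r\<close>.\<close>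
        have "J i \<inter> T \<subseteq> ?s ` fst ` {p \<in> ?B. r \<le> \<bar>a p\<bar>}"
        proof
          fix j assume j: "j \<in> J i \<inter> T"
          then obtain l where l: "l < K" "j = ?s l"
            using bij_betw_nth_sorted[OF finJ] Ji(2) by (auto simp: bij_betw_def)
          have "row_count n J j \<le> L"
            using j i row_count_upd_in[of j J i] by (auto simp: T_def light_rows_def)
          moreover have "\<theta> \<le> \<bar>u j\<bar>" using j by (auto simp: T_def light_rows_def u_def)
          ultimately have "r \<le> \<bar>a (l, i)\<bar>"
            using \<epsilon>_pos L_pos l by (simp add: a_def r_def abs_mult divide_right_mono mult_left_mono)
          then show "j \<in> ?s ` fst ` {p \<in> ?B. r \<le> \<bar>a p\<bar>}" using l by force
        qed
        then have "card (J i \<inter> T) \<le> card (?s ` fst ` {p \<in> ?B. r \<le> \<bar>a p\<bar>})"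
          by (rule card_mono[rotated]) simp
        also have "\<dots> \<le> card {p \<in> ?B. r \<le> \<bar>a p\<bar>}"
          by (rule order_trans[OF card_image_le]) (auto intro: card_image_le)
        finally have "\<alpha> * real K / 4 \<le> real (card {p \<in> ?B. r \<le> \<bar>a p\<bar>}) + 1" using True by linarith
        then have "1 / sqrt (real (card {p \<in> ?B. r \<le> \<bar>a p\<bar>}) + 1) \<le> 1 / sqrt (\<alpha> * real K / 4)"
          using aK by (intro divide_left_mono) auto
        also have "\<dots> = 2 / sqrt (\<alpha> * real K)" by (simp add: real_sqrt_divide)
        finally have "1 / sqrt (real (card {p \<in> ?B. r \<le> \<bar>a p\<bar>}) + 1) \<le> 2 / sqrt (\<alpha> * real K)" .
        moreover have "measure_pmf.prob (Pi_pmf ?B 0 (\<lambda>_. rademacher)) {g. \<bar>b + (\<Sum>p\<in>?B. a p * g p)\<bar> < r}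
            \<le> 1 / sqrt (real (card {p \<in> ?B. r \<le> \<bar>a p\<bar>}) + 1)"
          by (rule littlewood_offord[OF _ r]) simp
        ultimately show ?thesis unfolding eq using True by simp
      next
        case False
        then show ?thesis unfolding eq using nonneg by simp
      qed
    qed auto
  qed
qed

text \<open>Markov's inequality for the total weight, whose mean is at most n exp(3K) / 2^L.\<close>

lemma prob_rows_bad:
  "measure_pmf.prob law {\<omega>. \<not> rows_good \<omega>} \<le> 2 / \<alpha> * (exp (3 * real K) / 2 ^ L)"
  unfolding law_eq
proof (rule prob_pair_pmf_le_fst)
  show nonneg: "0 \<le> 2 / \<alpha> * (exp (3 * real K) / 2 ^ L)" using \<alpha>_pos by simp
  fix \<eta> :: "nat \<times> nat \<Rightarrow> real"
  show "measure_pmf.prob (pair_pmf (subsets_law n K) (Pi_pmf ({..<K} \<times> {..<n}) 0 (\<lambda>_. rademacher)))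
      {y. (\<eta>, y) \<in> {\<omega>. \<not> rows_good \<omega>}} \<le> 2 / \<alpha> * (exp (3 * real K) / 2 ^ L)"
  proof (rule prob_pair_pmf_le_snd[OF _ nonneg])
    fix X :: "nat \<times> nat \<Rightarrow> real"
    have "measure_pmf.prob (subsets_law n K) {J. (J, X) \<in> {y. (\<eta>, y) \<in> {\<omega>. \<not> rows_good \<omega>}}}
        \<le> measure_pmf.expectation (subsets_law n K) (\<lambda>J. (\<Sum>j<n. 4 ^ row_count n J j) / 2 ^ L)
          / (\<alpha> * real n / 2)"
      by (rule prob_markov_finite[OF finite_set_subsets_law[OF K_le]])
        (use \<alpha>_pos n_pos in \<open>auto simp: rows_good_def sum_nonneg\<close>)
    also have "measure_pmf.expectation (subsets_law n K) (\<lambda>J. (\<Sum>j<n. 4 ^ row_count n J j) / 2 ^ L :: real)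
        = (\<Sum>j<n. measure_pmf.expectation (subsets_law n K) (\<lambda>J. 4 ^ row_count n J j)) / 2 ^ L"
      by (simp add: Bochner_Integration.integral_sum
          integrable_measure_pmf_finite[OF finite_set_subsets_law[OF K_le]])
    also have "\<dots> \<le> (\<Sum>j<n. exp (3 * real K)) / 2 ^ L"
      using expectation_power_row_count[OF K_pos K_le]
      by (intro divide_right_mono sum_mono) auto
    finally have "measure_pmf.prob (subsets_law n K) {J. (J, X) \<in> {y. (\<eta>, y) \<in> {\<omega>. \<not> rows_good \<omega>}}}
        \<le> (\<Sum>j<n. exp (3 * real K)) / 2 ^ L / (\<alpha> * real n / 2)"
      using \<alpha>_pos by (simp add: divide_right_mono)
    also have "\<dots> = 2 / \<alpha> * (exp (3 * real K) / 2 ^ L)"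
      using n_pos \<alpha>_pos by (simp add: field_simps)
    finally show "measure_pmf.prob (subsets_law n K) {J. (J, X) \<in> {y. (\<eta>, y) \<in> {\<omega>. \<not> rows_good \<omega>}}}
        \<le> 2 / \<alpha> * (exp (3 * real K) / 2 ^ L)" .
  qed
qed

text \<open>Only the signs \<open>\<eta> (2, i)\<close> remain random. The A and R2 parts form the
  functional \<open>f\<close>; the pattern condition, with the first signs frozen as its diagonal,
  makes \<open>g\<close> large on many indices.\<close>

lemma prob_sparse_bad:
  fixes x :: real
  assumes x: "0 < x" "x \<le> 1" and m: "m = nat \<lfloor>\<alpha> * real n\<rfloor>"
  shows "measure_pmf.prob law {\<omega>. \<not> sparse_good \<omega>}
    \<le> (1 + x) ^ n / x ^ m * ((1 + x) ^ (3 * n) / x ^ (m + 1) * exp (- (\<gamma> * real n) / 5))"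
    (is "_ \<le> ?bd")
  unfolding law_eq
proof (rule prob_pair_pmf_le_snd)
  show nonneg: "0 \<le> ?bd" using x by simp
  fix y :: "(nat \<Rightarrow> nat set) \<times> (nat \<times> nat \<Rightarrow> real)"
  obtain J X where y: "y = (J, X)" by (cases y)
  let ?A = "{1 :: nat} \<times> {..<n}" and ?B = "{2 :: nat} \<times> {..<n}"
  have un: "{1, 2} \<times> {..<n} = ?A \<union> ?B" by auto
  show "measure_pmf.prob (Pi_pmf ({1, 2} \<times> {..<n}) 0 (\<lambda>_. rademacher))
      {\<eta>. (\<eta>, y) \<in> {\<omega>. \<not> sparse_good \<omega>}} \<le> ?bd"
    unfolding un
  proof (rule prob_Pi_pmf_split_le[OF _ _ _ _ nonneg])
    fix h assume "h \<in> set_pmf (Pi_pmf ?A 0 (\<lambda>_. rademacher))"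
    then have h: "h (1, j) \<in> {-1, 1}" if "j < n" for j
      using that by (auto simp: set_Pi_pmf PiE_dflt_def)
    define c where "c = \<epsilon> / (\<rho> * sqrt (real n))"
    define f where "f p j = A j (snd p) + \<epsilon> * r2 J X j (snd p)" for p :: "nat \<times> nat" and j
    define g where "g p j = V j (snd p) * h (1, j)" for p :: "nat \<times> nat" and j
    define U where "U = {u. L2_set u {..<n} = 1 \<and> real (card {j. j < n \<and> u j \<noteq> 0}) \<le> \<alpha> * real n}"
    have cardB: "card {p \<in> ?B. P (snd p)} = card {i. i < n \<and> P i}" for P
    proof (rule bij_betw_same_card[of snd])
      show "bij_betw snd {p \<in> ?B. P (snd p)} {i. i < n \<and> P i}"
        by (rule bij_betw_byWitness[where f' = "Pair 2"]) auto
    qed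
    have c: "0 < c" using \<epsilon>_pos \<rho>_pos n_pos by (simp add: c_def)
    have "{\<eta>2. (\<lambda>x. if x \<in> ?A then h x else \<eta>2 x) \<in> {\<eta>. (\<eta>, y) \<in> {\<omega>. \<not> sparse_good \<omega>}}}
        = {\<eta>2. \<exists>u\<in>U. real (card {p \<in> ?B. c * \<beta> \<le>
            \<bar>(\<Sum>j<n. f p j * u j) + c * \<eta>2 p * (\<Sum>j<n. g p j * u j)\<bar>}) < \<gamma> * real n / 8}"
    proof -
      have Mt: "Mt (\<lambda>x. if x \<in> ?A then h x else \<eta>2 x) J X u i
          = (\<Sum>j<n. f (2, i) j * u j) + c * \<eta>2 (2, i) * (\<Sum>j<n. g (2, i) j * u j)" for \<eta>2 u i
        unfolding Mt_def M_def f_def g_def c_def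
        by (simp add: sum_distrib_left sum.distrib[symmetric] algebra_simps)
      have cards: "card {p \<in> ?B. c * \<beta> \<le> \<bar>(\<Sum>j<n. f p j * u j) + c * \<eta>2 p * (\<Sum>j<n. g p j * u j)\<bar>}
          = card {i. i < n \<and> c * \<beta> \<le> \<bar>Mt (\<lambda>x. if x \<in> ?A then h x else \<eta>2 x) J X u i\<bar>}" for \<eta>2 u
      proof -
        have "{p \<in> ?B. c * \<beta> \<le> \<bar>(\<Sum>j<n. f p j * u j) + c * \<eta>2 p * (\<Sum>j<n. g p j * u j)\<bar>}
          = {p \<in> ?B. c * \<beta> \<le> \<bar>Mt (\<lambda>x. if x \<in> ?A then h x else \<eta>2 x) J X u (snd p)\<bar>}"
          unfolding Mt by auto
        then show ?thesis
          using cardB[of "\<lambda>i. c * \<beta> \<le> \<bar>Mt (\<lambda>x. if x \<in> ?A then h x else \<eta>2 x) J X u i\<bar>"]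
          by (simp only:)
      qed
      show ?thesis
        unfolding cards sparse_good_def y prod.case c_def[symmetric] U_def by (auto simp: not_le)
    qed
    moreover have "measure_pmf.prob (Pi_pmf ?B 0 (\<lambda>_. rademacher))
        {\<eta>2. \<exists>u\<in>U. real (card {p \<in> ?B. c * \<beta> \<le>
            \<bar>(\<Sum>j<n. f p j * u j) + c * \<eta>2 p * (\<Sum>j<n. g p j * u j)\<bar>}) < \<gamma> * real n / 8}
        \<le> (1 + x) ^ n / x ^ m * ((1 + x) ^ (3 * card ?B) / x ^ (m + 1) * exp (- (\<gamma> * real n) / 5))"
    proof (rule prob_sign_cancellation_sparse[OF _ x \<beta>_pos c])
      fix u assume u: "u \<in> U"
      then show "card {j. j < n \<and> u j \<noteq> 0} \<le> m"
        by (simp add: U_def m le_nat_floor)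
      have "\<gamma> * real n \<le> real (card {i. i < n \<and> \<beta> \<le> \<bar>\<Sum>j<n. V j i * (h (1, j) * u j)\<bar>})"
        by (rule V_pattern) (use h u in \<open>auto simp: U_def\<close>)
      then show "\<gamma> * real n \<le> real (card {p \<in> ?B. \<beta> \<le> \<bar>\<Sum>j<n. g p j * u j\<bar>})"
        unfolding g_def using cardB[of "\<lambda>i. \<beta> \<le> \<bar>\<Sum>j<n. V j i * (h (1, j) * u j)\<bar>"]
        by (simp add: mult.assoc)
    qed simp
    ultimately show "measure_pmf.prob (Pi_pmf ?B 0 (\<lambda>_. rademacher))
        {\<eta>2. (\<lambda>x. if x \<in> ?A then h x else \<eta>2 x) \<in> {\<eta>. (\<eta>, y) \<in> {\<omega>. \<not> sparse_good \<omega>}}} \<le> ?bd"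
      by (simp add: card_cartesian_product)
  qed auto
qed

text \<open>Off the two exceptional events a small image forces at least \<alpha>n/2 bad columns.
  The expected number of these is n times the single-column bound, and Markov's inequality gives the
  factor 2/\<alpha>.\<close>

lemma prob_small_image:
  fixes a \<theta> \<kappa> x :: real
  assumes n16: "16 \<le> \<gamma> * real n"
    and a: "0 < a" "a \<le> 1 / 2" "576 * a\<^sup>2 * \<rho>\<^sup>2 < \<beta>\<^sup>2 * \<gamma>"
    and \<theta>: "\<theta> = a * \<epsilon> / sqrt (real n)" and "0 < \<kappa>"
    and x: "0 < x" "x \<le> 1" and m: "m = nat \<lfloor>\<alpha> * real n\<rfloor>"
  shows "measure_pmf.prob law {(\<eta>, J, X). \<exists>v. \<alpha> * real n < real (card {i. i < n \<and> \<kappa> \<le> \<bar>v i\<bar>}) \<and>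
      L2_set (\<lambda>j. \<Sum>i<n. M \<eta> J X j i * v i) {..<n} < \<kappa> * (\<epsilon> * \<theta> / real L)}
    \<le> (1 + x) ^ n / x ^ m * ((1 + x) ^ (3 * n) / x ^ (m + 1) * exp (- (\<gamma> * real n) / 5))
      + 2 / \<alpha> * (exp (3 * real K) / 2 ^ L)
      + 2 / \<alpha> * (8 / (\<alpha> * real K) + 2 / sqrt (\<alpha> * real K))"
    (is "measure_pmf.prob law ?F \<le> ?p1 + ?p2 + 2 / \<alpha> * (?p3 + ?p4)")
proof -
  define B where "B \<omega> = {i. i < n \<and> (few_hits \<theta> \<omega> i \<or> concentrated \<theta> \<omega> i)}" for \<omega>
  have \<theta>_pos: "0 < \<theta>" using a \<epsilon>_pos n_pos by (simp add: \<theta>)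
  \<comment> \<open>Restricting to the support makes \<open>admissible\<close> available.\<close>
  have "measure_pmf.prob law ?F = measure_pmf.prob law (?F \<inter> set_pmf law)"
    by (simp add: measure_Int_set_pmf)
  also have "\<dots> \<le> measure_pmf.prob law ({\<omega>. \<not> sparse_good \<omega>} \<union> {\<omega>. \<not> rows_good \<omega>} \<union>
      {\<omega>. \<alpha> * real n / 2 \<le> real (card (B \<omega>))})"
  proof (rule measure_pmf.finite_measure_mono)
    show "?F \<inter> set_pmf law \<subseteq> {\<omega>. \<not> sparse_good \<omega>} \<union> {\<omega>. \<not> rows_good \<omega>} \<union>
      {\<omega>. \<alpha> * real n / 2 \<le> real (card (B \<omega>))}"
    proof
      fix \<omega> assume \<omega>: "\<omega> \<in> ?F \<inter> set_pmf law"
      obtain \<eta> J X where eq: "\<omega> = (\<eta>, J, X)" by (cases \<omega>) auto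
      have adm: "admissible (\<eta>, J, X)" using \<omega> admissible_law by (auto simp: eq)
      from \<omega> obtain v where v: "\<alpha> * real n < real (card {i. i < n \<and> \<kappa> \<le> \<bar>v i\<bar>})"
        "L2_set (\<lambda>j. \<Sum>i<n. M \<eta> J X j i * v i) {..<n} < \<kappa> * (\<epsilon> * \<theta> / real L)" by (auto simp: eq)
      show "\<omega> \<in> {\<omega>. \<not> sparse_good \<omega>} \<union> {\<omega>. \<not> rows_good \<omega>} \<union>
          {\<omega>. \<alpha> * real n / 2 \<le> real (card (B \<omega>))}"
        using many_bad_columns[OF adm _ _ n16 a \<theta> v(1) \<open>0 < \<kappa>\<close> v(2)]
        by (auto simp: eq B_def)
    qed
  qed simp
  also have "\<dots> \<le> measure_pmf.prob law {\<omega>. \<not> sparse_good \<omega>} + measure_pmf.prob law {\<omega>. \<not> rows_good \<omega>}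
      + measure_pmf.prob law {\<omega>. \<alpha> * real n / 2 \<le> real (card (B \<omega>))}"
    by (rule order_trans[OF measure_Un_le]) (auto intro!: add_right_mono measure_Un_le)
  also have "measure_pmf.prob law {\<omega>. \<alpha> * real n / 2 \<le> real (card (B \<omega>))} \<le> 2 / \<alpha> * (?p3 + ?p4)"
  proof -
    define bad where "bad i \<omega> \<longleftrightarrow> few_hits \<theta> \<omega> i \<or> concentrated \<theta> \<omega> i" for i \<omega>
    have card_B: "real (card (B \<omega>)) = (\<Sum>i<n. indicat_real {\<omega>. bad i \<omega>} \<omega>)" for \<omega>
    proof -
      have "B \<omega> = {..<n} \<inter> {i. bad i \<omega>}" by (auto simp: B_def bad_def)
      then show ?thesis by (simp add: indicator_def)
    qed
    have "measure_pmf.prob law {\<omega>. \<alpha> * real n / 2 \<le> real (card (B \<omega>))}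
        \<le> measure_pmf.expectation law (\<lambda>\<omega>. real (card (B \<omega>))) / (\<alpha> * real n / 2)"
      by (rule prob_markov_finite[OF finite_law]) (use \<alpha>_pos n_pos in auto)
    also have "measure_pmf.expectation law (\<lambda>\<omega>. real (card (B \<omega>)))
        = (\<Sum>i<n. measure_pmf.prob law {\<omega>. bad i \<omega>})"
      unfolding card_B
      by (subst Bochner_Integration.integral_sum) (auto intro: integrable_measure_pmf_finite finite_law)
    also have "\<dots> \<le> (\<Sum>i<n. ?p3 + ?p4)"
    proof (rule sum_mono)
      fix i assume i: "i \<in> {..<n}"
      have "{\<omega>. bad i \<omega>} = {\<omega>. few_hits \<theta> \<omega> i} \<union> {\<omega>. concentrated \<theta> \<omega> i}"
        by (auto simp: bad_def)
      then have "measure_pmf.prob law {\<omega>. bad i \<omega>}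
          \<le> measure_pmf.prob law {\<omega>. few_hits \<theta> \<omega> i} + measure_pmf.prob law {\<omega>. concentrated \<theta> \<omega> i}"
        by (simp add: measure_Un_le)
      then show "measure_pmf.prob law {\<omega>. bad i \<omega>} \<le> ?p3 + ?p4"
        using prob_few_hits[of i \<theta>] prob_concentrated[of i \<theta>] i \<theta>_pos by simp
    qed
    finally have "measure_pmf.prob law {\<omega>. \<alpha> * real n / 2 \<le> real (card (B \<omega>))}
        \<le> (\<Sum>i<n. ?p3 + ?p4) / (\<alpha> * real n / 2)"
      using \<alpha>_pos by (simp add: divide_right_mono)
    also have "\<dots> = 2 / \<alpha> * (?p3 + ?p4)"
    proof -
      have "real n * q / (\<alpha> * real n / 2) = 2 / \<alpha> * q" for q
        using n_pos \<alpha>_pos by (simp add: field_simps)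
      then show ?thesis by simp
    qed
    finally show ?thesis .
  qed
  finally show ?thesis
    using prob_sparse_bad[OF x m] prob_rows_bad by linarith
qed

end

subsection \<open>Matrices and vectors\<close>

lemma l2_norm_conv_L2_set:
  assumes "x \<in> carrier_vec n"
  shows "l2_norm x = L2_set (\<lambda>i. x $ i) {..<n}"
  using assms by (simp add: l2_norm_def L2_set_def scalar_prod_def power2_eq_square lessThan_atLeast0)

lemma mult_mat_vec_index_sum:
  assumes "A \<in> carrier_mat n n" "x \<in> carrier_vec n" "j < n"
  shows "(A *\<^sub>v x) $ j = (\<Sum>i<n. A $$ (j, i) * x $ i)"
  using assms by (simp add: scalar_prod_def lessThan_atLeast0)

lemma l2_norm_mult_mat_vec:
  assumes "A \<in> carrier_mat n n" "x \<in> carrier_vec n"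
  shows "l2_norm (A *\<^sub>v x) = L2_set (\<lambda>j. \<Sum>i<n. A $$ (j, i) * x $ i) {..<n}"
proof -
  have "A *\<^sub>v x \<in> carrier_vec n" using assms by simp
  then have "l2_norm (A *\<^sub>v x) = L2_set (\<lambda>j. (A *\<^sub>v x) $ j) {..<n}" by (rule l2_norm_conv_L2_set)
  also have "\<dots> = L2_set (\<lambda>j. \<Sum>i<n. A $$ (j, i) * x $ i) {..<n}"
    by (rule L2_set_cong) (use assms in \<open>simp_all add: mult_mat_vec_index_sum del: index_mult_mat_vec\<close>)
  finally show ?thesis .
qed

lemma abs_le_L2_set:
  assumes "finite I" "i \<in> I"
  shows "\<bar>f i\<bar> \<le> L2_set f I"
  using member_le_L2_set[OF assms, of "\<lambda>i. \<bar>f i\<bar>"] by (simp add: L2_set_def)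

lemma spectral_norm_bound:
  assumes A: "A \<in> carrier_mat n n"
  shows "L2_set (\<lambda>j. \<Sum>i<n. A $$ (j, i) * y i) {..<n} \<le> spectral_norm A * L2_set y {..<n}"
proof (cases "L2_set y {..<n} = 0")
  case True
  then have "y i = 0" if "i < n" for i using that by (simp add: L2_set_eq_0_iff)
  then show ?thesis using True by (simp add: L2_set_def)
next
  case False
  define q where "q = L2_set y {..<n}"
  have q: "0 < q" using False by (simp add: q_def less_le)
  define x where "x = Matrix.vec n (\<lambda>i. 1 / q * y i)"
  have x: "x \<in> carrier_vec n" by (simp add: x_def)
  have "l2_norm x = L2_set (\<lambda>i. 1 / q * y i) {..<n}"
    unfolding l2_norm_conv_L2_set[OF x] by (rule L2_set_cong) (auto simp: x_def)
  also have "\<dots> = 1 / q * q" unfolding q_def by (rule L2_set_right_distrib[symmetric]) simp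
  finally have x1: "x \<in> unit_sphere n" using q x by (simp add: unit_sphere_def)
  \<comment> \<open>A real supremum dominates its members only if the set is bounded; the sum of the
    absolute entries is a crude bound.\<close>
  have "bdd_above ((\<lambda>x. l2_norm (A *\<^sub>v x)) ` unit_sphere n)"
  proof (rule bdd_aboveI2)
    fix x assume "x \<in> unit_sphere n"
    then have x: "x \<in> carrier_vec n" "L2_set (\<lambda>i. x $ i) {..<n} = 1"
      by (auto simp: unit_sphere_def l2_norm_conv_L2_set)
    have "l2_norm (A *\<^sub>v x) \<le> (\<Sum>j<n. \<bar>\<Sum>i<n. A $$ (j, i) * x $ i\<bar>)"
      unfolding l2_norm_mult_mat_vec[OF A x(1)] by (rule L2_set_le_sum_abs)
    also have "\<dots> \<le> (\<Sum>j<n. \<Sum>i<n. \<bar>A $$ (j, i)\<bar>)"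
    proof (rule sum_mono)
      fix j
      have "\<bar>A $$ (j, i) * x $ i\<bar> \<le> \<bar>A $$ (j, i)\<bar>" if "i < n" for i
        using abs_le_L2_set[of "{..<n}" i "\<lambda>i. x $ i"] that x(2)
        by (simp add: abs_mult mult_left_le)
      then show "\<bar>\<Sum>i<n. A $$ (j, i) * x $ i\<bar> \<le> (\<Sum>i<n. \<bar>A $$ (j, i)\<bar>)"
        by (intro order_trans[OF sum_abs] sum_mono) auto
    qed
    finally show "l2_norm (A *\<^sub>v x) \<le> (\<Sum>j<n. \<Sum>i<n. \<bar>A $$ (j, i)\<bar>)" .
  qed
  then have "l2_norm (A *\<^sub>v x) \<le> spectral_norm A"
    unfolding spectral_norm_def using x1 A by (intro cSUP_upper) auto
  moreover have "l2_norm (A *\<^sub>v x) = 1 / q * L2_set (\<lambda>j. \<Sum>i<n. A $$ (j, i) * y i) {..<n}"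
  proof -
    have "l2_norm (A *\<^sub>v x) = L2_set (\<lambda>j. 1 / q * (\<Sum>i<n. A $$ (j, i) * y i)) {..<n}"
      unfolding l2_norm_mult_mat_vec[OF A x] sum_distrib_left
      by (rule L2_set_cong) (auto simp: x_def intro!: sum.cong)
    also have "\<dots> = 1 / q * L2_set (\<lambda>j. \<Sum>i<n. A $$ (j, i) * y i) {..<n}"
      by (rule L2_set_right_distrib[symmetric]) (use q in simp)
    finally show ?thesis .
  qed
  ultimately show ?thesis using q by (simp add: q_def[symmetric] field_simps)
qed

text \<open>With z the transpose applied to \<open>y\<close>, the squared norm of z is the inner
  product of \<open>y\<close> with the image of z, at most the norm of \<open>y\<close> times c
  times the norm of z.\<close>

lemma L2_bound_transpose:
  fixes a :: "nat \<Rightarrow> nat \<Rightarrow> real"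
  assumes bound: "\<And>x. L2_set (\<lambda>j. \<Sum>i<n. a j i * x i) {..<n} \<le> c * L2_set x {..<n}"
    and "0 \<le> c"
  shows "L2_set (\<lambda>i. \<Sum>j<n. a j i * y j) {..<n} \<le> c * L2_set y {..<n}"
proof -
  define z where "z i = (\<Sum>j<n. a j i * y j)" for i
  define q where "q = L2_set z {..<n}"
  have "q\<^sup>2 = (\<Sum>i<n. z i * z i)" by (simp add: q_def L2_set_def sum_nonneg power2_eq_square)
  also have "\<dots> = (\<Sum>i<n. \<Sum>j<n. y j * (a j i * z i))"
    by (subst (2) z_def) (simp add: sum_distrib_left mult_ac)
  also have "\<dots> = (\<Sum>j<n. \<Sum>i<n. y j * (a j i * z i))" by (rule sum.swap)
  also have "\<dots> = (\<Sum>j<n. y j * (\<Sum>i<n. a j i * z i))" by (simp add: sum_distrib_left)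
  also have "\<dots> \<le> (\<Sum>j<n. \<bar>y j\<bar> * \<bar>\<Sum>i<n. a j i * z i\<bar>)"
    by (rule sum_mono) (metis abs_ge_self abs_mult)
  also have "\<dots> \<le> L2_set y {..<n} * L2_set (\<lambda>j. \<Sum>i<n. a j i * z i) {..<n}"
    by (rule L2_set_mult_ineq)
  also have "\<dots> \<le> L2_set y {..<n} * (c * q)"
    unfolding q_def by (intro mult_left_mono bound) simp
  finally have "q * q \<le> c * L2_set y {..<n} * q" by (simp add: power2_eq_square mult_ac)
  moreover have "0 \<le> q" by (simp add: q_def)
  ultimately have "q \<le> c * L2_set y {..<n}"
    using \<open>0 \<le> c\<close> by (cases "q = 0") (auto intro: mult_right_le_imp_le)
  then show ?thesis by (simp add: q_def z_def[abs_def])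
qed

text \<open>Otherwise the normalised large part of \<open>v\<close> is a sparse unit vector within
  \<nu> of \<open>v\<close>: dropping the small part costs at most \<nu>/2, and so does the
  normalisation.\<close>

lemma Incomp_many_large_coordinates:
  assumes v: "v \<in> Incomp n \<alpha> \<nu>" and \<nu>: "0 < \<nu>" "\<nu> < 1" and n: "0 < n"
  shows "\<alpha> * real n < real (card {i. i < n \<and> \<nu> / (2 * sqrt (real n)) \<le> \<bar>v $ i\<bar>})"
proof (rule ccontr)
  define \<kappa> where "\<kappa> = \<nu> / (2 * sqrt (real n))"
  define T where "T = {i. i < n \<and> \<kappa> \<le> \<bar>v $ i\<bar>}"
  assume "\<not> \<alpha> * real n < real (card {i. i < n \<and> \<nu> / (2 * sqrt (real n)) \<le> \<bar>v $ i\<bar>})"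
  then have cardT: "real (card T) \<le> \<alpha> * real n" by (simp add: T_def \<kappa>_def)
  have vc: "v \<in> carrier_vec n" and v_sphere: "v \<in> unit_sphere n"
    using v by (auto simp: Incomp_def unit_sphere_def)
  then have v1: "L2_set (\<lambda>i. v $ i) {..<n} = 1"
    by (simp add: unit_sphere_def l2_norm_conv_L2_set)
  define y where "y i = (if i \<in> T then v $ i else 0)" for i
  define z where "z i = (if i \<in> T then 0 else v $ i)" for i
  define q where "q = L2_set y {..<n}"
  have vyz: "(\<lambda>i. v $ i) = (\<lambda>i. y i + z i)" by (auto simp: y_def z_def)
  have "(\<Sum>i<n. (z i)\<^sup>2) \<le> (\<Sum>i<n. \<kappa>\<^sup>2)"
  proof (rule sum_mono)
    fix i assume "i \<in> {..<n}"
    then have "\<bar>z i\<bar> \<le> \<bar>\<kappa>\<bar>" using \<nu> by (auto simp: z_def T_def \<kappa>_def)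
    then show "(z i)\<^sup>2 \<le> \<kappa>\<^sup>2" by (simp add: abs_le_square_iff)
  qed
  also have "\<dots> = (\<nu> / 2)\<^sup>2" using n by (simp add: \<kappa>_def power_divide power_mult_distrib)
  finally have z: "L2_set z {..<n} \<le> \<nu> / 2"
    unfolding L2_set_def using \<nu> by (intro real_le_lsqrt) (auto intro: sum_nonneg)
  have "1 \<le> q + L2_set z {..<n}"
    using L2_set_triangle_ineq[of y z "{..<n}"] v1 by (simp add: q_def vyz)
  then have q1: "1 - q \<le> \<nu> / 2" using z by simp
  then have q: "0 < q" using \<nu> by simp
  have "q \<le> L2_set (\<lambda>i. v $ i) {..<n}"
    unfolding q_def L2_set_def by (intro real_sqrt_le_mono sum_mono) (auto simp: y_def)
  then have q2: "q \<le> 1" using v1 by simp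
  define w where "w = Matrix.vec n (\<lambda>i. 1 / q * y i)"
  have wc: "w \<in> carrier_vec n" by (simp add: w_def)
  have "l2_norm w = L2_set (\<lambda>i. 1 / q * y i) {..<n}"
    unfolding l2_norm_conv_L2_set[OF wc] by (rule L2_set_cong) (auto simp: w_def)
  also have "\<dots> = 1 / q * q" unfolding q_def by (rule L2_set_right_distrib[symmetric]) simp
  finally have w1: "w \<in> unit_sphere n" using q wc by (simp add: unit_sphere_def)
  have "num_nonzero w \<le> card T"
    unfolding num_nonzero_def by (rule card_mono) (auto simp: w_def y_def T_def split: if_splits)
  then have sparse: "real (num_nonzero w) \<le> \<alpha> * real n" using cardT by linarith
  have "v - w \<in> carrier_vec n" using vc wc by simp
  then have "l2_norm (v - w) = L2_set (\<lambda>i. (v - w) $ i) {..<n}" by (rule l2_norm_conv_L2_set)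
  also have "\<dots> = L2_set (\<lambda>i. z i + (1 - 1 / q) * y i) {..<n}"
    using vc wc fun_cong[OF vyz] by (intro L2_set_cong refl) (simp add: w_def algebra_simps)
  also have "\<dots> \<le> L2_set z {..<n} + L2_set (\<lambda>i. (1 - 1 / q) * y i) {..<n}"
    by (rule L2_set_triangle_ineq)
  also have "L2_set (\<lambda>i. (1 - 1 / q) * y i) {..<n} = L2_set (\<lambda>i. (1 / q - 1) * y i) {..<n}"
    unfolding L2_set_def by (simp add: power_mult_distrib power2_commute)
  also have "\<dots> = (1 / q - 1) * q"
    unfolding q_def by (rule L2_set_right_distrib[symmetric]) (use q q2 in \<open>simp add: q_def\<close>)
  also have "\<dots> = 1 - q" using q by (simp add: field_simps)
  finally have "l2_norm (v - w) \<le> \<nu>" using z q1 by simp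
  then have "v \<in> Comp n \<alpha> \<nu>" using v_sphere w1 sparse by (auto simp: Comp_def)
  then show False using v by (simp add: Incomp_def)
qed

lemma R2_index:
  assumes "j < n" "i < n"
  shows "R2 n K L (\<eta>, J, X) $$ (j, i) = (if L < row_count n J j \<or> j \<notin> J i then 0
    else \<Sum>l<K. if j = sorted_list_of_set (J i) ! l then X (l, i) / real L else 0)"
proof -
  have "{k. k < n \<and> row (H_bar n J) j $ k \<noteq> 0} = {k. k < n \<and> j \<in> J k}"
    using assms by (auto simp: H_bar_def split: if_splits)
  then have "num_nonzero (row (H_bar n J) j) = row_count n J j"
    by (simp add: num_nonzero_def row_count_def H_bar_def)
  then show ?thesis
    using assms by (simp add: R2_def hadamard_prod_def H_trunc_def R2_bar_def H_bar_def)
qed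

lemma R1_index:
  assumes "V \<in> carrier_mat n n" "j < n" "i < n"
  shows "R1 n \<rho> V (\<eta>, J, X) $$ (j, i) = \<eta> (1, j) * V $$ (j, i) * \<eta> (2, i) / (\<rho> * sqrt (real n))"
proof -
  have "mat_diag n (\<lambda>i. \<eta> (1, i)) * V = Matrix.mat n n (\<lambda>(j, i). \<eta> (1, j) * V $$ (j, i))"
    using assms by (simp add: mat_diag_mult_left)
  then show ?thesis
    using assms by (simp add: R1_def mat_diag_mult_right[where nr = n and n = n])
qed

lemma pattern_matrix_transpose:
  assumes V: "pattern_matrix n \<alpha> \<beta> \<gamma> \<rho> V" and \<eta>: "\<And>j. j < n \<Longrightarrow> \<eta> j \<in> {-1, 1}"
    and u: "L2_set u {..<n} = 1" "real (card {j. j < n \<and> u j \<noteq> 0}) \<le> \<alpha> * real n"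
  shows "\<gamma> * real n \<le> real (card {i. i < n \<and> \<beta> \<le> \<bar>\<Sum>j<n. V $$ (j, i) * (\<eta> j * u j)\<bar>})"
proof -
  define x where "x = Matrix.vec n u"
  have x: "x \<in> carrier_vec n" by (simp add: x_def)
  have Vc: "V \<in> carrier_mat n n" using V by (simp add: pattern_matrix_def)
  have "l2_norm x = L2_set u {..<n}"
    unfolding l2_norm_conv_L2_set[OF x] by (rule L2_set_cong) (auto simp: x_def)
  then have "x \<in> unit_sphere n" using u x by (simp add: unit_sphere_def)
  moreover have "num_nonzero x = card {j. j < n \<and> u j \<noteq> 0}"
    unfolding num_nonzero_def by (rule arg_cong[of _ _ card]) (auto simp: x_def)
  moreover have "\<eta> \<in> {..<n} \<rightarrow> {-1, 1}" using \<eta> by auto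
  ultimately have "\<gamma> * real n
      \<le> real (card {j. j < n \<and> \<beta> \<le> \<bar>(transpose_mat V * mat_diag n \<eta> *\<^sub>v x) $ j\<bar>})"
    using V u(2) unfolding pattern_matrix_def by (metis (no_types, lifting))
  moreover have "(transpose_mat V * mat_diag n \<eta> *\<^sub>v x) $ i = (\<Sum>j<n. V $$ (j, i) * (\<eta> j * u j))"
    if "i < n" for i
  proof -
    have "transpose_mat V * mat_diag n \<eta> = Matrix.mat n n (\<lambda>(i, j). V $$ (j, i) * \<eta> j)"
      using Vc by (subst mat_diag_mult_right[where n = n]) (auto intro!: eq_matI)
    then show ?thesis
      using that mult_mat_vec_index_sum[of "transpose_mat V * mat_diag n \<eta>" n x i] x
      by (simp add: x_def mult.assoc)
  qed
  then have "{j. j < n \<and> \<beta> \<le> \<bar>(transpose_mat V * mat_diag n \<eta> *\<^sub>v x) $ j\<bar>}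
      = {i. i < n \<and> \<beta> \<le> \<bar>\<Sum>j<n. V $$ (j, i) * (\<eta> j * u j)\<bar>}" by auto
  ultimately show ?thesis by simp
qed

section \<open>Numerical estimates\<close>

lemma real_nat_ceiling_le_add_one: "real (nat \<lceil>t\<rceil>) \<le> t + 1" if "0 \<le> t" for t :: real
proof -
  have "real (nat \<lceil>t\<rceil>) = real_of_int \<lceil>t\<rceil>" using that by simp
  then show ?thesis by linarith
qed

lemma exp_minus_le_inverse: "exp (- t) \<le> 1 / t" if "0 < t" for t :: real
proof -
  have "t \<le> exp t" using exp_ge_add_one_self[of t] by linarith
  then show ?thesis using that by (simp add: exp_minus field_simps)
qed

text \<open>For x = \<gamma>/80 the powers of 1+x cost at most \<gamma>n/20 in the exponent. So do
  the powers of 1/x, by the bound on \<alpha> and 2m+1 <= 3\<alpha>n. Half of the gain \<gamma>n/5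
  remains.\<close>

lemma sparse_tail_bound:
  fixes \<alpha> \<gamma> :: real
  assumes "0 < \<gamma>" "\<gamma> < 1" "0 < \<alpha>" "1 \<le> \<alpha> * real n" "\<alpha> < \<gamma> / (60 * ln (80 / \<gamma>))"
    and m: "m = nat \<lfloor>\<alpha> * real n\<rfloor>"
  shows "(1 + \<gamma> / 80) ^ n / (\<gamma> / 80) ^ m * ((1 + \<gamma> / 80) ^ (3 * n) / (\<gamma> / 80) ^ (m + 1) *
    exp (- (\<gamma> * real n) / 5)) \<le> exp (- (\<gamma> * real n / 10))"
proof -
  define l where "l = ln (80 / \<gamma>)"
  have l: "0 < l" using assms by (simp add: l_def)
  have x: "\<gamma> / 80 = exp (- l)" using assms by (simp add: l_def exp_minus)
  have mle: "real m \<le> \<alpha> * real n" using assms by (simp add: m)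
  have "(1 + \<gamma> / 80) ^ n / (\<gamma> / 80) ^ m * ((1 + \<gamma> / 80) ^ (3 * n) / (\<gamma> / 80) ^ (m + 1) *
      exp (- (\<gamma> * real n) / 5))
      = (1 + \<gamma> / 80) ^ (4 * n) / (\<gamma> / 80) ^ (2 * m + 1) * exp (- (\<gamma> * real n) / 5)"
  proof -
    have "4 * n = n + 3 * n" "2 * m + 1 = m + (m + 1)" by simp_all
    then show ?thesis by (simp only: power_add times_divide_times_eq mult.assoc[symmetric])
  qed
  also have "\<dots> \<le> exp (\<gamma> / 80) ^ (4 * n) / (\<gamma> / 80) ^ (2 * m + 1) * exp (- (\<gamma> * real n) / 5)"
    using assms by (intro mult_right_mono divide_right_mono power_mono exp_ge_add_one_self) auto
  also have "\<dots> = exp (\<gamma> * real n / 20 + real (2 * m + 1) * l - \<gamma> * real n / 5)"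
    unfolding x exp_of_nat_mult[symmetric]
    by (simp only: exp_diff[symmetric] exp_add[symmetric]) (simp add: x[symmetric] algebra_simps)
  also have "\<dots> \<le> exp (\<gamma> * real n / 20 + 3 * (\<alpha> * real n) * l - \<gamma> * real n / 5)"
  proof -
    have "real (2 * m + 1) \<le> 3 * (\<alpha> * real n)" using mle assms(4) by simp
    then have "real (2 * m + 1) * l \<le> 3 * (\<alpha> * real n) * l" using l by (intro mult_right_mono) auto
    then show ?thesis by simp
  qed
  also have "\<dots> \<le> exp (- (\<gamma> * real n / 10))"
  proof -
    have "60 * l * \<alpha> \<le> \<gamma>" using assms l by (simp add: l_def[symmetric] field_simps)
    then have "60 * l * \<alpha> * real n \<le> \<gamma> * real n" by (rule mult_right_mono) simp
    then show ?thesis by (simp add: algebra_simps)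
  qed
  finally show ?thesis .
qed

text \<open>Here L >= 5K and ln 2 >= 2/3, so 2^L beats exp(3K) by a factor exp(K/3).\<close>

lemma row_tail_bound:
  assumes "1 \<le> K" "L = nat \<lceil>2 * exp 1 * real K\<rceil>"
  shows "exp (3 * real K) / 2 ^ L \<le> 3 / real K"
proof -
  have "(5::real) / 2 \<le> exp 1" using exp_lower_Taylor_quadratic[of 1] by simp
  then have "5 * real K \<le> 2 * exp 1 * real K" using assms by (intro mult_right_mono) auto
  also have "\<dots> \<le> real L" using assms by (simp add: real_nat_ceiling_ge)
  finally have L: "5 * real K \<le> real L" .
  have "5 * real K * (2 / 3) \<le> real L * ln 2"
    using L ln2_ge_two_thirds by (intro mult_mono) auto
  moreover have "exp (3 * real K) / 2 ^ L = exp (3 * real K - real L * ln 2)"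
    by (simp add: exp_diff exp_of_nat_mult)
  ultimately have "exp (3 * real K) / 2 ^ L \<le> exp (- (real K / 3))" by simp
  also have "\<dots> \<le> 1 / (real K / 3)" using assms by (intro exp_minus_le_inverse) simp
  finally show ?thesis by simp
qed

section \<open>Choice of the constants and conclusion\<close>

theorem theorem7p8:
  fixes \<beta> \<gamma> \<rho> :: real
  assumes "0 < \<beta>" "\<beta> < 1" "0 < \<gamma>" "\<gamma> < 1" "\<rho> > 0"
  shows "\<exists>a1 a2 c1 c2 c3 :: real. a1 > 0 \<and> a2 > 0 \<and> c1 > 0 \<and> c2 > 0 \<and> c3 > 0 \<and>
    (\<forall>(\<delta> :: real) (\<epsilon> :: real) (\<alpha> :: real) (\<nu> :: real) (K :: nat) (L :: nat) (n :: nat)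
       (A :: real Matrix.mat) (V :: real Matrix.mat).
       0 < \<delta> \<longrightarrow> \<delta> < 1 \<longrightarrow> 0 < \<epsilon> \<longrightarrow> \<epsilon> < 1 \<longrightarrow> 0 < \<alpha> \<longrightarrow> \<alpha> < 1 \<longrightarrow> \<alpha> < a1 \<longrightarrow>
       \<nu> = a2 * \<epsilon> \<longrightarrow>
       K = nat \<lceil>c2 / (\<delta>^2 * \<alpha>^3)\<rceil> \<longrightarrow>
       L = nat \<lceil>2 * exp 1 * real K\<rceil> \<longrightarrow>
       real n \<ge> c1 / (\<delta>^5 * \<alpha>^9) \<longrightarrow>
       A \<in> carrier_mat n n \<longrightarrow> spectral_norm A = 1 \<longrightarrow>
       pattern_matrix n \<alpha> \<beta> \<gamma> \<rho> V \<longrightarrow>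
       measure_pmf.prob (perturbation_law n K)
         {\<omega>. (INF v \<in> Incomp n \<alpha> \<nu>.
                 ereal (l2_norm ((A + \<epsilon> \<cdot>\<^sub>m (R1 n \<rho> V \<omega> + R2 n K L \<omega>)) *\<^sub>v v)))
               \<ge> ereal (c3 * \<epsilon>^3 * \<delta>^2 * \<alpha>^3 / real n)}
         \<ge> 1 - \<delta> / 2)"
proof -
  \<comment> \<open>The factor 25 works since 25^2 = 625 exceeds 576; \<open>a1\<close> is the bound
    required by \<open>sparse_tail_bound\<close>.\<close>
  define a where "a = min (1 / 2) (\<beta> * sqrt \<gamma> / (25 * \<rho>))"
  define a1 where "a1 = \<gamma> / (60 * ln (80 / \<gamma>))"
  define c1 where "c1 = 8192 / \<gamma>"
  \<comment> \<open>The denominator is 2 * 7 * 8192: the 2 from \<open>\<kappa>\<close>, the rest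
    from L <= 7K and K <= 8192/d.\<close>
  define c3 where "c3 = a / 114688"
  have a: "0 < a" "a \<le> 1 / 2" using assms by (auto simp: a_def)
  have a': "576 * a\<^sup>2 * \<rho>\<^sup>2 < \<beta>\<^sup>2 * \<gamma>"
  proof -
    have "a * \<rho> \<le> \<beta> * sqrt \<gamma> / (25 * \<rho>) * \<rho>"
      using assms by (intro mult_right_mono) (auto simp: a_def)
    then have "a * \<rho> \<le> \<beta> * sqrt \<gamma> / 25" using assms by simp
    then have "(a * \<rho>)\<^sup>2 \<le> (\<beta> * sqrt \<gamma> / 25)\<^sup>2"
      using a assms by (intro power_mono) auto
    then have "a\<^sup>2 * \<rho>\<^sup>2 \<le> \<beta>\<^sup>2 * \<gamma> / 625"
      using assms by (simp add: power_mult_distrib power_divide)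
    moreover have "0 < \<beta>\<^sup>2 * \<gamma>" using assms by simp
    ultimately show ?thesis by simp
  qed
  have a1: "0 < a1" using assms by (simp add: a1_def)
  have main: "1 - \<delta> / 2 \<le> measure_pmf.prob (perturbation_law n K)
         {\<omega>. (INF v \<in> Incomp n \<alpha> \<nu>.
                 ereal (l2_norm ((A + \<epsilon> \<cdot>\<^sub>m (R1 n \<rho> V \<omega> + R2 n K L \<omega>)) *\<^sub>v v)))
               \<ge> ereal (c3 * \<epsilon>^3 * \<delta>^2 * \<alpha>^3 / real n)}"
    if \<delta>: "0 < \<delta>" "\<delta> < 1" and \<epsilon>: "0 < \<epsilon>" "\<epsilon> < 1" and \<alpha>: "0 < \<alpha>" "\<alpha> < 1" "\<alpha> < a1"
      and \<nu>: "\<nu> = 1 * \<epsilon>" and K: "K = nat \<lceil>4096 / (\<delta>^2 * \<alpha>^3)\<rceil>"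
      and L: "L = nat \<lceil>2 * exp 1 * real K\<rceil>" and n: "c1 / (\<delta>^5 * \<alpha>^9) \<le> real n"
      and A: "A \<in> carrier_mat n n" "spectral_norm A = 1" and V: "pattern_matrix n \<alpha> \<beta> \<gamma> \<rho> V"
    for \<delta> \<epsilon> \<alpha> \<nu> :: real and K L n :: nat and A V :: "real Matrix.mat"
  proof -
    define d where "d = \<delta>\<^sup>2 * \<alpha>^3"
    have d: "0 < d" "d \<le> 1"
      using \<delta> \<alpha> by (auto simp: d_def intro!: mult_le_one power_le_one)
    have Kge: "4096 / d \<le> real K" unfolding K d_def by (rule real_nat_ceiling_ge)
    have "4096 \<le> 4096 / d" using d by (simp add: field_simps)
    then have K1: "4096 \<le> real K" using Kge by linarith
    have "real K \<le> 4096 / d + 1"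
      unfolding K d_def using \<delta> \<alpha> by (intro real_nat_ceiling_le_add_one) simp
    then have Kle: "real K \<le> 8192 / d" using \<open>4096 \<le> 4096 / d\<close> by simp
    have "2 * exp 1 * real K \<le> 6 * real K"
      using e_less_272 by (intro mult_right_mono) auto
    moreover have "real L \<le> 2 * exp 1 * real K + 1"
      unfolding L by (intro real_nat_ceiling_le_add_one) simp
    ultimately have L7: "real L \<le> 7 * real K" using K1 by linarith
    have "(5::real) / 2 \<le> exp 1" using exp_lower_Taylor_quadratic[of 1] by simp
    then have "1 * real K \<le> 2 * exp 1 * real K" by (intro mult_right_mono) auto
    then have "real K \<le> real L"
      using real_nat_ceiling_ge[of "2 * exp 1 * real K"] unfolding L[symmetric] by linarith
    then have KL: "K \<le> L" by simp
    \<comment> \<open>The lower bound on \<open>n\<close> enters as n >= c1/(\<delta>\<alpha>) and n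
      >= c1/d. The second gives K <= n, which makes the law meaningful.\<close>
    have pow: "\<delta>^5 * \<alpha>^9 \<le> \<delta> * \<alpha>" "\<delta>^5 * \<alpha>^9 \<le> d"
    proof -
      have "\<delta>^5 \<le> \<delta>^1" "\<alpha>^9 \<le> \<alpha>^1" "\<delta>^5 \<le> \<delta>^2" "\<alpha>^9 \<le> \<alpha>^3"
        using \<delta> \<alpha> by (intro power_decreasing; simp)+
      then show "\<delta>^5 * \<alpha>^9 \<le> \<delta> * \<alpha>" "\<delta>^5 * \<alpha>^9 \<le> d"
        unfolding d_def using \<delta> \<alpha> by (intro mult_mono; simp)+
    qed
    have dpos: "0 < \<delta>^5 * \<alpha>^9" using \<delta> \<alpha> by simp
    have c1: "0 < c1" "8192 \<le> c1" using assms by (auto simp: c1_def field_simps)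
    have n1: "c1 / (\<delta> * \<alpha>) \<le> real n"
      using pow dpos c1 \<delta> \<alpha> by (intro order_trans[OF _ n] divide_left_mono) auto
    have n2: "c1 / d \<le> real n"
      using pow dpos c1 d by (intro order_trans[OF _ n] divide_left_mono) auto
    have "0 < c1 / d" using c1 d by simp
    then have npos: "0 < n" using n2 by (cases n) auto
    have "8192 / d \<le> c1 / d" using c1 d by (intro divide_right_mono) auto
    then have Kn: "K \<le> n" using Kle n2 by linarith
    have dan: "c1 \<le> real n * (\<delta> * \<alpha>)" using n1 \<delta> \<alpha> by (simp add: field_simps)
    have dn: "c1 \<le> real n * \<delta>"
      using mult_left_mono[of "\<delta> * \<alpha>" \<delta> "real n"] \<delta> \<alpha> dan by (simp add: mult_left_le)
    have an: "c1 \<le> \<alpha> * real n"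
      using mult_left_mono[of "\<delta> * \<alpha>" \<alpha> "real n"] \<delta> \<alpha> dan by (simp add: mult_left_le_one_le mult.commute)
    have nn: "c1 \<le> real n" using dn \<delta> mult_left_mono[of \<delta> 1 "real n"] by simp
    have gn: "8192 \<le> \<gamma> * real n" "8192 \<le> \<gamma> * (real n * \<delta>)"
      using nn dn assms by (simp_all add: c1_def field_simps)
    interpret perturbation_model n K L "\<lambda>j i. A $$ (j, i)" "\<lambda>j i. V $$ (j, i)" \<rho> \<epsilon> \<alpha> \<beta> \<gamma>
    proof
      show "1 \<le> K" using K1 by linarith
      show "L2_set (\<lambda>i. \<Sum>j<n. A $$ (j, i) * y j) {..<n} \<le> L2_set y {..<n}" for y
        using L2_bound_transpose[where n = n and a = "\<lambda>j i. A $$ (j, i)" and c = 1] spectral_norm_bound[OF A(1)] A(2) by simp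
      have Vc: "V \<in> carrier_mat n n" and Vn: "spectral_norm V \<le> \<rho> * sqrt (real n)"
        using V by (auto simp: pattern_matrix_def)
      have V_bound: "L2_set (\<lambda>j. \<Sum>i<n. V $$ (j, i) * y i) {..<n} \<le> \<rho> * sqrt (real n) * L2_set y {..<n}" for y
        by (rule order_trans[OF spectral_norm_bound[OF Vc]]) (intro mult_right_mono Vn, simp)
      show "L2_set (\<lambda>i. \<Sum>j<n. V $$ (j, i) * y j) {..<n} \<le> \<rho> * sqrt (real n) * L2_set y {..<n}" for y
        by (rule L2_bound_transpose[where a = "\<lambda>j i. V $$ (j, i)", OF V_bound]) (use assms in simp)
      show "\<gamma> * real n \<le> real (card {i. i < n \<and> \<beta> \<le> \<bar>\<Sum>j<n. V $$ (j, i) * (\<eta> j * u j)\<bar>})"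
        if "\<And>j. j < n \<Longrightarrow> \<eta> j \<in> {-1, 1}" "L2_set u {..<n} = 1"
          "real (card {j. j < n \<and> u j \<noteq> 0}) \<le> \<alpha> * real n" for \<eta> u
        using V that by (rule pattern_matrix_transpose)
    qed (use npos Kn KL assms \<epsilon> \<alpha> in auto)
    define \<theta> where "\<theta> = a * \<epsilon> / sqrt (real n)"
    define \<kappa> where "\<kappa> = \<nu> / (2 * sqrt (real n))"
    define m where "m = nat \<lfloor>\<alpha> * real n\<rfloor>"
    have \<kappa>: "0 < \<kappa>" using \<epsilon> npos by (simp add: \<kappa>_def \<nu>)
    define F where "F = {(\<eta>, J, X). \<exists>v. \<alpha> * real n < real (card {i. i < n \<and> \<kappa> \<le> \<bar>v i\<bar>}) \<and>
      L2_set (\<lambda>j. \<Sum>i<n. M \<eta> J X j i * v i) {..<n} < \<kappa> * (\<epsilon> * \<theta> / real L)}"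
    have "measure_pmf.prob law F
        \<le> (1 + \<gamma> / 80) ^ n / (\<gamma> / 80) ^ m * ((1 + \<gamma> / 80) ^ (3 * n) / (\<gamma> / 80) ^ (m + 1) *
            exp (- (\<gamma> * real n) / 5))
          + 2 / \<alpha> * (exp (3 * real K) / 2 ^ L)
          + 2 / \<alpha> * (8 / (\<alpha> * real K) + 2 / sqrt (\<alpha> * real K))"
      unfolding F_def
      by (rule prob_small_image[OF _ a a' \<theta>_def \<kappa> _ _ m_def]) (use gn assms in auto)
    \<comment> \<open>The budget \<delta>/2 is split into \<delta>/8 for sparse vectors, \<delta>/8
      for heavy rows and \<delta>/4 for single columns.\<close>
    also have "\<dots> \<le> \<delta> / 8 + \<delta> / 8 + (\<delta> / 8 + \<delta> / 8)"
    proof (intro add_mono)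
      have "(1 + \<gamma> / 80) ^ n / (\<gamma> / 80) ^ m * ((1 + \<gamma> / 80) ^ (3 * n) / (\<gamma> / 80) ^ (m + 1) *
            exp (- (\<gamma> * real n) / 5)) \<le> exp (- (\<gamma> * real n / 10))"
        by (rule sparse_tail_bound) (use assms \<alpha> an c1 in \<open>auto simp: m_def a1_def\<close>)
      also have "\<dots> \<le> 1 / (\<gamma> * real n / 10)" using assms npos by (intro exp_minus_le_inverse) simp
      also have "\<dots> \<le> \<delta> / 8" using gn assms npos by (simp add: field_simps)
      finally show "(1 + \<gamma> / 80) ^ n / (\<gamma> / 80) ^ m * ((1 + \<gamma> / 80) ^ (3 * n) / (\<gamma> / 80) ^ (m + 1) *
            exp (- (\<gamma> * real n) / 5)) \<le> \<delta> / 8" .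
      have Kd: "4096 \<le> real K * d" using Kge d by (simp add: field_simps)
      have invK: "1 / real K \<le> d / 4096" using Kd K1 by (simp add: field_simps)
      have d1: "d \<le> \<delta> * \<alpha>" "d \<le> \<delta> * \<alpha>\<^sup>2"
      proof -
        have "\<delta>\<^sup>2 \<le> \<delta>^1" "\<alpha>^3 \<le> \<alpha>^1" "\<alpha>^3 \<le> \<alpha>^2" using \<delta> \<alpha> by (intro power_decreasing; simp)+
        then show "d \<le> \<delta> * \<alpha>" "d \<le> \<delta> * \<alpha>\<^sup>2"
          unfolding d_def using \<delta> \<alpha> by (intro mult_mono; simp)+
      qed
      have "exp (3 * real K) / 2 ^ L \<le> 3 / real K" using K1 L by (intro row_tail_bound) auto
      also have "\<dots> \<le> 3 * (\<delta> * \<alpha> / 4096)" using invK d1 by simp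
      finally have "2 / \<alpha> * (exp (3 * real K) / 2 ^ L) \<le> 2 / \<alpha> * (3 * (\<delta> * \<alpha> / 4096))"
        using \<alpha> by (intro mult_left_mono) auto
      also have "\<dots> \<le> \<delta> / 8" using \<alpha> \<delta> by simp
      finally show "2 / \<alpha> * (exp (3 * real K) / 2 ^ L) \<le> \<delta> / 8" .
      have "8 / (\<alpha> * real K) = 8 / \<alpha> * (1 / real K)" by simp
      also have "\<dots> \<le> 8 / \<alpha> * (\<delta> * \<alpha>\<^sup>2 / 4096)" using invK d1 \<alpha> by (intro mult_left_mono) auto
      also have "\<dots> = \<delta> * \<alpha> / 512" using \<alpha> by (simp add: power2_eq_square)
      finally have t1: "2 / \<alpha> * (8 / (\<alpha> * real K)) \<le> 2 / \<alpha> * (\<delta> * \<alpha> / 512)"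
        using \<alpha> by (intro mult_left_mono) auto
      \<comment> \<open>The dominant Littlewood-Offord term fixes c2 = 4096 = 64^2; it becomes
        \<delta>/16.\<close>
      have "(64 / (\<delta> * \<alpha>))\<^sup>2 \<le> \<alpha> * real K"
      proof -
        have "(64 / (\<delta> * \<alpha>))\<^sup>2 = \<alpha> * (4096 / d)"
          using \<alpha> \<delta> by (simp add: d_def power_divide power_mult_distrib power2_eq_square power3_eq_cube)
        also have "\<dots> \<le> \<alpha> * real K" using Kge \<alpha>(1) by (intro mult_left_mono) auto
        finally show ?thesis .
      qed
      then have "64 / (\<delta> * \<alpha>) \<le> sqrt (\<alpha> * real K)" by (rule real_le_rsqrt)
      then have "2 / sqrt (\<alpha> * real K) \<le> 2 / (64 / (\<delta> * \<alpha>))"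
        using \<alpha> \<delta> K1 by (intro divide_left_mono) auto
      then have t2: "2 / \<alpha> * (2 / sqrt (\<alpha> * real K)) \<le> 2 / \<alpha> * (2 / (64 / (\<delta> * \<alpha>)))"
        using \<alpha> by (intro mult_left_mono) auto
      have e: "2 / \<alpha> * (\<delta> * \<alpha> / 512) = \<delta> / 256" "2 / \<alpha> * (2 / (64 / (\<delta> * \<alpha>))) = \<delta> / 16"
        using \<alpha> by simp_all
      have "2 / \<alpha> * (8 / (\<alpha> * real K) + 2 / sqrt (\<alpha> * real K)) \<le> \<delta> / 256 + \<delta> / 16"
        unfolding distrib_left by (rule add_mono[OF t1[unfolded e] t2[unfolded e]])
      also have "\<dots> \<le> \<delta> / 8 + \<delta> / 8" using \<delta> by simp
      finally show "2 / \<alpha> * (8 / (\<alpha> * real K) + 2 / sqrt (\<alpha> * real K)) \<le> \<delta> / 8 + \<delta> / 8" .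
    qed
    finally have F: "measure_pmf.prob law F \<le> \<delta> / 2" by simp
    define G where "G = {\<omega>. (INF v \<in> Incomp n \<alpha> \<nu>.
                 ereal (l2_norm ((A + \<epsilon> \<cdot>\<^sub>m (R1 n \<rho> V \<omega> + R2 n K L \<omega>)) *\<^sub>v v)))
               \<ge> ereal (c3 * \<epsilon>^3 * \<delta>^2 * \<alpha>^3 / real n)}"
    \<comment> \<open>\<open>F\<close> quantifies over all vectors with many large coordinates, so
      one exceptional event serves all incompressible \<open>v\<close>.\<close>
    have "- F \<subseteq> G"
    proof
      fix \<omega> assume \<omega>F: "\<omega> \<in> - F"
      obtain \<eta> J X where \<omega>: "\<omega> = (\<eta>, J, X)" by (cases \<omega>) auto
      have "c3 * \<epsilon>^3 * \<delta>^2 * \<alpha>^3 / real n \<le> l2_norm ((A + \<epsilon> \<cdot>\<^sub>m (R1 n \<rho> V \<omega> + R2 n K L \<omega>)) *\<^sub>v v)"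
        if v: "v \<in> Incomp n \<alpha> \<nu>" for v
      proof -
        have Vc: "V \<in> carrier_mat n n" using V by (simp add: pattern_matrix_def)
        have vc: "v \<in> carrier_vec n" using v by (simp add: Incomp_def unit_sphere_def)
        have R1c: "R1 n \<rho> V \<omega> \<in> carrier_mat n n" 
          by (intro carrier_matI) (simp_all add: R1_def \<omega> mat_diag_def)
        have R2c: "R2 n K L \<omega> \<in> carrier_mat n n"
          by (simp add: R2_def \<omega> hadamard_prod_def H_trunc_def)
        let ?M = "A + \<epsilon> \<cdot>\<^sub>m (R1 n \<rho> V \<omega> + R2 n K L \<omega>)"
        have Mc: "?M \<in> carrier_mat n n" using A R1c R2c by simp
        have "?M $$ (j, i) = M \<eta> J X j i" if "j < n" "i < n" for j i
          using that A R1c R2c R1_index[OF Vc that, of \<rho> \<eta> J X] R2_index[OF that, of K L \<eta> J X]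
          by (simp add: M_def r2_def \<omega>)
        then have "l2_norm (?M *\<^sub>v v) = L2_set (\<lambda>j. \<Sum>i<n. M \<eta> J X j i * v $ i) {..<n}"
          unfolding l2_norm_mult_mat_vec[OF Mc vc] by (intro L2_set_cong refl sum.cong) auto
        moreover have "\<alpha> * real n < real (card {i. i < n \<and> \<kappa> \<le> \<bar>v $ i\<bar>})"
          unfolding \<kappa>_def by (rule Incomp_many_large_coordinates[OF v]) (use \<epsilon> npos in \<open>auto simp: \<nu>\<close>)
        moreover have "\<not> (\<alpha> * real n < real (card {i. i < n \<and> \<kappa> \<le> \<bar>w i\<bar>}) \<and>
            L2_set (\<lambda>j. \<Sum>i<n. M \<eta> J X j i * w i) {..<n} < \<kappa> * (\<epsilon> * \<theta> / real L))" for w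
          using \<omega>F unfolding F_def \<omega> by blast
        from this[of "\<lambda>i. v $ i"] calculation
        have "\<kappa> * (\<epsilon> * \<theta> / real L) \<le> l2_norm (?M *\<^sub>v v)" by linarith
        moreover have "c3 * \<epsilon>^3 * \<delta>^2 * \<alpha>^3 / real n \<le> \<kappa> * (\<epsilon> * \<theta> / real L)"
        proof -
          have "real L * d \<le> 7 * (8192 / d) * d"
            using L7 Kle d by (intro mult_right_mono) auto
          then have "real L * d \<le> 57344" using d by simp
          then have "d / 57344 \<le> 1 / real L" using L_pos by (simp add: field_simps)
          then have "a * \<epsilon>^3 / (2 * real n) * (d / 57344) \<le> a * \<epsilon>^3 / (2 * real n) * (1 / real L)"
            using a \<epsilon> by (intro mult_left_mono) auto
          moreover have "a * \<epsilon>^3 / (2 * real n) * (d / 57344) = c3 * \<epsilon>^3 * \<delta>^2 * \<alpha>^3 / real n"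
            by (simp add: c3_def d_def)
          moreover have "a * \<epsilon>^3 / (2 * real n) * (1 / real L) = \<kappa> * (\<epsilon> * \<theta> / real L)"
          proof -
            have "1 * \<epsilon> / (2 * s) * (\<epsilon> * (a * \<epsilon> / s) / l) = a * \<epsilon>^3 / (2 * (s * s)) * (1 / l)" for s l
              by (simp add: power3_eq_cube mult_ac)
            from this[of "sqrt (real n)" "real L"] show ?thesis by (simp add: \<kappa>_def \<theta>_def \<nu>)
          qed
          ultimately show ?thesis by simp
        qed
        ultimately show ?thesis by linarith
      qed
      \<comment> \<open>The infimum is taken in \<open>ereal\<close>, so an empty
        \<open>Incomp\<close> gives infinity and a pointwise bound suffices.\<close>
      then show "\<omega> \<in> G" by (simp add: G_def le_INF_iff)
    qed
    then have "measure_pmf.prob law (- F) \<le> measure_pmf.prob law G"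
      by (intro measure_pmf.finite_measure_mono) auto
    moreover have "measure_pmf.prob law (- F) = 1 - measure_pmf.prob law F"
      using measure_pmf.prob_compl[of F law] by (simp add: Compl_eq_Diff_UNIV)
    ultimately show ?thesis using F unfolding G_def by linarith
  qed
  have c1: "0 < c1" and c3: "0 < c3" using assms a by (auto simp: c1_def c3_def)
  show ?thesis
  proof (rule exI[of _ a1], rule exI[of _ "1::real"], rule exI[of _ c1], rule exI[of _ "4096::real"],
      rule exI[of _ c3], intro conjI allI impI)
    show "0 < a1" "0 < c1" "0 < c3" by (fact a1 c1 c3)+
    show "(0::real) < 1" "(0::real) < 4096" by simp_all
  qed (rule main)
qed

end
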